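(* Let $X\subset\mathbb{R}^N$ and $Y\subset\mathbb{R}^P$ be locally finite geometric simplicial complexes and let $f\colon X\to Y$ be a surjective simplicial map with finite fibres. Let $C$ be either of the two first quadrant double complexes $$C_{p,q}=C_p(W^{q+1}(f)),\quad d'=\partial^{q+1}_p,\quad d''=\varrho^{q+1}_p\qquad\text{or}\qquad C_{p,q}=C_p^{\mathrm{Alt}}(D^{q+1}(f)),\quad d'=\partial^{q+1}_p,\quad d''=\epsilon^{q+1}_p$$ ($p,q\ge 0$, with $d''=0$ on $C_{p,0}$). Then the first spectral sequence ${}^{I}E^r_{p,q}$ of $C$ collapses onto the $p$-axis (i.e. ${}^{I}E^2_{p,q}=0$ for all $q\ne 0$), and $${}^{I}E^2_{n,0}\cong H_n(\mathrm{Tot}(C))\cong H_n(Y).$$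
   Context: A simplicial map sends the vertices of each simplex to vertices of a simplex and is affine on each simplex. For $k\ge 1$, $W^k(f)=\{(x_1,\dots,x_k)\in X^k : f(x_1)=\dots=f(x_k)\}$, and $D^k(f)$ is the closure in $X^k$ of $\{(x_1,\dots,x_k)\in X^k : f(x_1)=\dots=f(x_k),\ x_i\ne x_j \text{ for } i\neq j\}$; by convention $W^1(f)=D^1(f)=X$. The symmetric group $S_k$ acts on both by permuting components. $\pi_\ell$ is the $\ell$-th projection to $X$; $\varepsilon^{i,k}$ forgets the $i$-th component (mapping $W^k(f)\to W^{k-1}(f)$ and $D^k(f)\to D^{k-1}(f)$), and $\varepsilon^k=\varepsilon^{k,k}$. Associated triangulation: for a point $x$ of a simplicial complex let $\Gamma_x$ be the unique geometric simplex containing $x$ in its interior. Let $\mathbf{x}\in W^k(f)$, $y=f(\pi_1(\mathbf{x}))$ and let $w_0,\dots,w_n$ be the vertices of $\Gamma_y$. For each $\ell$, $f$ maps $\Gamma_{\pi_\ell(\mathbf{x})}$ isomorphically onto $\Gamma_y$; let $v^{(\ell)}_j$ be the vertex of $\Gamma_{\pi_\ell(\mathbf{x})}$ with $f(v^{(\ell)}_j)=w_j$. Let $\Gamma^{(k)}_{\mathbf{x}}$ be the geometric $n$-simplex with vertices $(v^{(1)}_j,\dots,v^{(k)}_j)$, $j=0,\dots,n$. The simplices of $W^k(f)$ (resp. $D^k(f)$) are the $\Gamma^{(k)}_{\mathbf{x}}$ with $\mathbf{x}\in W^k(f)$ (resp. $\mathbf{x}\in D^k(f)$). This makes $W^k(f)$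 and $D^k(f)$ simplicial complexes, and the $\varepsilon^{i,k}$ simplicial maps. An ordered $n$-simplex $[v_0,\dots,v_n]$ is a geometric $n$-simplex together with an ordering of its vertices. $C_n(\cdot)$ denotes the group of simplicial $n$-chains, namely the free abelian group generated by the ordered $n$-simplices; simplicial maps that are injective on simplices induce chain maps (subscript $\#$, and $\#,n$ in degree $n$) by acting on vertices. $\partial^k_n$ is the usual simplicial boundary on $W^k(f)$ or $D^k(f)$, and $H_*(Y)$ is the homology of the complex of simplicial chains $C_\bullet(Y)$ with the usual boundary. $C_n^{\mathrm{Alt}}(D^k(f))=\{c\in C_n(D^k(f)) : \sigma_\#(c)=\mathrm{sign}(\sigma)c\ \text{for all }\sigma\in S_k\}$. For $k\ge 2$, $\varrho^k_n=(-1)^n\sum_{i=1}^k(-1)^{i-1}\varepsilon^{i,k}_{\#,n}$ on $C_n(W^k(f))$ and $\epsilon^k_n=(-1)^n\varepsilon^k_{\#,n}$ on $C_n^{\mathrm{Alt}}(D^k(f))$. For a first quadrant double complex $(C_{p,q},d',d'')$ with $d'\colon C_{p,q}\to C_{p-1,q}$, $d''\colon C_{p,q}\to C_{p,q-1}$, $d'd''+d''d'=0$, the total complex is $\mathrm{Tot}(C)_n=\bigoplus_{p+q=n}C_{p,q}$ with differential $d'+d''$. The first spectral sequence is the one of the filtration ${}^{I}F^p(\mathrm{Tot}(C)_n)=\bigoplus_{i\le p}C_{i,n-i}$; it has ${}^{I}E^1_{p,q}=H_q(C_{p,*},d'')$ with $d^1$ induced by $d'$, and ${}^{I}E^2_{p,q}=H'_pH''_q(C)$.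 *)

theory Defs
  imports "HOL-Analysis.Analysis" "HOL-Algebra.Free_Abelian_Groups" "HOL-Combinatorics.Permutations"
begin

section \<open>Geometric simplicial complexes and simplicial maps\<close>

text \<open>As in \<^const>\<open>simplicial_complex\<close>, which is restricted to finite complexes, the empty face counts
  as a simplex (of dimension -1). Local finiteness is that of the polyhedron \<open>\<Union>K\<close> with the subspace
  topology.\<close>

definition locally_finite_complex :: "'a::euclidean_space set set \<Rightarrow> bool" where
  "locally_finite_complex K \<longleftrightarrow>
     (\<forall>S\<in>K. \<exists>n. n simplex S) \<and>
     (\<forall>F S. S \<in> K \<and> F face_of S \<longrightarrow> F \<in> K) \<and>
     (\<forall>S S'. S \<in> K \<and> S' \<in> K \<longrightarrow> (S \<inter> S') face_of S) \<and>
     (\<forall>x\<in>\<Union>K. \<exists>U. open U \<and> x \<in> U \<and> finite {S\<in>K. S \<inter> U \<noteq> {}})"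

definition vertices :: "'a::euclidean_space set \<Rightarrow> 'a set" where
  "vertices S = {v. v extreme_point_of S}"

definition simplicial_map ::
  "'a::euclidean_space set set \<Rightarrow> 'b::euclidean_space set set \<Rightarrow> ('a \<Rightarrow> 'b) \<Rightarrow> bool" where
  "simplicial_map K L f \<longleftrightarrow>
     (\<forall>S\<in>K. (\<exists>T\<in>L. f ` vertices S \<subseteq> vertices T) \<and>
        (\<forall>x\<in>S. \<forall>y\<in>S. \<forall>u\<in>{0..1}.
           f ((1 - u) *\<^sub>R x + u *\<^sub>R y) = (1 - u) *\<^sub>R f x + u *\<^sub>R f y))"

definition carrier_simplex :: "'a::euclidean_space set set \<Rightarrow> 'a \<Rightarrow> 'a set" where
  "carrier_simplex K x = (THE S. S \<in> K \<and> x \<in> rel_interior S)"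


section \<open>Multiple point spaces\<close>

text \<open>A point of \<open>X\<^sup>k\<close> is an extensional function on \<open>{1..k}\<close>. For \<open>k = 1\<close> both definitions below
  give all of \<open>X\<^sup>1\<close>.\<close>

definition W_space :: "'a set \<Rightarrow> ('a \<Rightarrow> 'b) \<Rightarrow> nat \<Rightarrow> (nat \<Rightarrow> 'a) set" where
  "W_space X f k = {x \<in> {1..k} \<rightarrow>\<^sub>E X. \<forall>i\<in>{1..k}. \<forall>j\<in>{1..k}. f (x i) = f (x j)}"

definition D_space :: "'a::topological_space set \<Rightarrow> ('a \<Rightarrow> 'b) \<Rightarrow> nat \<Rightarrow> (nat \<Rightarrow> 'a) set" where
  "D_space X f k =
     product_topology (\<lambda>_. top_of_set X) {1..k} closure_of {x \<in> W_space X f k. inj_on x {1..k}}"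

definition forget :: "nat \<Rightarrow> nat \<Rightarrow> (nat \<Rightarrow> 'a) \<Rightarrow> nat \<Rightarrow> 'a" where
  "forget i k x = (\<lambda>j\<in>{1..k - 1}. if j < i then x j else x (Suc j))"

definition permute_components :: "nat \<Rightarrow> (nat \<Rightarrow> nat) \<Rightarrow> (nat \<Rightarrow> 'a) \<Rightarrow> nat \<Rightarrow> 'a" where
  "permute_components k \<sigma> x = (\<lambda>l\<in>{1..k}. x (\<sigma> l))"

text \<open>The vertex set of the simplex \<open>\<Gamma>\<close> through \<open>x\<close> of the associated triangulation: one tuple for
  each vertex \<open>w\<close> of the simplex of \<open>L\<close> carrying \<open>f (x 1)\<close>.\<close>

definition multi_simplex_vertices ::
  "'a::euclidean_space set set \<Rightarrow> 'b::euclidean_space set set \<Rightarrow> ('a \<Rightarrow> 'b) \<Rightarrow> nat \<Rightarrow> (nat \<Rightarrow> 'a)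
     \<Rightarrow> (nat \<Rightarrow> 'a) set" where
  "multi_simplex_vertices K L f k x =
     (\<lambda>w. \<lambda>l\<in>{1..k}. THE v. v \<in> vertices (carrier_simplex K (x l)) \<and> f v = w)
       ` vertices (carrier_simplex L (f (x 1)))"

text \<open>A geometric simplex is determined by its vertices, so from here on a triangulation is
  recorded by the vertex sets of its simplices.\<close>

definition W_simplices ::
  "'a::euclidean_space set set \<Rightarrow> 'b::euclidean_space set set \<Rightarrow> ('a \<Rightarrow> 'b) \<Rightarrow> nat
     \<Rightarrow> (nat \<Rightarrow> 'a) set set" where
  "W_simplices K L f k = multi_simplex_vertices K L f k ` W_space (\<Union>K) f k"

definition D_simplices ::
  "'a::euclidean_space set set \<Rightarrow> 'b::euclidean_space set set \<Rightarrow> ('a \<Rightarrow> 'b) \<Rightarrow> nat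
     \<Rightarrow> (nat \<Rightarrow> 'a) set set" where
  "D_simplices K L f k = multi_simplex_vertices K L f k ` D_space (\<Union>K) f k"


section \<open>Simplicial chains\<close>

text \<open>The chain group is free on all ordered simplices: different orderings of the vertices of one
  simplex are different generators, and no relation is imposed between them.\<close>

definition ordered_simplices :: "'v set set \<Rightarrow> nat \<Rightarrow> 'v list set" where
  "ordered_simplices \<V> n = {vs. length vs = Suc n \<and> distinct vs \<and> set vs \<in> \<V>}"

definition simp_chain_group :: "'v set set \<Rightarrow> nat \<Rightarrow> ('v list \<Rightarrow>\<^sub>0 int) monoid" where
  "simp_chain_group \<V> n = free_Abelian_group (ordered_simplices \<V> n)"

definition simp_boundary :: "nat \<Rightarrow> ('v list \<Rightarrow>\<^sub>0 int) \<Rightarrow> ('v list \<Rightarrow>\<^sub>0 int)" where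
  "simp_boundary n c =
     (if n = 0 then 0
      else frag_extend
        (\<lambda>vs. \<Sum>i\<le>n. frag_cmul ((-1) ^ i) (frag_of (take i vs @ drop (Suc i) vs))) c)"

definition simp_chain_map :: "('v \<Rightarrow> 'w) \<Rightarrow> ('v list \<Rightarrow>\<^sub>0 int) \<Rightarrow> ('w list \<Rightarrow>\<^sub>0 int)" where
  "simp_chain_map g = frag_extend (\<lambda>vs. frag_of (map g vs))"

definition W_chains ::
  "'a::euclidean_space set set \<Rightarrow> 'b::euclidean_space set set \<Rightarrow> ('a \<Rightarrow> 'b) \<Rightarrow> nat \<Rightarrow> nat
     \<Rightarrow> ((nat \<Rightarrow> 'a) list \<Rightarrow>\<^sub>0 int) monoid" where
  "W_chains K L f k n = simp_chain_group (W_simplices K L f k) n"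

definition D_alt_chains ::
  "'a::euclidean_space set set \<Rightarrow> 'b::euclidean_space set set \<Rightarrow> ('a \<Rightarrow> 'b) \<Rightarrow> nat \<Rightarrow> nat
     \<Rightarrow> ((nat \<Rightarrow> 'a) list \<Rightarrow>\<^sub>0 int) monoid" where
  "D_alt_chains K L f k n =
     (let G = simp_chain_group (D_simplices K L f k) n in
      G\<lparr>carrier := {c \<in> carrier G. \<forall>\<sigma>. \<sigma> permutes {1..k} \<longrightarrow>
          simp_chain_map (permute_components k \<sigma>) c = frag_cmul (sign \<sigma>) c}\<rparr>)"

definition rho :: "nat \<Rightarrow> nat \<Rightarrow> ((nat \<Rightarrow> 'a) list \<Rightarrow>\<^sub>0 int) \<Rightarrow> ((nat \<Rightarrow> 'a) list \<Rightarrow>\<^sub>0 int)" where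
  "rho k n c =
     frag_cmul ((-1) ^ n) (\<Sum>i=1..k. frag_cmul ((-1) ^ (i - 1)) (simp_chain_map (forget i k) c))"

definition eps :: "nat \<Rightarrow> nat \<Rightarrow> ((nat \<Rightarrow> 'a) list \<Rightarrow>\<^sub>0 int) \<Rightarrow> ((nat \<Rightarrow> 'a) list \<Rightarrow>\<^sub>0 int)" where
  "eps k n c = frag_cmul ((-1) ^ n) (simp_chain_map (forget k k) c)"


section \<open>Homology and double complexes\<close>

text \<open>Indices are natural numbers, so a differential out of degree 0 formally has the group in degree
  0 as its target; it is required to be zero there.\<close>

definition homology_at ::
  "(nat \<Rightarrow> 'g monoid) \<Rightarrow> (nat \<Rightarrow> 'g \<Rightarrow> 'g) \<Rightarrow> nat \<Rightarrow> 'g set monoid" where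
  "homology_at G d n =
     (G n)\<lparr>carrier := kernel (G n) (G (n - 1)) (d n)\<rparr> Mod (d (Suc n) ` carrier (G (Suc n)))"

definition double_complex ::
  "(nat \<Rightarrow> nat \<Rightarrow> 'g monoid) \<Rightarrow> (nat \<Rightarrow> nat \<Rightarrow> 'g \<Rightarrow> 'g) \<Rightarrow> (nat \<Rightarrow> nat \<Rightarrow> 'g \<Rightarrow> 'g) \<Rightarrow> bool" where
  "double_complex C d' d'' \<longleftrightarrow>
     (\<forall>p q. comm_group (C p q) \<and>
        d' p q \<in> hom (C p q) (C (p - 1) q) \<and>
        d'' p q \<in> hom (C p q) (C p (q - 1)) \<and>
        (\<forall>c\<in>carrier (C p q).
           (p = 0 \<longrightarrow> d' p q c = \<one>\<^bsub>C p q\<^esub>) \<and>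
           (q = 0 \<longrightarrow> d'' p q c = \<one>\<^bsub>C p q\<^esub>) \<and>
           d' (p - 1) q (d' p q c) = \<one>\<^bsub>C (p - 2) q\<^esub> \<and>
           d'' p (q - 1) (d'' p q c) = \<one>\<^bsub>C p (q - 2)\<^esub> \<and>
           d' p (q - 1) (d'' p q c) \<otimes>\<^bsub>C (p - 1) (q - 1)\<^esub> d'' (p - 1) q (d' p q c)
             = \<one>\<^bsub>C (p - 1) (q - 1)\<^esub>))"

text \<open>The component \<open>C\<^sub>i\<^sub>,\<^sub>n\<^sub>-\<^sub>i\<close> of the total complex in degree \<open>n\<close> has index \<open>i\<close>.\<close>

definition Tot :: "(nat \<Rightarrow> nat \<Rightarrow> 'g monoid) \<Rightarrow> nat \<Rightarrow> (nat \<Rightarrow> 'g) monoid" where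
  "Tot C n = sum_group {..n} (\<lambda>i. C i (n - i))"

definition Tot_d ::
  "(nat \<Rightarrow> nat \<Rightarrow> 'g monoid) \<Rightarrow> (nat \<Rightarrow> nat \<Rightarrow> 'g \<Rightarrow> 'g) \<Rightarrow> (nat \<Rightarrow> nat \<Rightarrow> 'g \<Rightarrow> 'g) \<Rightarrow> nat
     \<Rightarrow> (nat \<Rightarrow> 'g) \<Rightarrow> nat \<Rightarrow> 'g" where
  "Tot_d C d' d'' n z =
     (if n = 0 then \<one>\<^bsub>Tot C 0\<^esub>
      else (\<lambda>i\<in>{..n - 1}. d' (Suc i) (n - Suc i) (z (Suc i)) \<otimes>\<^bsub>C i (n - 1 - i)\<^esub> d'' i (n - i) (z i)))"

definition first_filtration :: "(nat \<Rightarrow> nat \<Rightarrow> 'g monoid) \<Rightarrow> int \<Rightarrow> nat \<Rightarrow> (nat \<Rightarrow> 'g) set" where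
  "first_filtration C p n =
     {z \<in> carrier (Tot C n). \<forall>i\<le>n. p < int i \<longrightarrow> z i = \<one>\<^bsub>C i (n - i)\<^esub>}"

text \<open>The spectral sequence of the filtration, in total degree \<open>n = p + q\<close>:
  \<open>Z\<^sup>r\<^sub>p = {z \<in> F\<^sup>p. d z \<in> F\<^sup>p\<^sup>-\<^sup>r}\<close> and \<open>E\<^sup>r\<^sub>p = Z\<^sup>r\<^sub>p / (Z\<^sup>r\<^sup>-\<^sup>1\<^sub>p\<^sub>-\<^sub>1 + d Z\<^sup>r\<^sup>-\<^sup>1\<^sub>p\<^sub>+\<^sub>r\<^sub>-\<^sub>1)\<close>.\<close>

definition first_Z ::
  "(nat \<Rightarrow> nat \<Rightarrow> 'g monoid) \<Rightarrow> (nat \<Rightarrow> nat \<Rightarrow> 'g \<Rightarrow> 'g) \<Rightarrow> (nat \<Rightarrow> nat \<Rightarrow> 'g \<Rightarrow> 'g)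
     \<Rightarrow> int \<Rightarrow> int \<Rightarrow> nat \<Rightarrow> (nat \<Rightarrow> 'g) set" where
  "first_Z C d' d'' r p n =
     {z \<in> first_filtration C p n. Tot_d C d' d'' n z \<in> first_filtration C (p - r) (n - 1)}"

definition first_E ::
  "(nat \<Rightarrow> nat \<Rightarrow> 'g monoid) \<Rightarrow> (nat \<Rightarrow> nat \<Rightarrow> 'g \<Rightarrow> 'g) \<Rightarrow> (nat \<Rightarrow> nat \<Rightarrow> 'g \<Rightarrow> 'g)
     \<Rightarrow> nat \<Rightarrow> nat \<Rightarrow> nat \<Rightarrow> (nat \<Rightarrow> 'g) set monoid" where
  "first_E C d' d'' r p q =
     (let n = p + q; Z = first_Z C d' d'' in
      (Tot C n)\<lparr>carrier := Z (int r) (int p) n\<rparr> Mod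
        (Z (int r - 1) (int p - 1) n <#>\<^bsub>Tot C n\<^esub>
         Tot_d C d' d'' (Suc n) ` Z (int r - 1) (int p + int r - 1) (Suc n)))"

end

theory Submission
  imports Defs
begin

text \<open>An ordered simplex of \<open>W\<^sup>k(f)\<close> is a \<open>k\<close>-tuple of ordered simplices of \<open>X\<close> with the same image in
  \<open>Y\<close>, so a row of the first double complex is the direct sum, over the ordered simplices of \<open>Y\<close>, of the
  complexes of tuples in a nonempty set, augmented to \<open>\<int>\<close>. Putting a chosen simplex of the fibre in front
  of a tuple contracts it. An alternating chain vanishes on tuples with a repeated entry, and tuples
  without repetition always lie in \<open>D\<^sup>k(f)\<close>; hence a row of the second double complex is the subcomplex
  of alternating chains, and the alternating sum of the insertions of the chosen simplex at all positions
  contracts it. Thus both double complexes have exact rows with \<open>C(Y)\<close> as cokernel in degree 0, and the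
  statements on \<open>E\<^sup>2\<close> and on the total complex follow by a diagram chase.\<close>

section \<open>Double complexes with exact rows\<close>

text \<open>Finite fibres make the problem combinatorial: a simplicial map that identifies two
  points of a simplex is constant on the segment between them, so here \<open>f\<close> is injective
  on every simplex. Hence ordered simplices map to ordered simplices of the same dimension, and
  surjectivity gives each ordered simplex of \<open>Y\<close> a lift.

  The lift is chosen separately for each ordered simplex, with no compatibility with faces. The
  contraction therefore does not commute with \<open>d'\<close>, but the diagram chase uses only
  exactness in the direction of \<open>d''\<close>.

  The obstacle in the second complex is that \<open>D^k(f)\<close> is a closure: which tuples with
  repeated entries it contains depends on the geometry of \<open>f\<close>, and inserting a simplex
  may lead out of it. Alternation removes this dependence: the coefficient of a repeated tuple
  equals its own negative, hence is 0 over the integers. So the alternating chains of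
  \<open>D^k(f)\<close> are all those of \<open>W^k(f)\<close>, where insertion is always
  possible.\<close>

lemma (in comm_group) FactGroup_iso_FactGroup_vimage:
  assumes "comm_group H" and M: "subgroup M H"
    and h: "h \<in> hom G H" "h ` carrier G = carrier H"
    and N: "N = {g \<in> carrier G. h g \<in> M}"
  shows "(G Mod N) \<cong> (H Mod M)"
proof -
  interpret H: comm_group H by fact
  interpret M: normal M H using M H.subgroup_imp_normal by blast
  \<comment> \<open>\<open>?k\<close> is \<open>h\<close> followed by the projection to
    \<open>H Mod M\<close>; the claim is the first isomorphism theorem for it.\<close>
  let ?k = "\<lambda>g. M #>\<^bsub>H\<^esub> h g"
  have "?k \<in> hom G (H Mod M)"
    using h(1) M.r_coset_hom_Mod unfolding hom_def by fastforce
  then interpret k: group_hom G "H Mod M" ?k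
    using M.factorgroup_is_group by (simp add: group_hom_def group_hom_axioms_def is_group)
  have "M #>\<^bsub>H\<^esub> y = M \<longleftrightarrow> y \<in> M" if "y \<in> carrier H" for y
    using that M H.coset_join1 H.coset_join2 M.subset by blast
  then have "kernel G (H Mod M) ?k = N"
    using h by (auto simp: kernel_def N)
  moreover have "?k ` carrier G = carrier (H Mod M)"
    by (simp add: carrier_FactGroup image_image flip: h(2))
  ultimately show ?thesis
    using k.FactGroup_iso by simp
qed

lemma (in comm_group) subgroup_is_comm_group:
  assumes "subgroup H G" shows "comm_group (G\<lparr>carrier := H\<rparr>)"
  using assms subgroup.subgroup_is_group[OF assms is_group] subgroup.mem_carrier[OF assms]
  by (auto intro!: group.group_comm_groupI simp: m_comm)

text \<open>All groups \<open>C p q\<close> are subgroups of one additive type, so products and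
  inverses in them, and componentwise in \<open>Tot\<close>, become \<open>+\<close> and
  \<open>-\<close> and are left to arithmetic.\<close>

locale additive_double_complex =
  fixes C :: "nat \<Rightarrow> nat \<Rightarrow> 'g::ab_group_add monoid"
    and d' d'' :: "nat \<Rightarrow> nat \<Rightarrow> 'g \<Rightarrow> 'g"
  assumes double_complex: "double_complex C d' d''"
    and mult_C [simp]: "monoid.mult (C p q) = (+)"
    and one_C [simp]: "one (C p q) = 0"
begin

abbreviation A :: "nat \<Rightarrow> nat \<Rightarrow> 'g set" where "A p q \<equiv> carrier (C p q)"

sublocale C: comm_group "C p q" for p q
  using double_complex by (simp add: double_complex_def)

lemma zero_closed [simp, intro]: "0 \<in> A p q"
  using C.one_closed[of p q] by simp

lemma add_closed [intro]: "x \<in> A p q \<Longrightarrow> y \<in> A p q \<Longrightarrow> x + y \<in> A p q"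
  using C.m_closed[of x p q y] by simp

lemma inv_C [simp]: "x \<in> A p q \<Longrightarrow> inv\<^bsub>C p q\<^esub> x = - x"
  using C.r_inv[of x p q] by (simp add: eq_neg_iff_add_eq_0 add.commute)

lemma uminus_closed [intro]: "x \<in> A p q \<Longrightarrow> - x \<in> A p q"
  using C.inv_closed[of x p q] by simp

lemma diff_closed [intro]: "x \<in> A p q \<Longrightarrow> y \<in> A p q \<Longrightarrow> x - y \<in> A p q"
  using add_closed[of x p q "- y"] by auto

lemma d'_hom: "d' p q \<in> hom (C p q) (C (p - 1) q)"
  and d''_hom: "d'' p q \<in> hom (C p q) (C p (q - 1))"
  using double_complex by (simp_all add: double_complex_def)

lemma d'_closed [intro]: "x \<in> A (Suc p) q \<Longrightarrow> d' (Suc p) q x \<in> A p q"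
  and d''_closed [intro]: "x \<in> A p (Suc q) \<Longrightarrow> d'' p (Suc q) x \<in> A p q"
  using d'_hom[of "Suc p" q] d''_hom[of p "Suc q"] by (auto simp: hom_def)

lemma d'_add: "x \<in> A p q \<Longrightarrow> y \<in> A p q \<Longrightarrow> d' p q (x + y) = d' p q x + d' p q y"
  and d''_add: "x \<in> A p q \<Longrightarrow> y \<in> A p q \<Longrightarrow> d'' p q (x + y) = d'' p q x + d'' p q y"
  using d'_hom[of p q] d''_hom[of p q] by (auto simp: hom_def)

lemma d'_zero [simp]: "d' p q 0 = 0"
  and d''_zero [simp]: "d'' p q 0 = 0"
  using d'_add[of 0 p q 0] d''_add[of 0 p q 0] by auto

lemma d''_uminus: "x \<in> A p q \<Longrightarrow> d'' p q (- x) = - d'' p q x"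
  using d''_add[of x p q "- x"] by (auto simp: eq_neg_iff_add_eq_0 add.commute)

lemma d'_d': "x \<in> A (Suc (Suc p)) q \<Longrightarrow> d' (Suc p) q (d' (Suc (Suc p)) q x) = 0"
  and d''_d'': "x \<in> A p (Suc (Suc q)) \<Longrightarrow> d'' p (Suc q) (d'' p (Suc (Suc q)) x) = 0"
  and d'_d'': "x \<in> A (Suc p) (Suc q) \<Longrightarrow>
     d' (Suc p) q (d'' (Suc p) (Suc q) x) + d'' p (Suc q) (d' (Suc p) (Suc q) x) = 0"
  using double_complex unfolding double_complex_def by (metis diff_Suc_1 mult_C one_C)+

section \<open>The total complex, componentwise\<close>

lemma carrier_Tot: "carrier (Tot C n) = (\<Pi>\<^sub>E i\<in>{..n}. A i (n - i))"
proof -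
  have "finite {i \<in> {..n}. P i}" for P by (rule finite_subset[of _ "{..n}"]) auto
  then show ?thesis
    unfolding Tot_def by (subst carrier_sum_group) (auto simp: C.is_group)
qed

lemma Tot_memD [dest]: "z \<in> carrier (Tot C n) \<Longrightarrow> i \<le> n \<Longrightarrow> z i \<in> A i (n - i)"
  by (auto simp: carrier_Tot)

lemma Tot_memI: "(\<And>i. i \<le> n \<Longrightarrow> z i \<in> A i (n - i)) \<Longrightarrow> (\<lambda>i\<in>{..n}. z i) \<in> carrier (Tot C n)"
  by (auto simp: carrier_Tot)

lemma Tot_eqI:
  "z \<in> carrier (Tot C n) \<Longrightarrow> w \<in> carrier (Tot C n) \<Longrightarrow> (\<And>i. i \<le> n \<Longrightarrow> z i = w i) \<Longrightarrow> z = w"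
  unfolding carrier_Tot by (rule PiE_ext) auto

sublocale T: comm_group "Tot C n" for n
  unfolding Tot_def
  by (rule group.group_comm_groupI)
    (auto simp: C.is_group carrier_Tot[unfolded Tot_def] add.commute)

lemma Tot_mult_nth [simp]: "i \<le> n \<Longrightarrow> (z \<otimes>\<^bsub>Tot C n\<^esub> w) i = z i + w i"
  by (simp add: Tot_def)

lemma Tot_one_nth [simp]: "i \<le> n \<Longrightarrow> \<one>\<^bsub>Tot C n\<^esub> i = 0"
  by (simp add: Tot_def)

lemma Tot_inv_nth [simp]:
  assumes "z \<in> carrier (Tot C n)" "i \<le> n" shows "(inv\<^bsub>Tot C n\<^esub> z) i = - z i"
  using assms Tot_memD[OF assms] unfolding Tot_def
  by (subst inv_sum_group) (simp_all add: C.is_group)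

text \<open>The source degree is \<open>Suc m\<close> and the second index
  \<open>Suc (m - i)\<close>, so that the closure rules, stated at successor indices, apply.\<close>

lemma Tot_d_Suc_nth:
  "i \<le> m \<Longrightarrow> Tot_d C d' d'' (Suc m) z i = d' (Suc i) (m - i) (z (Suc i)) + d'' i (Suc (m - i)) (z i)"
  by (simp add: Tot_d_def Suc_diff_le)

lemma Tot_d_0: "Tot_d C d' d'' 0 z = \<one>\<^bsub>Tot C 0\<^esub>"
  by (simp add: Tot_d_def)

lemma Tot_d_closed [intro]:
  assumes "z \<in> carrier (Tot C n)" shows "Tot_d C d' d'' n z \<in> carrier (Tot C (n - 1))"
proof (cases n)
  case (Suc m)
  have "z i \<in> A i (Suc (m - i))" if "i \<le> m" for i
    using Tot_memD[OF assms, of i] that by (simp add: Suc Suc_diff_le)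
  moreover have "z (Suc i) \<in> A (Suc i) (m - i)" if "i \<le> m" for i
    using Tot_memD[OF assms, of "Suc i"] that by (simp add: Suc)
  ultimately show ?thesis
    by (auto simp: carrier_Tot Suc Tot_d_Suc_nth Tot_d_def Suc_diff_le intro!: add_closed d'_closed d''_closed)
qed (simp add: Tot_d_0)

lemma Tot_d_hom: "Tot_d C d' d'' n \<in> hom (Tot C n) (Tot C (n - 1))"
proof (rule homI)
  fix z w assume zw: "z \<in> carrier (Tot C n)" "w \<in> carrier (Tot C n)"
  show "Tot_d C d' d'' n (z \<otimes>\<^bsub>Tot C n\<^esub> w)
    = Tot_d C d' d'' n z \<otimes>\<^bsub>Tot C (n - 1)\<^esub> Tot_d C d' d'' n w"
  proof (cases n)
    case (Suc m)
    have "u i \<in> A i (Suc (m - i))" if "i \<le> m" "u \<in> carrier (Tot C n)" for i u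
      using Tot_memD[OF that(2), of i] that by (simp add: Suc Suc_diff_le)
    moreover have "u (Suc i) \<in> A (Suc i) (m - i)" if "i \<le> m" "u \<in> carrier (Tot C n)" for i u
      using Tot_memD[OF that(2), of "Suc i"] that by (simp add: Suc)
    moreover have "Tot_d C d' d'' (Suc m) u \<in> carrier (Tot C m)" if "u \<in> carrier (Tot C n)" for u
      using Tot_d_closed[OF that] by (simp add: Suc)
    ultimately show ?thesis
      using T.m_closed zw unfolding Suc diff_Suc_1
      by (intro Tot_eqI) (auto simp: Tot_d_Suc_nth d'_add d''_add algebra_simps)
  qed (simp add: Tot_d_0)
qed (rule Tot_d_closed)

sublocale d: group_hom "Tot C n" "Tot C (n - 1)" "Tot_d C d' d'' n" for n
  by unfold_locales (rule Tot_d_hom)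

text \<open>Component \<open>i\<close> of \<open>d (d z)\<close> involves \<open>z\<close> at
  \<open>i\<close>, \<open>i + 1\<close> and \<open>i + 2\<close>: the outer two give
  \<open>d'' d''\<close> and \<open>d' d'\<close>, the middle one gives the two mixed terms, which
  cancel.\<close>

lemma Tot_d_Tot_d:
  assumes "z \<in> carrier (Tot C (Suc n))"
  shows "Tot_d C d' d'' n (Tot_d C d' d'' (Suc n) z) = \<one>\<^bsub>Tot C (n - 1)\<^esub>"
proof (cases n)
  case (Suc m)
  show ?thesis
  proof (rule Tot_eqI)
    fix i assume "i \<le> n - 1"
    then obtain l where l: "m = i + l" using le_Suc_ex Suc by auto
    have z: "z i \<in> A i (Suc (Suc l))" "z (Suc i) \<in> A (Suc i) (Suc l)" "z (Suc (Suc i)) \<in> A (Suc (Suc i)) l"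
      using Tot_memD[OF assms, of i] Tot_memD[OF assms, of "Suc i"] Tot_memD[OF assms, of "Suc (Suc i)"]
      by (simp_all add: Suc l Suc_diff_le)
    then have "Tot_d C d' d'' n (Tot_d C d' d'' (Suc n) z) i =
       d' (Suc i) l (d' (Suc (Suc i)) l (z (Suc (Suc i)))) + d' (Suc i) l (d'' (Suc i) (Suc l) (z (Suc i)))
        + (d'' i (Suc l) (d' (Suc i) (Suc l) (z (Suc i))) + d'' i (Suc l) (d'' i (Suc (Suc l)) (z i)))"
      by (simp add: Suc l Tot_d_Suc_nth) (subst d'_add d''_add, auto)+
    also have "\<dots> = 0"
      using z d'_d'[of "z (Suc (Suc i))" i l] d''_d''[of "z i" i l] d'_d''[of "z (Suc i)" i l] by simp
    finally show "Tot_d C d' d'' n (Tot_d C d' d'' (Suc n) z) i = \<one>\<^bsub>Tot C (n - 1)\<^esub> i"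
      using \<open>i \<le> n - 1\<close> by simp
  qed (use assms Tot_d_closed[of z "Suc n"] Tot_d_closed in \<open>auto simp del: One_nat_def\<close>)
qed (simp add: Tot_d_0)

section \<open>The first filtration and its groups \<open>Z\<close>\<close>

lemma filtration_iff:
  "z \<in> first_filtration C p n \<longleftrightarrow> z \<in> carrier (Tot C n) \<and> (\<forall>i\<le>n. p < int i \<longrightarrow> z i = 0)"
  by (simp add: first_filtration_def)

lemma subgroup_filtration: "subgroup (first_filtration C p n) (Tot C n)"
  by unfold_locales (auto simp: filtration_iff T.m_closed)

lemma filtration_mono: "p \<le> p' \<Longrightarrow> z \<in> first_filtration C p n \<Longrightarrow> z \<in> first_filtration C p' n"
  by (auto simp: filtration_iff)

lemma filtration_all: "int n \<le> p \<Longrightarrow> first_filtration C p n = carrier (Tot C n)"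
  by (auto simp: filtration_iff)

lemma subgroup_first_Z: "subgroup (first_Z C d' d'' r p n) (Tot C n)"
proof -
  interpret F: subgroup "first_filtration C p n" "Tot C n" by (rule subgroup_filtration)
  interpret F': subgroup "first_filtration C (p - r) (n - 1)" "Tot C (n - 1)" by (rule subgroup_filtration)
  show ?thesis
    by (rule T.subgroupI) (use F.one_closed F'.one_closed F.subset d.hom_one[of n] in \<open>auto simp: first_Z_def subset_eq simp del: One_nat_def intro!: exI[of _ "\<one>\<^bsub>Tot C n\<^esub>"]\<close>)
qed

end

lemma set_multI: "u \<in> H \<Longrightarrow> v \<in> K \<Longrightarrow> u \<otimes>\<^bsub>G\<^esub> v \<in> H <#>\<^bsub>G\<^esub> K"
  by (auto simp: set_mult_def)

text \<open>Exactness along \<open>d''\<close> is asked in second degree at least 1; on the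
  \<open>p\<close>-axis the cokernel of \<open>d''\<close> is what survives.\<close>

locale exact_double_complex = additive_double_complex +
  assumes exact: "c \<in> A p (Suc q) \<Longrightarrow> d'' p (Suc q) c = 0 \<Longrightarrow> \<exists>b\<in>A p (Suc (Suc q)). d'' p (Suc (Suc q)) b = c"
begin

text \<open>The basic move of the chase: if the leading component of \<open>z\<close> is a
  \<open>d''\<close>-cycle off the \<open>p\<close>-axis (\<open>k < n\<close>), a boundary cancels
  it without creating components of larger index, so the filtration degree drops by one.\<close>

lemma clear_top_component:
  assumes z: "z \<in> first_filtration C (int k) n" and "k < n" and "d'' k (n - k) (z k) = 0"
  obtains y where "y \<in> first_filtration C (int k) (Suc n)"
    and "Tot_d C d' d'' (Suc n) y \<in> first_filtration C (int k) n"
    and "z \<otimes>\<^bsub>Tot C n\<^esub> inv\<^bsub>Tot C n\<^esub> Tot_d C d' d'' (Suc n) y \<in> first_filtration C (int k - 1) n"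
proof -
  obtain q where n: "n = k + Suc q" using \<open>k < n\<close> less_imp_Suc_add by force
  have zT: "z \<in> carrier (Tot C n)" and z0: "\<And>i. i \<le> n \<Longrightarrow> k < i \<Longrightarrow> z i = 0"
    using z by (auto simp: filtration_iff)
  obtain b where b: "b \<in> A k (Suc (Suc q))" "d'' k (Suc (Suc q)) b = z k"
    using exact[of "z k" k q] Tot_memD[OF zT, of k] assms by (auto simp: n)
  \<comment> \<open>The \<open>d''\<close>-preimage of \<open>z k\<close>, placed in component
    \<open>k\<close> of degree \<open>n + 1\<close>: its boundary has \<open>z k\<close> in
    component \<open>k\<close> and otherwise only \<open>d' b\<close>, one component lower.\<close>
  define y where "y = (\<lambda>i\<in>{..Suc n}. if i = k then b else 0)"
  have y: "y \<in> carrier (Tot C (Suc n))"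
    unfolding y_def by (rule Tot_memI) (use b in \<open>auto simp: n\<close>)
  have dy: "Tot_d C d' d'' (Suc n) y \<in> carrier (Tot C n)"
    using Tot_d_closed[OF y] by simp
  show thesis
  proof
    show "y \<in> first_filtration C (int k) (Suc n)"
      using y by (auto simp: filtration_iff y_def)
    show *: "Tot_d C d' d'' (Suc n) y \<in> first_filtration C (int k) n"
      using dy by (auto simp: filtration_iff Tot_d_Suc_nth) (simp add: y_def)
    have "y k = b" "y (Suc k) = 0" by (simp_all add: y_def n)
    then have "Tot_d C d' d'' (Suc n) y k = z k"
      using b by (simp add: Tot_d_Suc_nth n)
    moreover have "Tot_d C d' d'' (Suc n) y i = 0" if "i \<le> n" "k < i" for i
      using * that by (auto simp: filtration_iff)
    ultimately have "z i - Tot_d C d' d'' (Suc n) y i = 0" if "i \<le> n" "int k - 1 < int i" for i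
      using that z0[of i] by (cases "i = k") auto
    then show "z \<otimes>\<^bsub>Tot C n\<^esub> inv\<^bsub>Tot C n\<^esub> Tot_d C d' d'' (Suc n) y \<in> first_filtration C (int k - 1) n"
      using dy zT by (simp add: filtration_iff)
  qed
qed

text \<open>A cycle without component on the \<open>p\<close>-axis is cleared from the top by
  \<open>clear_top_component\<close>, until nothing is left in filtration degree -1. The bound on
  \<open>w\<close> is kept because \<open>lift_cycle\<close> needs a \<open>w\<close> without
  component on the \<open>p\<close>-axis.\<close>

lemma cycle_is_boundary:
  assumes "j \<le> n" "z \<in> first_filtration C (int j - 1) n" "Tot_d C d' d'' n z = \<one>\<^bsub>Tot C (n - 1)\<^esub>"
  shows "\<exists>w\<in>first_filtration C (int j - 1) (Suc n). Tot_d C d' d'' (Suc n) w = z"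
  using assms
proof (induction j arbitrary: z)
  case 0
  then have "z = \<one>\<^bsub>Tot C n\<^esub>" by (intro Tot_eqI) (auto simp: filtration_iff)
  moreover have "\<one>\<^bsub>Tot C (Suc n)\<^esub> \<in> first_filtration C (int 0 - 1) (Suc n)"
    using subgroup_filtration subgroup.one_closed by blast
  moreover have "Tot_d C d' d'' (Suc n) \<one>\<^bsub>Tot C (Suc n)\<^esub> = \<one>\<^bsub>Tot C n\<^esub>"
    using d.hom_one[of "Suc n"] by simp
  ultimately show ?case by blast
next
  case (Suc j)
  then obtain m where m: "n = Suc m" "j \<le> m" by (cases n) auto
  have zT: "z \<in> carrier (Tot C n)" and "z (Suc j) = 0"
    using Suc.prems by (auto simp: filtration_iff)
  \<comment> \<open>In component \<open>j\<close> of the boundary the \<open>d'\<close>-term comes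
    from \<open>z (Suc j)\<close>, which is 0.\<close>
  then have "d'' j (n - j) (z j) = Tot_d C d' d'' n z j"
    using m by (simp add: Tot_d_Suc_nth Suc_diff_le)
  also have "\<dots> = 0" using Suc.prems m by simp
  finally obtain y where y: "y \<in> first_filtration C (int j) (Suc n)"
    and dy: "Tot_d C d' d'' (Suc n) y \<in> first_filtration C (int j) n"
    and zy: "z \<otimes>\<^bsub>Tot C n\<^esub> inv\<^bsub>Tot C n\<^esub> Tot_d C d' d'' (Suc n) y \<in> first_filtration C (int j - 1) n" (is "?z \<in> _")
    using clear_top_component[of z j n] Suc.prems m by auto
  have yT: "y \<in> carrier (Tot C (Suc n))" and dyT: "Tot_d C d' d'' (Suc n) y \<in> carrier (Tot C n)"
    using y dy by (auto simp: filtration_iff)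
  have "Tot_d C d' d'' n ?z = \<one>\<^bsub>Tot C (n - 1)\<^esub>"
    using Suc.prems zT dyT Tot_d_Tot_d[OF yT] by (simp del: One_nat_def)
  then obtain w where w: "w \<in> first_filtration C (int j - 1) (Suc n)" "Tot_d C d' d'' (Suc n) w = ?z"
    using Suc.IH[OF _ zy] m by auto
  have wT: "w \<in> carrier (Tot C (Suc n))" using w by (simp add: filtration_iff)
  have "w \<otimes>\<^bsub>Tot C (Suc n)\<^esub> y \<in> first_filtration C (int (Suc j) - 1) (Suc n)"
    using y filtration_mono[OF _ w(1), of "int j"] subgroup.m_closed[OF subgroup_filtration] by simp
  moreover have "Tot_d C d' d'' (Suc n) (w \<otimes>\<^bsub>Tot C (Suc n)\<^esub> y) = z"
    using wT yT w(2) dyT zT d.hom_mult[of w "Suc n" y] by (simp add: T.m_assoc)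
  ultimately show ?case by blast
qed

text \<open>Numerator and denominator coincide off the \<open>p\<close>-axis. For \<open>z\<close>
  in the numerator, the component of \<open>d z\<close> at \<open>p\<close> is \<open>d''\<close> of
  the leading component and vanishes because \<open>d z\<close> has filtration degree
  \<open>p - 2\<close>; clearing it by \<open>d y\<close> writes \<open>z\<close> as a sum of an
  element of filtration degree \<open>p - 1\<close> with the same boundary and of
  \<open>d y\<close>.\<close>

theorem trivial_first_E2:
  assumes "q \<noteq> 0" shows "trivial_group (first_E C d' d'' 2 p q)"
proof -
  define n where "n = p + q"
  then have "p < n" "n - p = q" using assms by auto
  let ?Z = "first_Z C d' d'' 2 (int p) n"
  let ?N = "first_Z C d' d'' 1 (int p - 1) n <#>\<^bsub>Tot C n\<^esub>
         Tot_d C d' d'' (Suc n) ` first_Z C d' d'' 1 (int p + 1) (Suc n)"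
  have Z: "subgroup ?Z (Tot C n)" by (rule subgroup_first_Z)
  have "?N = ?Z"
  proof (intro equalityI subsetI)
    fix z assume "z \<in> ?N"
    then obtain u v where u: "u \<in> first_Z C d' d'' 1 (int p - 1) n"
      and v: "v \<in> first_Z C d' d'' 1 (int p + 1) (Suc n)"
      and z: "z = u \<otimes>\<^bsub>Tot C n\<^esub> Tot_d C d' d'' (Suc n) v"
      by (auto simp: set_mult_def)
    have "u \<in> ?Z" using u filtration_mono[of "int p - 1" "int p"] by (auto simp: first_Z_def)
    moreover have "Tot_d C d' d'' (Suc n) v \<in> ?Z"
      using v Tot_d_Tot_d[of v n] subgroup.one_closed[OF subgroup_filtration, of "n - 1" "int p - 2"]
      by (simp add: first_Z_def filtration_iff[of v] del: One_nat_def)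
    ultimately show "z \<in> ?Z" unfolding z by (rule subgroup.m_closed[OF Z])
  next
    fix z assume z: "z \<in> ?Z"
    obtain m where m: "n = Suc m" "p \<le> m" by (rule that[of "n - 1"]) (use \<open>p < n\<close> in auto)
    have zF: "z \<in> first_filtration C (int p) n" and dz: "Tot_d C d' d'' n z \<in> first_filtration C (int p - 2) (n - 1)"
      using z by (auto simp: first_Z_def)
    have zT: "z \<in> carrier (Tot C n)" and "z (Suc p) = 0"
      using zF m by (auto simp: filtration_iff)
    then have "d'' p (n - p) (z p) = Tot_d C d' d'' n z p"
      using m by (simp add: Tot_d_Suc_nth Suc_diff_le)
    also have "\<dots> = 0" using dz m by (simp add: filtration_iff)
    finally obtain y where y: "y \<in> first_filtration C (int p) (Suc n)"
      and dy: "Tot_d C d' d'' (Suc n) y \<in> first_filtration C (int p) n"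
      and zy: "z \<otimes>\<^bsub>Tot C n\<^esub> inv\<^bsub>Tot C n\<^esub> Tot_d C d' d'' (Suc n) y \<in> first_filtration C (int p - 1) n" (is "?z \<in> _")
      using clear_top_component[OF zF \<open>p < n\<close>] by auto
    have yT: "y \<in> carrier (Tot C (Suc n))" and dyT: "Tot_d C d' d'' (Suc n) y \<in> carrier (Tot C n)"
      using y dy by (auto simp: filtration_iff)
    have "Tot_d C d' d'' n ?z = Tot_d C d' d'' n z"
      using zT dyT Tot_d_Tot_d[OF yT] by (simp del: One_nat_def)
    then have "?z \<in> first_Z C d' d'' 1 (int p - 1) n"
      using zy dz by (simp add: first_Z_def)
    moreover have "y \<in> first_Z C d' d'' 1 (int p + 1) (Suc n)"
      using y dy filtration_mono[of "int p" "int p + 1" y] by (simp add: first_Z_def)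
    moreover have "z = ?z \<otimes>\<^bsub>Tot C n\<^esub> Tot_d C d' d'' (Suc n) y"
      using zT dyT by (simp add: T.m_assoc)
    ultimately show "z \<in> ?N" by (metis set_multI imageI)
  qed
  then have E: "first_E C d' d'' 2 p q = (Tot C n)\<lparr>carrier := ?Z\<rparr> Mod ?Z"
    by (simp add: first_E_def Let_def add.commute[of 1] flip: n_def)
  interpret Z: comm_group "(Tot C n)\<lparr>carrier := ?Z\<rparr>" by (rule T.subgroup_is_comm_group[OF Z])
  have self: "subgroup ?Z ((Tot C n)\<lparr>carrier := ?Z\<rparr>)"
    using Z.subgroup_self by simp
  then have "group (first_E C d' d'' 2 p q)"
    unfolding E using Z.subgroup_imp_normal normal.factorgroup_is_group by blast
  moreover have "carrier (first_E C d' d'' 2 p q) = {\<one>\<^bsub>first_E C d' d'' 2 p q\<^esub>}"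
    unfolding E carrier_FactGroup one_FactGroup using Z.coset_join2[OF _ self] Z.one_closed by fastforce
  ultimately show ?thesis by (simp add: trivial_group_def)
qed

end

text \<open>\<open>B\<close> is the cokernel of \<open>d''\<close> on the \<open>p\<close>-axis,
  presented by the surjection \<open>a\<close> with kernel the image of \<open>d''\<close>, so that
  it can live in a type of its own; later it is the chain complex of \<open>Y\<close>.\<close>

locale augmented_double_complex = exact_double_complex C d' d''
  for C :: "nat \<Rightarrow> nat \<Rightarrow> 'g::ab_group_add monoid" and d' d'' +
  fixes B :: "nat \<Rightarrow> 'h::ab_group_add monoid" and bd :: "nat \<Rightarrow> 'h \<Rightarrow> 'h" and a :: "nat \<Rightarrow> 'g \<Rightarrow> 'h"
  assumes comm_group_B: "comm_group (B n)"
    and mult_B [simp]: "monoid.mult (B n) = (+)"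
    and one_B [simp]: "one (B n) = 0"
    and bd_hom: "bd n \<in> hom (B n) (B (n - 1))"
    and bd_0: "bd 0 y = 0"
    and a_hom: "a n \<in> hom (C n 0) (B n)"
    and a_surj: "a n ` A n 0 = carrier (B n)"
    and a_d'': "c \<in> A n 1 \<Longrightarrow> a n (d'' n 1 c) = 0"
    and a_kernel: "c \<in> A n 0 \<Longrightarrow> a n c = 0 \<Longrightarrow> \<exists>b\<in>A n 1. d'' n 1 b = c"
    and a_d': "c \<in> A (Suc n) 0 \<Longrightarrow> a n (d' (Suc n) 0 c) = bd (Suc n) (a (Suc n) c)"
begin

sublocale B: comm_group "B n" for n
  by (rule comm_group_B)

sublocale bd: group_hom "B n" "B (n - 1)" "bd n" for n
  by unfold_locales (rule bd_hom)

lemma a_closed [intro]: "c \<in> A n 0 \<Longrightarrow> a n c \<in> carrier (B n)"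
  and a_add: "c \<in> A n 0 \<Longrightarrow> c' \<in> A n 0 \<Longrightarrow> a n (c + c') = a n c + a n c'"
  using a_hom[of n] by (auto simp: hom_def)

lemma a_zero [simp]: "a n 0 = 0"
  using a_add[of 0 n 0] by auto

lemma a_diff: "c \<in> A n 0 \<Longrightarrow> c' \<in> A n 0 \<Longrightarrow> a n (c - c') = a n c - a n c'"
  using a_add[of "c - c'" n c'] diff_closed[of c n 0 c'] by (simp add: eq_diff_eq)

text \<open>Inherited from \<open>d' d' = 0\<close> along the surjection \<open>a\<close>.\<close>

lemma bd_bd:
  assumes "y \<in> carrier (B (Suc n))" shows "bd n (bd (Suc n) y) = 0"
proof (cases n)
  case (Suc m)
  obtain x where x: "x \<in> A (Suc n) 0" "y = a (Suc n) x" using assms by (metis imageE a_surj)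
  then have "bd n (bd (Suc n) y) = a m (d' n 0 (d' (Suc n) 0 x))"
    using d'_closed a_d' by (simp add: Suc)
  then show ?thesis using d'_d'[of x m 0] x by (simp add: Suc)
qed (simp add: bd_0)

text \<open>In degree \<open>n\<close> the component with index \<open>n\<close> lies in
  \<open>C n 0\<close>, on the \<open>p\<close>-axis, where \<open>a\<close> is defined.\<close>

definition top_value :: "nat \<Rightarrow> (nat \<Rightarrow> 'g) \<Rightarrow> 'h" where
  "top_value n z = a n (z n)"

lemma top_value_hom: "top_value n \<in> hom (Tot C n) (B n)"
proof (rule homI)
  fix z w assume "z \<in> carrier (Tot C n)" "w \<in> carrier (Tot C n)"
  then show "top_value n (z \<otimes>\<^bsub>Tot C n\<^esub> w) = top_value n z \<otimes>\<^bsub>B n\<^esub> top_value n w"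
    using Tot_memD[of z n n] Tot_memD[of w n n] by (simp add: top_value_def a_add)
next
  fix z assume "z \<in> carrier (Tot C n)"
  then show "top_value n z \<in> carrier (B n)"
    using Tot_memD[of z n n] by (auto simp: top_value_def)
qed

lemma top_value_boundary:
  assumes "w \<in> carrier (Tot C (Suc n))"
  shows "top_value n (Tot_d C d' d'' (Suc n) w) = bd (Suc n) (top_value (Suc n) w)"
proof -
  have w: "w n \<in> A n 1" "w (Suc n) \<in> A (Suc n) 0"
    using Tot_memD[OF assms, of n] Tot_memD[OF assms, of "Suc n"] by simp_all
  then have "a n (d' (Suc n) 0 (w (Suc n)) + d'' n 1 (w n)) = a n (d' (Suc n) 0 (w (Suc n))) + a n (d'' n 1 (w n))"
    by (intro a_add) auto
  then show ?thesis
    using w a_d'' a_d' by (simp add: top_value_def Tot_d_Suc_nth)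
qed

text \<open>Only the component of \<open>d z\<close> on the \<open>p\<close>-axis has to vanish.
  This covers the cycles of \<open>Tot\<close> and also the numerator of the second page, where
  \<open>d z\<close> has filtration degree \<open>n - 2\<close>.\<close>

lemma bd_top_value:
  assumes "z \<in> carrier (Tot C n)" and "0 < n \<Longrightarrow> Tot_d C d' d'' n z (n - 1) = 0"
  shows "bd n (top_value n z) = 0"
proof (cases n)
  case (Suc m)
  have z: "z \<in> carrier (Tot C (Suc m))" using assms Suc by simp
  have "top_value m (Tot_d C d' d'' (Suc m) z) = 0"
    using assms(2) by (simp add: Suc top_value_def)
  then show ?thesis
    using top_value_boundary[OF z] by (simp add: Suc)
qed (simp add: bd_0)

text \<open>A zigzag: for a lift \<open>x\<close> of \<open>y\<close>, \<open>a\<close> kills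
  \<open>d' x\<close>, so \<open>d' x\<close> is some \<open>d'' b\<close>. The pair of
  \<open>x\<close> and \<open>- b\<close> has a boundary off the \<open>p\<close>-axis; that
  boundary is a cycle, so \<open>cycle_is_boundary\<close> provides a correction \<open>w\<close>
  that leaves the component \<open>x\<close> untouched.\<close>

lemma lift_cycle:
  assumes "y \<in> carrier (B n)" "bd n y = 0"
  shows "\<exists>z\<in>carrier (Tot C n). Tot_d C d' d'' n z = \<one>\<^bsub>Tot C (n - 1)\<^esub> \<and> top_value n z = y"
proof -
  obtain x where x: "x \<in> A n 0" "a n x = y" using assms(1) by (metis imageE a_surj)
  show ?thesis
  proof (cases n)
    case 0
    have "(\<lambda>i\<in>{..n}. x) \<in> carrier (Tot C n)"
      by (rule Tot_memI) (use x 0 in auto)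
    moreover have "top_value n (\<lambda>i\<in>{..n}. x) = y" using x by (simp add: top_value_def)
    moreover have "Tot_d C d' d'' n (\<lambda>i\<in>{..n}. x) = \<one>\<^bsub>Tot C (n - 1)\<^esub>" by (simp add: 0 Tot_d_0)
    ultimately show ?thesis by blast
  next
    case (Suc m)
    have dx: "d' (Suc m) 0 x \<in> A m 0" using x Suc by auto
    have "a m (d' (Suc m) 0 x) = 0" using a_d'[of x m] x Suc assms by simp
    then obtain b where b: "b \<in> A m 1" "d'' m 1 b = d' (Suc m) 0 x"
      using a_kernel[OF dx] by blast
    \<comment> \<open>The sign of \<open>b\<close> makes \<open>d' x + d'' (- b)\<close> vanish, so
      the boundary of \<open>z\<close> has no component on the \<open>p\<close>-axis.\<close>
    define z where "z = (\<lambda>i\<in>{..n}. if i = n then x else if i = m then - b else 0)"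
    have z: "z \<in> carrier (Tot C n)"
      unfolding z_def by (rule Tot_memI) (use x b uminus_closed[OF b(1)] Suc in \<open>auto simp: Suc_diff_le\<close>)
    have "z m = - b" "z (Suc m) = x" by (simp_all add: z_def Suc)
    then have "Tot_d C d' d'' (Suc m) z m = 0"
      using b by (simp add: Tot_d_Suc_nth d''_uminus)
    moreover have dz: "Tot_d C d' d'' (Suc m) z \<in> carrier (Tot C m)"
      using Tot_d_closed[OF z] by (simp add: Suc)
    moreover have "i = m" if "i \<le> m" "int m - 1 < int i" for i using that by simp
    ultimately have "Tot_d C d' d'' (Suc m) z \<in> first_filtration C (int m - 1) m"
      unfolding filtration_iff by metis
    moreover have "Tot_d C d' d'' m (Tot_d C d' d'' (Suc m) z) = \<one>\<^bsub>Tot C (m - 1)\<^esub>"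
      using Tot_d_Tot_d z Suc by simp
    ultimately obtain w where w: "w \<in> first_filtration C (int m - 1) (Suc m)"
      "Tot_d C d' d'' (Suc m) w = Tot_d C d' d'' (Suc m) z"
      using cycle_is_boundary[of m m] by auto
    have wT: "w \<in> carrier (Tot C n)" and "w n = 0" using w by (auto simp: filtration_iff Suc)
    let ?z = "z \<otimes>\<^bsub>Tot C n\<^esub> inv\<^bsub>Tot C n\<^esub> w"
    have "Tot_d C d' d'' n ?z = \<one>\<^bsub>Tot C (n - 1)\<^esub>"
      using w z wT T.r_inv Tot_d_closed[OF z] Suc by simp
    moreover have "top_value n ?z = y"
      using wT \<open>w n = 0\<close> \<open>z (Suc m) = x\<close> x by (simp add: top_value_def Suc)
    moreover have "?z \<in> carrier (Tot C n)" using z wT by simp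
    ultimately show ?thesis by metis
  qed
qed

text \<open>The counterpart of \<open>clear_top_component\<close> on the \<open>p\<close>-axis,
  where the kernel of \<open>a\<close> takes the place of exactness: with \<open>x\<close> over
  \<open>y\<close>, the element \<open>z n - d' x\<close> is killed by \<open>a\<close>.\<close>

lemma clear_boundary_top:
  assumes z: "z \<in> carrier (Tot C n)" and y: "y \<in> carrier (B (Suc n))" "top_value n z = bd (Suc n) y"
  obtains w where "w \<in> carrier (Tot C (Suc n))"
    "z \<otimes>\<^bsub>Tot C n\<^esub> inv\<^bsub>Tot C n\<^esub> Tot_d C d' d'' (Suc n) w \<in> first_filtration C (int n - 1) n"
proof -
  obtain x where x: "x \<in> A (Suc n) 0" "a (Suc n) x = y" using y(1) by (metis imageE a_surj)
  have zn: "z n \<in> A n 0" using Tot_memD[OF z, of n] by simp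
  have dx: "d' (Suc n) 0 x \<in> A n 0" using x by blast
  have "a n (z n - d' (Suc n) 0 x) = 0"
    using a_diff[OF zn dx] a_d'[OF x(1)] x y by (simp add: top_value_def)
  then obtain b where b: "b \<in> A n 1" "d'' n 1 b = z n - d' (Suc n) 0 x"
    using a_kernel[OF diff_closed[OF zn dx]] by blast
  define w where "w = (\<lambda>i\<in>{..Suc n}. if i = Suc n then x else if i = n then b else 0)"
  have w: "w \<in> carrier (Tot C (Suc n))"
    unfolding w_def by (rule Tot_memI) (use x b in \<open>auto simp: Suc_diff_le\<close>)
  have "w n = b" "w (Suc n) = x" by (simp_all add: w_def)
  then have "Tot_d C d' d'' (Suc n) w n = z n" using b by (simp add: Tot_d_Suc_nth)
  moreover have dw: "Tot_d C d' d'' (Suc n) w \<in> carrier (Tot C n)" using Tot_d_closed[OF w] by simp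
  moreover have "i = n" if "i \<le> n" "int n - 1 < int i" for i using that by simp
  ultimately have "\<forall>i\<le>n. int n - 1 < int i \<longrightarrow> z i - Tot_d C d' d'' (Suc n) w i = 0"
    by (metis diff_self)
  then have "z \<otimes>\<^bsub>Tot C n\<^esub> inv\<^bsub>Tot C n\<^esub> Tot_d C d' d'' (Suc n) w \<in> first_filtration C (int n - 1) n"
    using z dw by (simp add: filtration_iff)
  then show thesis using that w by blast
qed

section \<open>Comparison with the homology of the cokernel\<close>

definition cycles_B :: "nat \<Rightarrow> 'h monoid" where
  "cycles_B n = (B n)\<lparr>carrier := kernel (B n) (B (n - 1)) (bd n)\<rparr>"

lemma carrier_cycles_B: "carrier (cycles_B n) = {y \<in> carrier (B n). bd n y = 0}"
  by (simp add: cycles_B_def kernel_def)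

lemma comm_group_cycles_B: "comm_group (cycles_B n)"
  unfolding cycles_B_def by (rule B.subgroup_is_comm_group[OF bd.subgroup_kernel])

lemma subgroup_boundaries_B: "subgroup (bd (Suc n) ` carrier (B (Suc n))) (cycles_B n)"
  unfolding cycles_B_def
proof (rule B.subgroup_incl)
  show "subgroup (bd (Suc n) ` carrier (B (Suc n))) (B n)"
    using bd.img_is_subgroup[of "Suc n"] by simp
  show "bd (Suc n) ` carrier (B (Suc n)) \<subseteq> kernel (B n) (B (n - 1)) (bd n)"
    using bd_bd bd.hom_closed[of _ "Suc n"] by (auto simp: kernel_def)
qed (rule bd.subgroup_kernel)

text \<open>Both quotients of the total complex are compared with the homology of \<open>B\<close> by the value of the
  augmentation on the component on the \<open>p\<close>-axis.\<close>

lemma FactGroup_iso_homology_B: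
  assumes Z: "subgroup Z (Tot C n)"
    and cycles: "\<And>z. z \<in> carrier (Tot C n) \<Longrightarrow> Tot_d C d' d'' n z = \<one>\<^bsub>Tot C (n - 1)\<^esub> \<Longrightarrow> z \<in> Z"
    and top: "\<And>z. z \<in> Z \<Longrightarrow> 0 < n \<Longrightarrow> Tot_d C d' d'' n z (n - 1) = 0"
    and N: "\<And>z. z \<in> N \<longleftrightarrow> z \<in> Z \<and> top_value n z \<in> bd (Suc n) ` carrier (B (Suc n))"
  shows "((Tot C n)\<lparr>carrier := Z\<rparr> Mod N) \<cong> homology_at B bd n"
proof -
  interpret Z: comm_group "(Tot C n)\<lparr>carrier := Z\<rparr>" by (rule T.subgroup_is_comm_group[OF Z])
  have sub: "Z \<subseteq> carrier (Tot C n)" using Z by (rule subgroup.subset)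
  have im: "top_value n z \<in> carrier (cycles_B n)" if "z \<in> Z" for z
  proof -
    have "z \<in> carrier (Tot C n)" using that sub by blast
    moreover have "top_value n z \<in> carrier (B n)"
      using hom_in_carrier[OF top_value_hom] calculation by blast
    ultimately show ?thesis using bd_top_value[of z n] top[OF that] by (simp add: carrier_cycles_B)
  qed
  have "top_value n \<in> hom ((Tot C n)\<lparr>carrier := Z\<rparr>) (cycles_B n)"
  proof (rule homI)
    fix z w assume "z \<in> carrier ((Tot C n)\<lparr>carrier := Z\<rparr>)" "w \<in> carrier ((Tot C n)\<lparr>carrier := Z\<rparr>)"
    then have "z \<in> carrier (Tot C n)" "w \<in> carrier (Tot C n)" using sub by auto
    then show "top_value n (z \<otimes>\<^bsub>(Tot C n)\<lparr>carrier := Z\<rparr>\<^esub> w) = top_value n z \<otimes>\<^bsub>cycles_B n\<^esub> top_value n w"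
      using hom_mult[OF top_value_hom] by (simp add: cycles_B_def)
  qed (use im in simp)
  moreover have "top_value n ` Z = carrier (cycles_B n)"
  proof
    show "carrier (cycles_B n) \<subseteq> top_value n ` Z"
      using lift_cycle[of _ n] cycles by (force simp: carrier_cycles_B)
  qed (use im in auto)
  ultimately have "((Tot C n)\<lparr>carrier := Z\<rparr> Mod N) \<cong> (cycles_B n Mod (bd (Suc n) ` carrier (B (Suc n))))"
    using N by (intro Z.FactGroup_iso_FactGroup_vimage[where h = "top_value n"] comm_group_cycles_B subgroup_boundaries_B) auto
  then show ?thesis by (simp add: homology_at_def cycles_B_def)
qed

text \<open>A cycle whose value bounds in \<open>B\<close> is a boundary: after
  \<open>clear_boundary_top\<close> it has no component on the \<open>p\<close>-axis, and
  \<open>cycle_is_boundary\<close> applies. The converse is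
  \<open>top_value_boundary\<close>.\<close>

theorem homology_Tot_iso: "homology_at (Tot C) (Tot_d C d' d'') n \<cong> homology_at B bd n"
  unfolding homology_at_def[of "Tot C"]
proof (rule FactGroup_iso_homology_B)
  fix z
  let ?Z = "kernel (Tot C n) (Tot C (n - 1)) (Tot_d C d' d'' n)"
  show "z \<in> Tot_d C d' d'' (Suc n) ` carrier (Tot C (Suc n)) \<longleftrightarrow>
    z \<in> ?Z \<and> top_value n z \<in> bd (Suc n) ` carrier (B (Suc n))" (is "?L \<longleftrightarrow> ?R")
  proof
    assume ?L
    then obtain w where w: "w \<in> carrier (Tot C (Suc n))" "z = Tot_d C d' d'' (Suc n) w" by blast
    then have "z \<in> ?Z" using Tot_d_Tot_d[OF w(1)] Tot_d_closed[OF w(1)] by (simp add: kernel_def)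
    moreover have "top_value n z = bd (Suc n) (top_value (Suc n) w)"
      using top_value_boundary w by simp
    ultimately show ?R using hom_in_carrier[OF top_value_hom w(1)] by blast
  next
    assume ?R
    then obtain y where zT: "z \<in> carrier (Tot C n)" and dz: "Tot_d C d' d'' n z = \<one>\<^bsub>Tot C (n - 1)\<^esub>"
      and y: "y \<in> carrier (B (Suc n))" "top_value n z = bd (Suc n) y"
      by (auto simp: kernel_def)
    obtain w where w: "w \<in> carrier (Tot C (Suc n))"
      and zw: "z \<otimes>\<^bsub>Tot C n\<^esub> inv\<^bsub>Tot C n\<^esub> Tot_d C d' d'' (Suc n) w \<in> first_filtration C (int n - 1) n" (is "?z \<in> _")
      using clear_boundary_top[OF zT y] .
    have dw: "Tot_d C d' d'' (Suc n) w \<in> carrier (Tot C n)" using Tot_d_closed[OF w] by simp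
    have "Tot_d C d' d'' n ?z = \<one>\<^bsub>Tot C (n - 1)\<^esub>"
      using zT dz dw Tot_d_Tot_d[OF w] by (simp del: One_nat_def)
    then obtain u where u: "u \<in> first_filtration C (int n - 1) (Suc n)" "Tot_d C d' d'' (Suc n) u = ?z"
      using cycle_is_boundary[OF _ zw] by blast
    have uT: "u \<in> carrier (Tot C (Suc n))" using u by (simp add: filtration_iff)
    then have "Tot_d C d' d'' (Suc n) (u \<otimes>\<^bsub>Tot C (Suc n)\<^esub> w) = z"
      using w u dw zT d.hom_mult[of u "Suc n" w] by (simp add: T.m_assoc)
    then show ?L using uT w T.m_closed by blast
  qed
qed (auto simp: kernel_def d.subgroup_kernel[unfolded kernel_def] simp del: One_nat_def)

text \<open>The filtration steps \<open>n\<close> and \<open>n + 1\<close> are everything in degrees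
  \<open>n\<close> and \<open>n + 1\<close>. So the second summand of the denominator consists of
  all boundaries, and the first one contains what \<open>clear_boundary_top\<close> leaves
  over.\<close>

theorem first_E2_iso: "first_E C d' d'' 2 n 0 \<cong> homology_at B bd n"
proof -
  let ?Z = "first_Z C d' d'' 2 (int n) n"
  let ?N = "first_Z C d' d'' 1 (int n - 1) n <#>\<^bsub>Tot C n\<^esub>
         Tot_d C d' d'' (Suc n) ` first_Z C d' d'' 1 (int n + 1) (Suc n)"
  have Z_iff: "z \<in> ?Z \<longleftrightarrow> z \<in> carrier (Tot C n) \<and> Tot_d C d' d'' n z \<in> first_filtration C (int n - 2) (n - 1)" for z
    by (auto simp: first_Z_def filtration_all)
  have Z1_iff: "w \<in> first_Z C d' d'' 1 (int n + 1) (Suc n) \<longleftrightarrow> w \<in> carrier (Tot C (Suc n))" for w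
    using Tot_d_closed[of w "Suc n"] by (auto simp: first_Z_def filtration_all)
  have "((Tot C n)\<lparr>carrier := ?Z\<rparr> Mod ?N) \<cong> homology_at B bd n"
  proof (rule FactGroup_iso_homology_B[OF subgroup_first_Z])
    fix z assume "z \<in> carrier (Tot C n)" "Tot_d C d' d'' n z = \<one>\<^bsub>Tot C (n - 1)\<^esub>"
    then show "z \<in> ?Z" using subgroup.one_closed[OF subgroup_filtration] by (simp add: Z_iff)
  next
    fix z assume "z \<in> ?Z" "0 < n"
    then show "Tot_d C d' d'' n z (n - 1) = 0" by (simp add: Z_iff filtration_iff)
  next
    fix z
    show "z \<in> ?N \<longleftrightarrow> z \<in> ?Z \<and> top_value n z \<in> bd (Suc n) ` carrier (B (Suc n))" (is "_ \<longleftrightarrow> ?R")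
    proof
      assume "z \<in> ?N"
      then obtain u w where u: "u \<in> first_Z C d' d'' 1 (int n - 1) n"
        and w: "w \<in> carrier (Tot C (Suc n))"
        and z: "z = u \<otimes>\<^bsub>Tot C n\<^esub> Tot_d C d' d'' (Suc n) w"
        by (auto simp: set_mult_def Z1_iff)
      have uZ: "u \<in> ?Z" and "u n = 0" and uT: "u \<in> carrier (Tot C n)"
        using u by (auto simp: Z_iff first_Z_def filtration_iff[of u])
      have dw: "Tot_d C d' d'' (Suc n) w \<in> carrier (Tot C n)" using Tot_d_closed[OF w] by simp
      then have "Tot_d C d' d'' (Suc n) w \<in> ?Z"
        using Tot_d_Tot_d[OF w] subgroup.one_closed[OF subgroup_filtration] by (simp add: Z_iff)
      then have "z \<in> ?Z" unfolding z by (rule subgroup.m_closed[OF subgroup_first_Z uZ])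
      moreover have "top_value n z = bd (Suc n) (top_value (Suc n) w)"
        using hom_mult[OF top_value_hom uT dw] top_value_boundary[OF w] \<open>u n = 0\<close>
        by (simp add: z top_value_def[of n u])
      ultimately show ?R using hom_in_carrier[OF top_value_hom w] by blast
    next
      assume R: ?R
      then obtain y where zT: "z \<in> carrier (Tot C n)" and dz: "Tot_d C d' d'' n z \<in> first_filtration C (int n - 2) (n - 1)"
        and y: "y \<in> carrier (B (Suc n))" "top_value n z = bd (Suc n) y"
        by (auto simp: Z_iff)
      obtain w where w: "w \<in> carrier (Tot C (Suc n))"
        and zw: "z \<otimes>\<^bsub>Tot C n\<^esub> inv\<^bsub>Tot C n\<^esub> Tot_d C d' d'' (Suc n) w \<in> first_filtration C (int n - 1) n" (is "?z \<in> _")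
        using clear_boundary_top[OF zT y] .
      have dw: "Tot_d C d' d'' (Suc n) w \<in> carrier (Tot C n)" using Tot_d_closed[OF w] by simp
      have "Tot_d C d' d'' n ?z = Tot_d C d' d'' n z"
        using zT dw Tot_d_Tot_d[OF w] by (simp del: One_nat_def)
      then have "?z \<in> first_Z C d' d'' 1 (int n - 1) n"
        using zw dz by (simp add: first_Z_def)
      moreover have "z = ?z \<otimes>\<^bsub>Tot C n\<^esub> Tot_d C d' d'' (Suc n) w"
        using zT dw by (simp add: T.m_assoc)
      ultimately show "z \<in> ?N" using w by (metis set_multI imageI Z1_iff)
    qed
  qed
  then show ?thesis by (simp add: first_E_def Let_def add.commute[of 1])
qed

theorem first_E2_iso_homology_Tot: "first_E C d' d'' 2 n 0 \<cong> homology_at (Tot C) (Tot_d C d' d'') n"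
proof -
  \<comment> \<open>Inverting the isomorphism from the homology of \<open>Tot\<close> to that of
    \<open>B\<close> requires its source to be a group.\<close>
  have "group (homology_at (Tot C) (Tot_d C d' d'') n)"
  proof -
    interpret K: comm_group "(Tot C n)\<lparr>carrier := kernel (Tot C n) (Tot C (n - 1)) (Tot_d C d' d'' n)\<rparr>"
      by (rule T.subgroup_is_comm_group[OF d.subgroup_kernel])
    have "subgroup (Tot_d C d' d'' (Suc n) ` carrier (Tot C (Suc n)))
      ((Tot C n)\<lparr>carrier := kernel (Tot C n) (Tot C (n - 1)) (Tot_d C d' d'' n)\<rparr>)"
    proof (rule T.subgroup_incl)
      show "subgroup (Tot_d C d' d'' (Suc n) ` carrier (Tot C (Suc n))) (Tot C n)"
        using d.img_is_subgroup[of "Suc n"] by simp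
      show "Tot_d C d' d'' (Suc n) ` carrier (Tot C (Suc n)) \<subseteq> kernel (Tot C n) (Tot C (n - 1)) (Tot_d C d' d'' n)"
        using Tot_d_Tot_d Tot_d_closed[of _ "Suc n"] by (auto simp: kernel_def simp del: One_nat_def)
    qed (rule d.subgroup_kernel)
    then show ?thesis
      unfolding homology_at_def using K.subgroup_imp_normal normal.factorgroup_is_group by blast
  qed
  then show ?thesis
    using first_E2_iso homology_Tot_iso group.iso_sym iso_trans by blast
qed

end

section \<open>Simplicial chains\<close>

lemma frag_extend_frag_extend:
  "frag_extend f (frag_extend g c) = frag_extend (\<lambda>x. frag_extend f (g x)) c"
  using subset_UNIV by (induction c rule: frag_induction) (auto simp: frag_extend_diff)

text \<open>The integers have no 2-torsion; this turns the sign arguments on alternating chains into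
  vanishing statements.\<close>

lemma frag_self_inverse_eq_0:
  fixes c :: "'a \<Rightarrow>\<^sub>0 int" assumes "c = - c" shows "c = 0"
proof (rule poly_mapping_eqI)
  fix x show "poly_mapping.lookup c x = poly_mapping.lookup 0 x"
    using arg_cong[OF assms, of "\<lambda>c. poly_mapping.lookup c x"] by simp
qed

text \<open>The common cancellation behind \<open>simp_boundary_simp_boundary\<close> and
  \<open>rho_rho\<close>: by the simplicial identity the terms with \<open>i < j\<close> pair off
  against those with \<open>j \<le> i\<close>, with opposite signs.\<close>

lemma alternating_double_sum_eq_0:
  fixes F :: "nat \<Rightarrow> nat \<Rightarrow> ('a \<Rightarrow>\<^sub>0 int)"
  assumes F: "\<And>i j. i < j \<Longrightarrow> j \<le> Suc n \<Longrightarrow> F i j = F (j - 1) i"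
  shows "(\<Sum>j\<le>Suc n. \<Sum>i\<le>n. frag_cmul ((-1) ^ (i + j)) (F i j)) = 0"
proof -
  let ?g = "\<lambda>(j, i). frag_cmul ((-1) ^ (i + j)) (F i j)"
  let ?S = "{..Suc n} \<times> {..n}"
  let ?P = "{(j, i). i < j \<and> j \<le> Suc n}" and ?Q = "{(j, i). j \<le> i \<and> i \<le> n}"
  have S: "?S = ?P \<union> ?Q" by auto
  have fin: "finite ?P" "finite ?Q" by (rule finite_subset[of _ ?S]; auto)+
  \<comment> \<open>The pair \<open>(j, i)\<close> with \<open>i < j\<close> corresponds to
    \<open>(i, j - 1)\<close>; the index sum drops by 1, which is the change of sign.\<close>
  have "sum ?g ?P = (\<Sum>(j, i)\<in>?Q. ?g (Suc i, j))"
  proof (rule sum.reindex_bij_witness[of _ "\<lambda>(j, i). (Suc i, j)" "\<lambda>(j, i). (i, j - 1)"])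
    fix x assume "x \<in> ?P"
    then obtain j i where "x = (j, i)" "i < j" by blast
    then show "(case case x of (j, i) \<Rightarrow> (i, j - 1) of (j, i) \<Rightarrow> ?g (Suc i, j)) = ?g x" by (cases j) simp_all
  qed auto
  also have "\<dots> = (\<Sum>x\<in>?Q. - ?g x)"
  proof (rule sum.cong[OF refl])
    fix x assume "x \<in> ?Q"
    then obtain j i where x: "x = (j, i)" "j \<le> i" "i \<le> n" by auto
    then have "F j (Suc i) = F i j" using F[of j "Suc i"] by simp
    then show "(case x of (j, i) \<Rightarrow> ?g (Suc i, j)) = - ?g x" by (simp add: x add.commute)
  qed
  finally have "sum ?g ?P = - sum ?g ?Q" by (simp only: sum_negf)
  moreover have "sum ?g ?S = sum ?g ?P + sum ?g ?Q"
    unfolding S by (rule sum.union_disjoint[OF fin]) auto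
  ultimately show ?thesis unfolding sum.cartesian_product by simp
qed

text \<open>The simplicial identity for faces, in the form asked for by
  \<open>alternating_double_sum_eq_0\<close>.\<close>

lemma remove_nth_remove_nth:
  assumes "i < j" "j < length vs"
  shows "take i (take j vs @ drop (Suc j) vs) @ drop (Suc i) (take j vs @ drop (Suc j) vs) =
    take (j - 1) (take i vs @ drop (Suc i) vs) @ drop (Suc (j - 1)) (take i vs @ drop (Suc i) vs)"
proof -
  obtain d where j: "j = Suc (i + d)" using assms(1) less_imp_Suc_add by blast
  show ?thesis
    using assms by (intro nth_equalityI) (auto simp: nth_append min_def j intro!: arg_cong[of _ _ "(!) vs"])
qed

lemma simp_boundary_simp_boundary:
  assumes "\<And>vs. vs \<in> Poly_Mapping.keys c \<Longrightarrow> length vs = Suc n"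
  shows "simp_boundary (n - 1) (simp_boundary n c) = 0"
proof (cases "n \<le> 1")
  case False
  then obtain m where n: "n = Suc (Suc m)" by (metis One_nat_def le_SucI not0_implies_Suc le0 le_refl)
  let ?r = "\<lambda>i vs. take i vs @ drop (Suc i) vs"
  have "frag_extend (\<lambda>vs. \<Sum>i\<le>Suc m. frag_cmul ((-1) ^ i) (frag_of (?r i vs)))
      (\<Sum>j\<le>Suc (Suc m). frag_cmul ((-1) ^ j) (frag_of (?r j vs))) = 0"
    if "vs \<in> Poly_Mapping.keys c" for vs
  proof -
    have "(\<Sum>j\<le>Suc (Suc m). \<Sum>i\<le>Suc m. frag_cmul ((-1) ^ (i + j)) (frag_of (?r i (?r j vs)))) = 0"
      using assms[OF that] remove_nth_remove_nth[where vs = vs]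
      by (intro alternating_double_sum_eq_0) (simp add: n)
    then show ?thesis
      by (simp add: frag_extend_sum frag_extend_cmul frag_cmul_sum o_def power_add mult.commute del: sum.atMost_Suc)
  qed
  then show ?thesis
    unfolding simp_boundary_def n
    by (simp add: frag_extend_frag_extend del: sum.atMost_Suc) (rule frag_extend_eq_0, blast)
qed (auto simp: simp_boundary_def le_Suc_eq)

lemma keys_simp_boundary:
  assumes "vs \<in> Poly_Mapping.keys (simp_boundary n c)"
  obtains us i where "us \<in> Poly_Mapping.keys c" "i \<le> n" "n \<noteq> 0" "vs = take i us @ drop (Suc i) us"
proof -
  let ?f = "\<lambda>us. \<Sum>i\<le>n. frag_cmul ((-1) ^ i) (frag_of (take i us @ drop (Suc i) us))"
  have n: "n \<noteq> 0"
  proof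
    assume "n = 0" then show False using assms by (simp add: simp_boundary_def)
  qed
  then have "vs \<in> Poly_Mapping.keys (frag_extend ?f c)" using assms by (simp add: simp_boundary_def)
  then obtain us where us: "us \<in> Poly_Mapping.keys c" "vs \<in> Poly_Mapping.keys (?f us)"
    using keys_frag_extend[of ?f c] by blast
  then obtain i where "i \<le> n" "vs \<in> Poly_Mapping.keys (frag_cmul ((-1) ^ i) (frag_of (take i us @ drop (Suc i) us)))"
    using keys_sum[of "\<lambda>i. frag_cmul ((-1) ^ i) (frag_of (take i us @ drop (Suc i) us))" "{..n}"] by blast
  then have "vs = take i us @ drop (Suc i) us" by (simp add: keys_frag_of)
  then show thesis using us(1) n \<open>i \<le> n\<close> that by blast
qed

lemma simp_boundary_add: "simp_boundary n (c + d) = simp_boundary n c + simp_boundary n d"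
  and simp_boundary_cmul: "simp_boundary n (frag_cmul k c) = frag_cmul k (simp_boundary n c)"
  and simp_boundary_zero [simp]: "simp_boundary n 0 = 0"
  by (simp_all add: simp_boundary_def frag_extend_add frag_extend_cmul)

lemma simp_boundary_sum: "simp_boundary n (sum g I) = (\<Sum>i\<in>I. simp_boundary n (g i))"
  by (induction I rule: infinite_finite_induct) (auto simp: simp_boundary_add)

section \<open>Chain maps induced by maps of vertices\<close>

lemma simp_chain_map_zero [simp]: "simp_chain_map g 0 = 0"
  and simp_chain_map_add: "simp_chain_map g (c + d) = simp_chain_map g c + simp_chain_map g d"
  and simp_chain_map_diff: "simp_chain_map g (c - d) = simp_chain_map g c - simp_chain_map g d"
  and simp_chain_map_uminus: "simp_chain_map g (- c) = - simp_chain_map g c"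
  and simp_chain_map_cmul: "simp_chain_map g (frag_cmul k c) = frag_cmul k (simp_chain_map g c)"
  by (simp_all add: simp_chain_map_def frag_extend_add frag_extend_diff frag_extend_minus frag_extend_cmul)

lemma simp_chain_map_sum: "simp_chain_map g (sum h I) = (\<Sum>i\<in>I. simp_chain_map g (h i))"
  by (induction I rule: infinite_finite_induct) (auto simp: simp_chain_map_add)

lemma simp_chain_map_frag_extend:
  "simp_chain_map g (frag_extend (\<lambda>vs. frag_of (h vs)) c) = frag_extend (\<lambda>vs. frag_of (map g (h vs))) c"
  by (simp add: simp_chain_map_def frag_extend_frag_extend)

lemma frag_extend_simp_chain_map:
  "frag_extend h (simp_chain_map g c) = frag_extend (\<lambda>vs. h (map g vs)) c"
  by (simp add: simp_chain_map_def frag_extend_frag_extend)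

lemma simp_chain_map_simp_chain_map:
  "simp_chain_map g (simp_chain_map h c) = simp_chain_map (\<lambda>x. g (h x)) c"
  by (simp add: simp_chain_map_def frag_extend_frag_extend o_def)

lemma simp_chain_map_cong:
  "(\<And>vs. vs \<in> Poly_Mapping.keys c \<Longrightarrow> map g vs = map h vs) \<Longrightarrow> simp_chain_map g c = simp_chain_map h c"
  unfolding simp_chain_map_def by (rule frag_extend_eq) (simp del: map_eq_conv)

lemma simp_chain_map_id:
  assumes "\<And>vs. vs \<in> Poly_Mapping.keys c \<Longrightarrow> map g vs = vs" shows "simp_chain_map g c = c"
proof -
  have "simp_chain_map g c = frag_extend frag_of c"
    unfolding simp_chain_map_def by (rule frag_extend_eq) (simp add: assms)
  then show ?thesis by (simp flip: frag_expansion)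
qed

lemma keys_frag_extend_frag_of:
  "Poly_Mapping.keys (frag_extend (\<lambda>vs. frag_of (h vs)) c) \<subseteq> h ` Poly_Mapping.keys c"
  using keys_frag_extend[of "\<lambda>vs. frag_of (h vs)" c] by (auto simp: image_iff)

lemma keys_simp_chain_map: "Poly_Mapping.keys (simp_chain_map g c) \<subseteq> map g ` Poly_Mapping.keys c"
  unfolding simp_chain_map_def by (rule keys_frag_extend_frag_of)

lemma simp_boundary_simp_chain_map:
  "simp_boundary n (simp_chain_map g c) = simp_chain_map g (simp_boundary n c)"
  by (simp add: simp_boundary_def simp_chain_map_def frag_extend_frag_extend frag_extend_sum frag_extend_cmul
      o_def take_map drop_map del: sum.atMost_Suc)

section \<open>Tuples of simplices in a fibre\<close>

text \<open>The members encode \<open>k\<close>-tuples of lists in \<open>S\<close> with the same image under \<open>f\<close>: the \<open>l\<close>-th entry is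
  the column \<open>map (\<lambda>v. v l) vs\<close>.\<close>

definition fibre_power :: "'v list set \<Rightarrow> ('v \<Rightarrow> 'w) \<Rightarrow> nat \<Rightarrow> (nat \<Rightarrow> 'v) list set" where
  "fibre_power S f k =
     {vs. set vs \<subseteq> extensional {1..k} \<and> (\<forall>l\<in>{1..k}. map (\<lambda>v. v l) vs \<in> S) \<and>
       (\<forall>l\<in>{1..k}. \<forall>m\<in>{1..k}. map (\<lambda>v. f (v l)) vs = map (\<lambda>v. f (v m)) vs)}"

definition ins :: "nat \<Rightarrow> nat \<Rightarrow> 'v \<Rightarrow> (nat \<Rightarrow> 'v) \<Rightarrow> nat \<Rightarrow> 'v" where
  "ins k i u v = (\<lambda>l\<in>{1..Suc k}. if l < i then v l else if l = i then u else v (l - 1))"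

lemma forget_ins:
  "1 \<le> i \<Longrightarrow> i \<le> Suc k \<Longrightarrow> v \<in> extensional {1..k} \<Longrightarrow> forget i (Suc k) (ins k i u v) = v"
  by (rule ext) (auto simp: forget_def ins_def extensional_def)

text \<open>After an insertion at \<open>i \<le> j\<close>, the old component \<open>j\<close> sits
  at position \<open>j + 1\<close>.\<close>

lemma forget_Suc_ins:
  "1 \<le> i \<Longrightarrow> i \<le> j \<Longrightarrow> j \<le> Suc k \<Longrightarrow>
    forget (Suc j) (Suc (Suc k)) (ins (Suc k) i u v) = ins k i u (forget j (Suc k) v)"
  by (rule ext) (auto simp: forget_def ins_def)

text \<open>The result does not depend on \<open>v\<close>. At the end of a row the contraction
  therefore factors through the augmentation.\<close>

lemma forget_2_ins_1: "forget 2 2 (ins 1 1 u v) = (\<lambda>l\<in>{1..1}. u)"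
  by (rule ext) (auto simp: forget_def ins_def)

lemma forget_forget:
  "1 \<le> i \<Longrightarrow> i < j \<Longrightarrow> j \<le> Suc k \<Longrightarrow>
    forget i k (forget j (Suc k) v) = forget (j - 1) k (forget i (Suc k) v)"
  by (rule ext) (auto simp: forget_def)

text \<open>An adjacent transposition either moves the inserted component by one place or acts on
  two neighbouring old components; the latter lie one place lower in \<open>v\<close> when they
  stand behind the insertion.\<close>

lemma permute_adjacent_ins:
  shows "1 \<le> i \<Longrightarrow> i \<le> k \<Longrightarrow> permute_components (Suc k) (Transposition.transpose i (Suc i)) (ins k i u v) = ins k (Suc i) u v"
    and "1 \<le> i \<Longrightarrow> i \<le> k \<Longrightarrow> permute_components (Suc k) (Transposition.transpose i (Suc i)) (ins k (Suc i) u v) = ins k i u v"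
    and "1 \<le> i \<Longrightarrow> i \<le> j \<Longrightarrow> j < k \<Longrightarrow> permute_components (Suc k) (Transposition.transpose (Suc j) (Suc (Suc j))) (ins k i u v) =
      ins k i u (permute_components k (Transposition.transpose j (Suc j)) v)"
    and "1 \<le> j \<Longrightarrow> Suc j < i \<Longrightarrow> i \<le> Suc k \<Longrightarrow> permute_components (Suc k) (Transposition.transpose j (Suc j)) (ins k i u v) =
      ins k i u (permute_components k (Transposition.transpose j (Suc j)) v)"
  by (rule ext; auto simp: permute_components_def ins_def Transposition.transpose_def)+

text \<open>Permuting components is precomposition, so it is a right action and the order of the
  factors is reversed.\<close>

lemma permute_components_permute_components:
  assumes "\<tau> permutes {1..k}"
  shows "permute_components k \<tau> (permute_components k \<sigma> v) = permute_components k (\<sigma> \<circ> \<tau>) v"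
proof
  fix l show "permute_components k \<tau> (permute_components k \<sigma> v) l = permute_components k (\<sigma> \<circ> \<tau>) v l"
    using permutes_in_image[OF assms, of l] by (auto simp: permute_components_def)
qed

lemma permute_components_id: "v \<in> extensional {1..k} \<Longrightarrow> permute_components k id v = v"
  by (rule ext) (auto simp: permute_components_def extensional_def)

lemma permute_components_forget_last:
  assumes "\<sigma> permutes {1..k}"
  shows "permute_components k \<sigma> (forget (Suc k) (Suc k) v) = forget (Suc k) (Suc k) (permute_components (Suc k) \<sigma> v)"
proof
  fix l show "permute_components k \<sigma> (forget (Suc k) (Suc k) v) l = forget (Suc k) (Suc k) (permute_components (Suc k) \<sigma> v) l"
    using permutes_in_image[OF assms, of l] by (auto simp: permute_components_def forget_def)
qed

text \<open>The exchange of two components is invisible once both are forgotten; with the sign from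
  alternation this gives \<open>eps_eps\<close>.\<close>

lemma forget_last_two_swap:
  "forget (Suc k) (Suc k) (forget (Suc (Suc k)) (Suc (Suc k))
     (permute_components (Suc (Suc k)) (Transposition.transpose (Suc k) (Suc (Suc k))) v)) =
   forget (Suc k) (Suc k) (forget (Suc (Suc k)) (Suc (Suc k)) v)"
  by (rule ext) (auto simp: permute_components_def forget_def Transposition.transpose_def)

section \<open>Alternating chains\<close>

definition alternating :: "nat \<Rightarrow> ((nat \<Rightarrow> 'v) list \<Rightarrow>\<^sub>0 int) \<Rightarrow> bool" where
  "alternating k c \<longleftrightarrow> (\<forall>\<sigma>. \<sigma> permutes {1..k} \<longrightarrow>
     simp_chain_map (permute_components k \<sigma>) c = frag_cmul (sign \<sigma>) c)"

lemma alternating_transpose: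
  assumes "alternating k c" "i \<in> {1..k}" "j \<in> {1..k}" "i \<noteq> j"
  shows "simp_chain_map (permute_components k (Transposition.transpose i j)) c = - c"
  using assms permutes_swap_id[of i "{1..k}" j] by (simp add: alternating_def sign_swap_id)

text \<open>The permutations that act by their sign are closed under composition, and the adjacent
  transpositions generate the symmetric group. Extensionality makes the identity permutation act
  trivially.\<close>

lemma alternatingI_adjacent:
  assumes ext: "\<And>vs. vs \<in> Poly_Mapping.keys c \<Longrightarrow> set vs \<subseteq> extensional {1..k}"
    and adj: "\<And>j. 1 \<le> j \<Longrightarrow> j < k \<Longrightarrow>
      simp_chain_map (permute_components k (Transposition.transpose j (Suc j))) c = - c"
  shows "alternating k c"
proof -
  define P where "P = (\<lambda>\<sigma>. simp_chain_map (permute_components k \<sigma>) c = frag_cmul (sign \<sigma>) c)"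
  have id: "P id"
    unfolding P_def using ext permute_components_id
    by (subst simp_chain_map_id) (auto intro!: map_idI)
  have comp: "P (\<sigma> \<circ> \<tau>)" if "P \<sigma>" "P \<tau>" "\<sigma> permutes {1..k}" "\<tau> permutes {1..k}" for \<sigma> \<tau>
  proof -
    have "simp_chain_map (permute_components k (\<sigma> \<circ> \<tau>)) c
      = simp_chain_map (permute_components k \<tau>) (simp_chain_map (permute_components k \<sigma>) c)"
      using that by (simp add: simp_chain_map_simp_chain_map permute_components_permute_components)
    also have "\<dots> = frag_cmul (sign \<sigma> * sign \<tau>) c"
      using that by (simp add: P_def simp_chain_map_cmul)
    also have "sign \<sigma> * sign \<tau> = (sign (\<sigma> \<circ> \<tau>) :: int)"
      using that by (simp add: sign_compose permutes_imp_permutation[of "{1..k}"])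
    finally show ?thesis unfolding P_def .
  qed
  have adj': "P (Transposition.transpose j (Suc j))" if "1 \<le> j" "j < k" for j
    using adj[OF that] by (simp add: P_def sign_swap_id)
  have *: "P (apply_adj_transps xs)" if "\<forall>j\<in>set xs. 1 \<le> j \<and> j < k" for xs
    using that
  proof (induction xs)
    case (Cons j xs)
    then have "P (Transposition.transpose j (Suc j) \<circ> apply_adj_transps xs)"
      by (intro comp adj' permutes_swap_id permutes_apply_adj_transps) auto
    then show ?case by (simp add: o_def)
  qed (simp add: id)
  have less: "P (Transposition.transpose a b)" if "a \<in> {1..k}" "b \<in> {1..k}" "a < b" for a b
    using *[of "adj_transp_seq a b"] that by (simp add: set_adj_transp_seq adj_transp_seq_correct)
  have swap: "P (Transposition.transpose a b)" if "a \<in> {1..k}" "b \<in> {1..k}" "a \<noteq> b" for a b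
    using less[of a b] less[of b a] that by (cases "a < b") (auto simp: transpose_commute)
  have "P \<sigma>" if "\<sigma> permutes {1..k}" for \<sigma>
    using that finite_atLeastAtMost
  proof (induction rule: permutes_induct)
    case *: (swap a b p)
    then show ?case by (intro comp swap permutes_swap_id)
  qed (rule id)
  then show ?thesis by (simp add: alternating_def P_def)
qed

text \<open>A permutation of the first \<open>k\<close> indices extends by a fixed point to
  \<open>k + 1\<close> indices, with the same sign, and commutes with forgetting the last
  component.\<close>

lemma alternating_forget_last:
  assumes "alternating (Suc k) c"
  shows "alternating k (simp_chain_map (forget (Suc k) (Suc k)) c)"
  unfolding alternating_def
proof (intro allI impI)
  fix \<sigma> assume \<sigma>: "\<sigma> permutes {1..k}"
  then have "\<sigma> permutes {1..Suc k}" by (rule permutes_subset) auto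
  then have "simp_chain_map (permute_components (Suc k) \<sigma>) c = frag_cmul (sign \<sigma>) c"
    using assms by (simp add: alternating_def)
  then show "simp_chain_map (permute_components k \<sigma>) (simp_chain_map (forget (Suc k) (Suc k)) c) =
     frag_cmul (sign \<sigma>) (simp_chain_map (forget (Suc k) (Suc k)) c)"
    unfolding simp_chain_map_simp_chain_map permute_components_forget_last[OF \<sigma>]
    by (metis simp_chain_map_cmul simp_chain_map_simp_chain_map)
qed

lemma alternating_zero: "alternating k 0"
  and alternating_add: "alternating k c \<Longrightarrow> alternating k d \<Longrightarrow> alternating k (c + d)"
  and alternating_cmul: "alternating k c \<Longrightarrow> alternating k (frag_cmul a c)"
  and alternating_boundary: "alternating k c \<Longrightarrow> alternating k (simp_boundary n c)"
  by (auto simp: alternating_def simp_chain_map_add simp_chain_map_cmul frag_cmul_distrib2 mult.commute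
     simp_boundary_cmul simp flip: simp_boundary_simp_chain_map)

lemma alternating_1:
  assumes "\<And>vs. vs \<in> Poly_Mapping.keys c \<Longrightarrow> set vs \<subseteq> extensional {1..1}"
  shows "alternating 1 c"
  by (rule alternatingI_adjacent) (use assms in auto)

text \<open>Swapping the last two components first changes the sign of \<open>c\<close> but not the
  result, which is thus its own negative.\<close>

lemma eps_eps:
  assumes "alternating (Suc (Suc k)) c"
  shows "eps (Suc k) n (eps (Suc (Suc k)) n c) = 0"
proof -
  let ?r = "\<lambda>c. simp_chain_map (forget (Suc k) (Suc k)) (simp_chain_map (forget (Suc (Suc k)) (Suc (Suc k))) c)"
  have "?r c = ?r (simp_chain_map (permute_components (Suc (Suc k)) (Transposition.transpose (Suc k) (Suc (Suc k)))) c)"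
    by (simp add: simp_chain_map_simp_chain_map forget_last_two_swap)
  also have "\<dots> = - ?r c"
    using alternating_transpose[OF assms, of "Suc k" "Suc (Suc k)"] by (simp add: simp_chain_map_uminus)
  finally show ?thesis
    using frag_self_inverse_eq_0 by (simp add: eps_def simp_chain_map_cmul)
qed

text \<open>Summation from 0 makes the sign exponent equal to the index, as in
  \<open>alternating_double_sum_eq_0\<close>.\<close>

lemma rho_eq: "rho (Suc k) n c = frag_cmul ((-1) ^ n) (\<Sum>i\<le>k. frag_cmul ((-1) ^ i) (simp_chain_map (forget (Suc i) (Suc k)) c))"
  unfolding rho_def
  by (simp only: One_nat_def sum.atLeast1_atMost_eq lessThan_Suc_atMost diff_Suc_Suc diff_zero)

lemma rho_rho: "rho (Suc k) n (rho (Suc (Suc k)) n c) = 0"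
proof -
  let ?F = "\<lambda>i j. simp_chain_map (\<lambda>x. forget (Suc i) (Suc k) (forget (Suc j) (Suc (Suc k)) x)) c"
  have "(\<Sum>j\<le>Suc k. \<Sum>i\<le>k. frag_cmul ((-1) ^ (i + j)) (?F i j)) = 0"
  proof (rule alternating_double_sum_eq_0)
    fix i j assume "i < j" "j \<le> Suc k"
    then have "forget (Suc i) (Suc k) (forget (Suc j) (Suc (Suc k)) x) =
       forget (Suc (j - 1)) (Suc k) (forget (Suc i) (Suc (Suc k)) x)" for x :: "nat \<Rightarrow> 'a"
      using forget_forget[of "Suc i" "Suc j" "Suc k" x] by simp
    then show "?F i j = ?F (j - 1) i" by simp
  qed
  then have "(\<Sum>i\<le>k. \<Sum>j\<le>Suc k. frag_cmul ((-1) ^ (i + j)) (?F i j)) = 0"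
    by (subst sum.swap)
  then have *: "(\<Sum>i\<le>k. frag_cmul ((-1) ^ i) (\<Sum>j\<le>Suc k. frag_cmul ((-1) ^ j) (?F i j))) = 0"
    by (simp add: frag_cmul_sum power_add del: sum.atMost_Suc)
  have "rho (Suc k) n (rho (Suc (Suc k)) n c) = frag_cmul ((-1) ^ n * (-1) ^ n)
      (\<Sum>i\<le>k. frag_cmul ((-1) ^ i) (\<Sum>j\<le>Suc k. frag_cmul ((-1) ^ j) (?F i j)))"
    by (simp add: rho_eq simp_chain_map_cmul simp_chain_map_sum simp_chain_map_simp_chain_map
      frag_cmul_sum mult_ac del: sum.atMost_Suc)
  then show ?thesis using * by simp
qed

section \<open>Exactness of the rows\<close>

text \<open>Keeps the first component \<open>v 1\<close> of a tuple from being rewritten to \<open>v (Suc 0)\<close>.\<close>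

declare One_nat_def [simp del]

lemma simp_boundary_degree_0 [simp]: "simp_boundary 0 c = 0"
  by (simp add: simp_boundary_def)

lemma frag_cmul_power_minus_one: "frag_cmul ((-1) ^ n) c = (if even n then c else - c)"
  by (cases "even n") auto

lemma frag_cmul_diff: "frag_cmul a (c - d) = frag_cmul a c - frag_cmul a d"
  by (rule poly_mapping_eqI) (simp add: lookup_minus right_diff_distrib)

lemma frag_cmul_minus: "frag_cmul a (- c) = frag_cmul (- a) c"
  by (rule poly_mapping_eqI) simp

text \<open>Both double complexes have the shape \<open>d'' = (-1) ^ p R\<close> with
  \<open>R\<close> free of the sign and commuting with the boundary. What remains to be shown
  concerns the rows of \<open>R\<close> alone, for each \<open>p\<close> separately; index
  \<open>q\<close> stands for tuples of length \<open>q + 1\<close>.\<close>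

lemma augmented_double_complexI:
  fixes X :: "nat \<Rightarrow> nat \<Rightarrow> ('x list \<Rightarrow>\<^sub>0 int) set" and U :: "'w set set"
  assumes X_zero: "\<And>p q. 0 \<in> X p q"
    and X_diff: "\<And>p q c d. c \<in> X p q \<Longrightarrow> d \<in> X p q \<Longrightarrow> c - d \<in> X p q"
    and X_length: "\<And>p q c vs. c \<in> X p q \<Longrightarrow> vs \<in> Poly_Mapping.keys c \<Longrightarrow> length vs = Suc p"
    and X_boundary: "\<And>p q c. c \<in> X (Suc p) q \<Longrightarrow> simp_boundary (Suc p) c \<in> X p q"
    and R_closed: "\<And>p q c. c \<in> X p (Suc q) \<Longrightarrow> R (Suc q) c \<in> X p q"
    and R_diff: "\<And>q c d. R q (c - d) = R q c - R q d"
    and R_boundary: "\<And>p q c. R q (simp_boundary p c) = simp_boundary p (R q c)"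
    and R_R: "\<And>p q c. c \<in> X p (Suc (Suc q)) \<Longrightarrow> R (Suc q) (R (Suc (Suc q)) c) = 0"
    and R_exact: "\<And>p q c. c \<in> X p (Suc q) \<Longrightarrow> R (Suc q) c = 0 \<Longrightarrow> \<exists>b\<in>X p (Suc (Suc q)). R (Suc (Suc q)) b = c"
    and a_surj: "\<And>p. simp_chain_map g ` X p 0 = {c. Poly_Mapping.keys c \<subseteq> ordered_simplices U p}"
    and a_R: "\<And>p c. c \<in> X p 1 \<Longrightarrow> simp_chain_map g (R 1 c) = 0"
    and a_kernel: "\<And>p c. c \<in> X p 0 \<Longrightarrow> simp_chain_map g c = 0 \<Longrightarrow> \<exists>b\<in>X p 1. R 1 b = c"
  shows "augmented_double_complex (\<lambda>p q. \<lparr>carrier = X p q, monoid.mult = (+), one = 0\<rparr>)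
    (\<lambda>p q. simp_boundary p) (\<lambda>p q. if q = 0 then (\<lambda>c. 0) else (\<lambda>c. frag_cmul ((-1) ^ p) (R q c)))
    (simp_chain_group U) simp_boundary (\<lambda>p. simp_chain_map g)"
proof -
  let ?C = "\<lambda>p q. \<lparr>carrier = X p q, monoid.mult = (+), one = 0\<rparr>"
  let ?d = "\<lambda>p q. if q = 0 then (\<lambda>c. 0) else (\<lambda>c. frag_cmul ((-1) ^ p) (R q c))"
  have X_uminus: "- c \<in> X p q" if "c \<in> X p q" for p q c using X_diff[OF X_zero that] by simp
  have X_add: "c + d \<in> X p q" if "c \<in> X p q" "d \<in> X p q" for p q c d
    using X_diff[OF that(1) X_uminus[OF that(2)]] by simp
  have R_zero: "R q 0 = 0" for q using R_diff[of q 0 0] by simp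
  have R_uminus: "R q (- c) = - R q c" for q c using R_diff[of q 0 c] R_zero by simp
  have R_add: "R q (c + d) = R q c + R q d" for q c d using R_diff[of q c "- d"] R_uminus by simp
  have d_add: "?d p q (c + d) = ?d p q c + ?d p q d" for p q c d
    by (simp add: R_add frag_cmul_distrib2)
  have d_closed: "?d p q c \<in> X p (q - 1)" if "c \<in> X p q" for p q c
    using that R_closed X_uminus X_zero by (cases q) (auto simp: frag_cmul_power_minus_one)
  have b_closed: "simp_boundary p c \<in> X (p - 1) q" if "c \<in> X p q" for p q c
    using that X_boundary X_zero by (cases p) auto
  have comm: "comm_group (?C p q)" for p q
    by (rule comm_groupI) (auto simp: X_zero X_add add.assoc add.commute intro!: bexI[of _ "- _"] X_uminus)
  have U: "simp_chain_group U n = \<lparr>carrier = {c. Poly_Mapping.keys c \<subseteq> ordered_simplices U n}, monoid.mult = (+), one = 0\<rparr>" for n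
    by (simp add: simp_chain_group_def free_Abelian_group_def)
  have dc: "double_complex ?C (\<lambda>p q. simp_boundary p) ?d"
    unfolding double_complex_def
  proof (intro allI conjI ballI)
    fix p q c assume "c \<in> carrier (?C p q)"
    then have c: "c \<in> X p q" by simp
    show "simp_boundary (p - 1) (simp_boundary p c) = \<one>\<^bsub>?C (p - 2) q\<^esub>"
      using simp_boundary_simp_boundary[of c p] X_length[OF c] by simp
    show "?d p (q - 1) (?d p q c) = \<one>\<^bsub>?C p (q - 2)\<^esub>"
    proof (cases "q \<le> 1")
      case False
      then obtain q' where "q = Suc (Suc q')" by (metis One_nat_def Suc_le_mono le0 not0_implies_Suc)
      then show ?thesis using R_R[of c p q'] c by (auto simp: frag_cmul_power_minus_one R_uminus)
    qed auto
    show "simp_boundary p (?d p q c) \<otimes>\<^bsub>?C (p - 1) (q - 1)\<^esub> ?d (p - 1) q (simp_boundary p c)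
      = \<one>\<^bsub>?C (p - 1) (q - 1)\<^esub>"
    proof (cases p)
      case 0
      then show ?thesis by (simp add: R_zero)
    next
      case (Suc p')
      \<comment> \<open>The signs belonging to \<open>Suc p'\<close> and \<open>p'\<close> are
        opposite, so the commuting square anticommutes.\<close>
      then show ?thesis by (simp add: simp_boundary_cmul R_boundary flip: frag_cmul_distrib)
    qed
  qed (use comm b_closed d_closed d_add simp_boundary_add in \<open>auto simp: hom_def\<close>)
  show ?thesis
  proof (intro augmented_double_complex.intro exact_double_complex.intro additive_double_complex.intro
      exact_double_complex_axioms.intro augmented_double_complex_axioms.intro)
    show "double_complex ?C (\<lambda>p q. simp_boundary p) ?d" by (rule dc)
    show "\<exists>b\<in>carrier (?C p (Suc (Suc q))). ?d p (Suc (Suc q)) b = c"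
      if c: "c \<in> carrier (?C p (Suc q))" "?d p (Suc q) c = 0" for c p q
    proof -
      obtain b where b: "b \<in> X p (Suc (Suc q))" "R (Suc (Suc q)) b = c"
        using R_exact[of c p q] c by auto
      \<comment> \<open>The sign \<open>(-1) ^ p\<close> of the differential is absorbed into the
        preimage.\<close>
      then show ?thesis using X_uminus[OF b(1)]
        by (intro bexI[of _ "if even p then b else - b"]) (auto simp: R_uminus)
    qed
    show "comm_group (simp_chain_group U n)" for n
      by (simp add: simp_chain_group_def abelian_free_Abelian_group)
    show "simp_boundary n \<in> hom (simp_chain_group U n) (simp_chain_group U (n - 1))" for n
    proof (rule homI)
      fix y assume "y \<in> carrier (simp_chain_group U n)"
      \<comment> \<open>Closure of the target chains under the boundary is inherited along the
        surjection, on whose source it is \<open>X_boundary\<close>.\<close>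
      then have "y \<in> simp_chain_map g ` X n 0" unfolding a_surj by (simp add: U)
      then obtain x where x: "x \<in> X n 0" "y = simp_chain_map g x" by blast
      then have "simp_boundary n y = simp_chain_map g (simp_boundary n x)" by (simp add: simp_boundary_simp_chain_map)
      then show "simp_boundary n y \<in> carrier (simp_chain_group U (n - 1))"
        using b_closed[OF x(1)] a_surj[of "n - 1"] by (auto simp: U)
    qed (simp add: U simp_boundary_add)
    show "simp_chain_map g \<in> hom (?C n 0) (simp_chain_group U n)" for n
      by (rule homI) (use a_surj[of n] in \<open>auto simp: U simp_chain_map_add\<close>)
    show "simp_chain_map g ` carrier (?C n 0) = carrier (simp_chain_group U n)" for n
      using a_surj by (simp add: U)
    show "simp_chain_map g (?d n 1 c) = 0" if "c \<in> carrier (?C n 1)" for c n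
      using a_R that by (simp add: simp_chain_map_cmul)
    show "\<exists>b\<in>carrier (?C n 1). ?d n 1 b = c" if c: "c \<in> carrier (?C n 0)" "simp_chain_map g c = 0" for c n
    proof -
      obtain b where b: "b \<in> X n 1" "R 1 b = c"
        using a_kernel[of c n] c by auto
      then show ?thesis using X_uminus[OF b(1)]
        by (intro bexI[of _ "if even n then b else - b"]) (auto simp: R_uminus)
    qed
    show "simp_chain_map g (simp_boundary (Suc n) c) = simp_boundary (Suc n) (simp_chain_map g c)" for c n
      by (simp add: simp_boundary_simp_chain_map)
  qed (auto simp: U)
qed

section \<open>Columns of lists of tuples\<close>

lemma fibre_powerI:
  assumes "set vs \<subseteq> extensional {1..k}" "\<And>l. l \<in> {1..k} \<Longrightarrow> map (\<lambda>v. v l) vs \<in> S"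
    and "\<And>l. l \<in> {1..k} \<Longrightarrow> map f (map (\<lambda>v. v l) vs) = b"
  shows "vs \<in> fibre_power S f k"
  using assms by (simp add: fibre_power_def o_def del: map_eq_conv)

lemma fibre_powerD:
  assumes "vs \<in> fibre_power S f k"
  shows "set vs \<subseteq> extensional {1..k}" "l \<in> {1..k} \<Longrightarrow> map (\<lambda>v. v l) vs \<in> S"
    and "l \<in> {1..k} \<Longrightarrow> map f (map (\<lambda>v. v l) vs) = map (\<lambda>v. f (v 1)) vs"
proof -
  show "map f (map (\<lambda>v. v l) vs) = map (\<lambda>v. f (v 1)) vs" if "l \<in> {1..k}"
  proof -
    have "1 \<in> {1..k}" using that by auto
    then have "map (\<lambda>v. f (v l)) vs = map (\<lambda>v. f (v 1)) vs"
      using assms that unfolding fibre_power_def by blast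
    then show ?thesis by (simp add: o_def del: map_eq_conv)
  qed
qed (use assms in \<open>auto simp: fibre_power_def\<close>)

lemma map_forget_fibre_power:
  assumes vs: "vs \<in> fibre_power S f (Suc k)" and i: "1 \<le> i" "i \<le> Suc k"
  shows "map (forget i (Suc k)) vs \<in> fibre_power S f k"
    and "1 \<le> k \<Longrightarrow> map (\<lambda>v. f (v 1)) (map (forget i (Suc k)) vs) = map (\<lambda>v. f (v 1)) vs"
proof -
  have col: "map (\<lambda>v. v l) (map (forget i (Suc k)) vs) = map (\<lambda>v. v (if l < i then l else Suc l)) vs"
    if "l \<in> {1..k}" for l
    using that by (auto simp: forget_def)
  have *: "map f (map (\<lambda>v. v l) (map (forget i (Suc k)) vs)) = map (\<lambda>v. f (v 1)) vs" if "l \<in> {1..k}" for l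
    unfolding col[OF that] using that by (intro fibre_powerD(3)[OF vs]) auto
  show "map (forget i (Suc k)) vs \<in> fibre_power S f k"
  proof (rule fibre_powerI)
    show "set (map (forget i (Suc k)) vs) \<subseteq> extensional {1..k}" by (auto simp: forget_def)
    show "map (\<lambda>v. v l) (map (forget i (Suc k)) vs) \<in> S" if "l \<in> {1..k}" for l
      unfolding col[OF that] using that by (intro fibre_powerD(2)[OF vs]) auto
  qed (rule *)
  show "map (\<lambda>v. f (v 1)) (map (forget i (Suc k)) vs) = map (\<lambda>v. f (v 1)) vs" if "1 \<le> k"
    using *[of 1] that by (simp add: o_def)
qed

lemma map_permute_fibre_power:
  assumes vs: "vs \<in> fibre_power S f k" and \<sigma>: "\<sigma> permutes {1..k}"
  shows "map (permute_components k \<sigma>) vs \<in> fibre_power S f k"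
    and "1 \<le> k \<Longrightarrow> map (\<lambda>v. f (v 1)) (map (permute_components k \<sigma>) vs) = map (\<lambda>v. f (v 1)) vs"
proof -
  have col: "map (\<lambda>v. v l) (map (permute_components k \<sigma>) vs) = map (\<lambda>v. v (\<sigma> l)) vs"
    if "l \<in> {1..k}" for l
    using that by (auto simp: permute_components_def)
  have \<sigma>l: "\<sigma> l \<in> {1..k}" if "l \<in> {1..k}" for l using permutes_in_image[OF \<sigma>] that by blast
  have *: "map f (map (\<lambda>v. v l) (map (permute_components k \<sigma>) vs)) = map (\<lambda>v. f (v 1)) vs" if "l \<in> {1..k}" for l
    unfolding col[OF that] using that by (intro fibre_powerD(3)[OF vs] \<sigma>l)
  show "map (permute_components k \<sigma>) vs \<in> fibre_power S f k"
  proof (rule fibre_powerI)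
    show "set (map (permute_components k \<sigma>) vs) \<subseteq> extensional {1..k}" by (auto simp: permute_components_def)
    show "map (\<lambda>v. v l) (map (permute_components k \<sigma>) vs) \<in> S" if "l \<in> {1..k}" for l
      unfolding col[OF that] using that by (intro fibre_powerD(2)[OF vs] \<sigma>l)
  qed (rule *)
  show "map (\<lambda>v. f (v 1)) (map (permute_components k \<sigma>) vs) = map (\<lambda>v. f (v 1)) vs" if "1 \<le> k"
    using *[of 1] that by (simp add: o_def)
qed

lemma ordered_simplices_remove_nth:
  assumes "\<And>s t. s \<in> V \<Longrightarrow> t \<subseteq> s \<Longrightarrow> t \<in> V" "vs \<in> ordered_simplices V (Suc n)" "i \<le> Suc n"
  shows "take i vs @ drop (Suc i) vs \<in> ordered_simplices V n"
proof -
  have vs: "length vs = Suc (Suc n)" "distinct vs" "set vs \<in> V" using assms by (auto simp: ordered_simplices_def)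
  have "distinct (take i vs @ vs ! i # drop (Suc i) vs)"
    using vs assms(3) id_take_nth_drop[of i vs] by simp
  then have "distinct (take i vs @ drop (Suc i) vs)" by auto
  moreover have "set (take i vs @ drop (Suc i) vs) \<subseteq> set vs" by (auto dest: in_set_takeD in_set_dropD)
  then have "set (take i vs @ drop (Suc i) vs) \<in> V" by (rule assms(1)[OF vs(3)])
  moreover have "length (take i vs @ drop (Suc i) vs) = Suc n" using vs(1) assms(3) by simp
  ultimately show ?thesis unfolding ordered_simplices_def by blast
qed

text \<open>The combinatorial residue of the geometry. The equation \<open>surj\<close> carries two
  facts: \<open>f\<close> sends ordered simplices to ordered simplices of the same dimension, and
  every ordered simplex downstairs has a lift.\<close>

locale fibre_system =
  fixes V :: "'v set set" and U :: "'w set set" and f :: "'v \<Rightarrow> 'w"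
  assumes faces: "s \<in> V \<Longrightarrow> t \<subseteq> s \<Longrightarrow> t \<in> V"
    and surj: "map f ` ordered_simplices V n = ordered_simplices U n"
begin

abbreviation FP :: "nat \<Rightarrow> nat \<Rightarrow> (nat \<Rightarrow> 'v) list set" where
  "FP n k \<equiv> fibre_power (ordered_simplices V n) f k"

abbreviation base :: "(nat \<Rightarrow> 'v) list \<Rightarrow> 'w list" where
  "base vs \<equiv> map (\<lambda>v. f (v 1)) vs"

text \<open>A choice for each ordered simplex by itself; lifts of faces need not be faces of
  lifts.\<close>

definition lift :: "'w list \<Rightarrow> 'v list" where
  "lift ws = (SOME us. us \<in> ordered_simplices V (length ws - 1) \<and> map f us = ws)"

text \<open>Inserts the lift of the common image as a new \<open>i\<close>-th column. Since
  \<open>vs\<close> is stored as a list of tuples, the column is distributed over its members by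
  \<open>map2\<close>.\<close>

definition cone :: "nat \<Rightarrow> nat \<Rightarrow> (nat \<Rightarrow> 'v) list \<Rightarrow> (nat \<Rightarrow> 'v) list" where
  "cone k i vs = map2 (ins k i) (lift (base vs)) vs"

definition chain_cone :: "nat \<Rightarrow> nat \<Rightarrow> ((nat \<Rightarrow> 'v) list \<Rightarrow>\<^sub>0 int) \<Rightarrow> ((nat \<Rightarrow> 'v) list \<Rightarrow>\<^sub>0 int)" where
  "chain_cone k i = frag_extend (\<lambda>vs. frag_of (cone k i vs))"

lemma lift:
  assumes "ws \<in> ordered_simplices U n"
  shows "lift ws \<in> ordered_simplices V n" "map f (lift ws) = ws" "length (lift ws) = length ws"
proof -
  have "length ws - 1 = n" using assms by (simp add: ordered_simplices_def)
  moreover obtain us where "us \<in> ordered_simplices V n" "ws = map f us"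
    using assms unfolding surj[symmetric] by (rule imageE)
  ultimately have "\<exists>us. us \<in> ordered_simplices V (length ws - 1) \<and> map f us = ws" by blast
  then have "lift ws \<in> ordered_simplices V (length ws - 1) \<and> map f (lift ws) = ws"
    unfolding lift_def by (rule someI_ex)
  then show "lift ws \<in> ordered_simplices V n" "map f (lift ws) = ws"
    by (simp_all add: \<open>length ws - 1 = n\<close>)
  then show "length (lift ws) = length ws" by (metis length_map)
qed

lemma base_mem:
  assumes "vs \<in> FP n k" "1 \<le> k" shows "base vs \<in> ordered_simplices U n"
proof -
  have "map f (map (\<lambda>v. v 1) vs) \<in> map f ` ordered_simplices V n"
    using fibre_powerD(2)[OF assms(1), of 1] assms(2) by (intro imageI) auto
  then show ?thesis unfolding surj by (simp add: o_def)
qed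

lemma FP_length: "vs \<in> FP n k \<Longrightarrow> 1 \<le> k \<Longrightarrow> length vs = Suc n"
  using base_mem by (force simp: ordered_simplices_def)

lemma FP_remove_nth:
  assumes "vs \<in> FP (Suc n) k" "i \<le> Suc n"
  shows "take i vs @ drop (Suc i) vs \<in> FP n k"
proof (rule fibre_powerI)
  show "set (take i vs @ drop (Suc i) vs) \<subseteq> extensional {1..k}"
    using fibre_powerD(1)[OF assms(1)] by (auto dest: in_set_takeD in_set_dropD)
next
  fix l assume l: "l \<in> {1..k}"
  show "map (\<lambda>v. v l) (take i vs @ drop (Suc i) vs) \<in> ordered_simplices V n"
    using ordered_simplices_remove_nth[OF faces fibre_powerD(2)[OF assms(1) l] assms(2)]
    by (simp add: take_map drop_map)
  show "map f (map (\<lambda>v. v l) (take i vs @ drop (Suc i) vs)) = take i (base vs) @ drop (Suc i) (base vs)"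
    unfolding fibre_powerD(3)[OF assms(1) l, symmetric] by (simp add: take_map drop_map)
qed

lemma keys_simp_boundary_FP:
  assumes "Poly_Mapping.keys c \<subseteq> FP (Suc n) k" shows "Poly_Mapping.keys (simp_boundary (Suc n) c) \<subseteq> FP n k"
proof
  fix vs assume "vs \<in> Poly_Mapping.keys (simp_boundary (Suc n) c)"
  then obtain us i where "us \<in> Poly_Mapping.keys c" "i \<le> Suc n" "vs = take i us @ drop (Suc i) us"
    by (rule keys_simp_boundary)
  then show "vs \<in> FP n k" using FP_remove_nth[of us n k i] assms by blast
qed

lemma cone_FP:
  assumes vs: "vs \<in> FP n k" and k: "1 \<le> k" and i: "1 \<le> i" "i \<le> Suc k"
  shows "cone k i vs \<in> FP n (Suc k)"
proof (rule fibre_powerI)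
  note base = base_mem[OF vs k]
  have len: "length (lift (base vs)) = length vs" using lift(3)[OF base] by simp
  show "set (cone k i vs) \<subseteq> extensional {1..Suc k}" by (auto simp: cone_def ins_def)
  fix l assume l: "l \<in> {1..Suc k}"
  have col: "map (\<lambda>v. v l) (cone k i vs) = (if l < i then map (\<lambda>v. v l) vs else if l = i then lift (base vs)
     else map (\<lambda>v. v (l - 1)) vs)"
    unfolding cone_def using l by (intro nth_equalityI) (auto simp: ins_def len)
  have l': "l < i \<Longrightarrow> l \<in> {1..k}" "i < l \<Longrightarrow> l - 1 \<in> {1..k}" using l i by auto
  show "map (\<lambda>v. v l) (cone k i vs) \<in> ordered_simplices V n"
    unfolding col using lift(1)[OF base] fibre_powerD(2)[OF vs] l' by (cases l i rule: linorder_cases) auto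
  show "map f (map (\<lambda>v. v l) (cone k i vs)) = base vs"
    unfolding col using lift(2)[OF base] fibre_powerD(3)[OF vs] l'
    by (cases l i rule: linorder_cases) (simp_all del: map_map map_eq_conv)
qed

lemma map_cone:
  assumes "vs \<in> FP n k" "1 \<le> k"
  shows "\<And>g. map g (cone k i vs) = map2 (\<lambda>u v. g (ins k i u v)) (lift (base vs)) vs"
    and "map2 (\<lambda>u v. v) (lift (base vs)) vs = vs"
    and "\<And>h. map2 (\<lambda>u v. h u) (lift (base vs)) vs = map h (lift (base vs))"
  using lift(3)[OF base_mem[OF assms]]
  by (auto simp: cone_def intro!: nth_equalityI)

lemma map_forget_cone_same:
  assumes vs: "vs \<in> FP n k" and "1 \<le> k" "1 \<le> i" "i \<le> Suc k"
  shows "map (forget i (Suc k)) (cone k i vs) = vs"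
proof -
  have "map2 (\<lambda>u v. forget i (Suc k) (ins k i u v)) (lift (base vs)) vs = map2 (\<lambda>u v. v) (lift (base vs)) vs"
    using assms fibre_powerD(1)[OF vs] by (auto intro!: map_cong forget_ins dest: set_zip_rightD)
  then show ?thesis by (simp only: map_cone(1,2)[OF vs \<open>1 \<le> k\<close>])
qed

text \<open>Forgetting one of the old columns leaves another one, hence the same common image and
  the same lift to insert.\<close>

lemma map_forget_Suc_cone:
  assumes vs: "vs \<in> FP n (Suc k)" and "1 \<le> k" "1 \<le> i" "i \<le> j" "j \<le> Suc k"
  shows "map (forget (Suc j) (Suc (Suc k))) (cone (Suc k) i vs) = cone k i (map (forget j (Suc k)) vs)"
proof -
  have base: "base (map (forget j (Suc k)) vs) = base vs"
    using assms by (intro map_forget_fibre_power(2)[OF vs]) auto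
  have "map (forget (Suc j) (Suc (Suc k))) (cone (Suc k) i vs) =
    map2 (\<lambda>u v. ins k i u (forget j (Suc k) v)) (lift (base vs)) vs"
    using assms by (subst map_cone(1)[OF vs]) (simp_all add: forget_Suc_ins)
  also have "\<dots> = cone k i (map (forget j (Suc k)) vs)"
    unfolding cone_def base by (simp add: zip_map2 o_def case_prod_beta)
  finally show ?thesis .
qed

section \<open>Insertion of the lift, on chains\<close>

lemma keys_chain_cone:
  assumes "Poly_Mapping.keys c \<subseteq> FP n k" "1 \<le> k" "1 \<le> i" "i \<le> Suc k"
  shows "Poly_Mapping.keys (chain_cone k i c) \<subseteq> FP n (Suc k)"
  using keys_frag_extend_frag_of[of "cone k i" c] cone_FP[OF _ assms(2-4)] assms(1)
  unfolding chain_cone_def by blast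

lemma chain_cone_zero [simp]: "chain_cone k i 0 = 0"
  and chain_cone_uminus: "chain_cone k i (- c) = - chain_cone k i c"
  and chain_cone_cmul: "chain_cone k i (frag_cmul a c) = frag_cmul a (chain_cone k i c)"
  and chain_cone_add: "chain_cone k i (c + d) = chain_cone k i c + chain_cone k i d"
  by (simp_all add: chain_cone_def frag_extend_minus frag_extend_cmul frag_extend_add)

lemma chain_cone_sum: "chain_cone k i (sum h I) = (\<Sum>j\<in>I. chain_cone k i (h j))"
  by (induction I rule: infinite_finite_induct) (auto simp: chain_cone_add)

lemma simp_chain_map_forget_cone_same:
  assumes "Poly_Mapping.keys c \<subseteq> FP n k" "1 \<le> k" "1 \<le> i" "i \<le> Suc k"
  shows "simp_chain_map (forget i (Suc k)) (chain_cone k i c) = c"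
proof -
  have "simp_chain_map (forget i (Suc k)) (chain_cone k i c) = frag_extend frag_of c"
    unfolding chain_cone_def simp_chain_map_frag_extend
  proof (rule frag_extend_eq)
    fix vs assume "vs \<in> Poly_Mapping.keys c"
    then have "vs \<in> FP n k" using assms(1) by blast
    then show "frag_of (map (forget i (Suc k)) (cone k i vs)) = frag_of vs"
      by (simp only: map_forget_cone_same[OF _ assms(2-4)])
  qed
  then show ?thesis by (simp flip: frag_expansion)
qed

lemma simp_chain_map_forget_Suc_cone:
  assumes "Poly_Mapping.keys c \<subseteq> FP n (Suc k)" "1 \<le> k" "1 \<le> i" "i \<le> j" "j \<le> Suc k"
  shows "simp_chain_map (forget (Suc j) (Suc (Suc k))) (chain_cone (Suc k) i c) =
    chain_cone k i (simp_chain_map (forget j (Suc k)) c)"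
  unfolding chain_cone_def simp_chain_map_frag_extend frag_extend_simp_chain_map
proof (rule frag_extend_eq)
  fix vs assume "vs \<in> Poly_Mapping.keys c"
  then have "vs \<in> FP n (Suc k)" using assms(1) by blast
  then show "frag_of (map (forget (Suc j) (Suc (Suc k))) (cone (Suc k) i vs)) = frag_of (cone k i (map (forget j (Suc k)) vs))"
    by (simp only: map_forget_Suc_cone[OF _ assms(2-5)])
qed

text \<open>Once the only old column is forgotten, what remains is the lift of the common image, a
  function of the augmented chain alone.\<close>

lemma simp_chain_map_forget_2_cone:
  assumes "Poly_Mapping.keys c \<subseteq> FP n 1" "simp_chain_map (\<lambda>v. f (v 1)) c = 0"
  shows "simp_chain_map (forget 2 2) (chain_cone 1 1 c) = 0"
proof -
  let ?h = "\<lambda>u. \<lambda>l\<in>{1..1::nat}. u"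
  have "map (forget 2 2) (cone 1 1 vs) = map ?h (lift (base vs))" if "vs \<in> FP n 1" for vs
    by (simp add: map_cone(1,3)[OF that] forget_2_ins_1)
  then have "simp_chain_map (forget 2 2) (chain_cone 1 1 c) =
     frag_extend (\<lambda>vs. frag_of (map ?h (lift (base vs)))) c"
    unfolding chain_cone_def simp_chain_map_frag_extend
    using assms(1) by (intro frag_extend_eq) (simp only: subsetD)
  also have "\<dots> = frag_extend (\<lambda>ws. frag_of (map ?h (lift ws))) (simp_chain_map (\<lambda>v. f (v 1)) c)"
    by (simp only: frag_extend_simp_chain_map)
  finally show ?thesis using assms(2) by simp
qed

text \<open>If the transposition does not touch the inserted column, it acts on the old columns by
  an adjacent transposition, and \<open>c\<close> contributes the sign.\<close>

lemma simp_chain_map_permute_cone: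
  assumes c: "Poly_Mapping.keys c \<subseteq> FP n k" "alternating k c" and k: "1 \<le> k"
    and j: "1 \<le> j" "j \<le> k" and i: "1 \<le> i" "i \<le> Suc k"
  shows "simp_chain_map (permute_components (Suc k) (Transposition.transpose j (Suc j))) (chain_cone k i c) =
    (if i = j then chain_cone k (Suc j) c else if i = Suc j then chain_cone k j c else - chain_cone k i c)"
proof -
  let ?\<tau> = "permute_components (Suc k) (Transposition.transpose j (Suc j))"
  have *: "simp_chain_map ?\<tau> (chain_cone k i c) = frag_extend (\<lambda>vs. frag_of (map ?\<tau> (cone k i vs))) c"
    unfolding chain_cone_def simp_chain_map_frag_extend ..
  have map_\<tau>: "map ?\<tau> (cone k i vs) = map2 (\<lambda>u v. ?\<tau> (ins k i u v)) (lift (base vs)) vs"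
    if "vs \<in> Poly_Mapping.keys c" for vs
    using map_cone(1) k that c(1) by blast
  \<comment> \<open>Treats the positions \<open>i < j\<close> and \<open>Suc j < i\<close> together:
    \<open>j'\<close> is the index of the same transposition on the old columns,
    \<open>j - 1\<close> in the former and \<open>j\<close> in the latter.\<close>
  have same: "simp_chain_map ?\<tau> (chain_cone k i c) = - chain_cone k i c"
    if j': "1 \<le> j'" "j' < k" and \<tau>: "\<And>(u::'v) v. ?\<tau> (ins k i u v) = ins k i u (permute_components k (Transposition.transpose j' (Suc j')) v)" for j'
  proof -
    let ?\<tau>' = "permute_components k (Transposition.transpose j' (Suc j'))"
    have perm: "Transposition.transpose j' (Suc j') permutes {1..k}" using j' by (intro permutes_swap_id) auto
    have "map ?\<tau> (cone k i vs) = cone k i (map ?\<tau>' vs)" if vs: "vs \<in> Poly_Mapping.keys c" for vs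
    proof -
      have "base (map ?\<tau>' vs) = base vs" using map_permute_fibre_power(2)[OF _ perm k] c(1) vs by blast
      then show ?thesis
        unfolding map_\<tau>[OF vs] cone_def by (simp add: \<tau> zip_map2 o_def case_prod_beta del: map_eq_conv)
    qed
    then have "simp_chain_map ?\<tau> (chain_cone k i c) = chain_cone k i (simp_chain_map ?\<tau>' c)"
      unfolding * unfolding chain_cone_def frag_extend_simp_chain_map by (intro frag_extend_eq) simp
    also have "simp_chain_map ?\<tau>' c = - c" using alternating_transpose[OF c(2), of j' "Suc j'"] j' by simp
    finally show ?thesis by (simp add: chain_cone_uminus)
  qed
  consider "i = j" | "i = Suc j" | "i < j" | "Suc j < i" by linarith
  then show ?thesis
  proof cases
    case 1
    have "frag_extend (\<lambda>vs. frag_of (map ?\<tau> (cone k i vs))) c = chain_cone k (Suc j) c"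
      unfolding chain_cone_def
      by (intro frag_extend_eq) (simp only: map_\<tau>, simp only: 1 permute_adjacent_ins(1)[OF j] cone_def)
    then show ?thesis using 1 * by simp
  next
    case 2
    have "frag_extend (\<lambda>vs. frag_of (map ?\<tau> (cone k i vs))) c = chain_cone k j c"
      unfolding chain_cone_def
      by (intro frag_extend_eq) (simp only: map_\<tau>, simp only: 2 permute_adjacent_ins(2)[OF j] cone_def)
    then show ?thesis using 2 * by simp
  next
    case 3
    then obtain j' where "j = Suc j'" "1 \<le> j'" using i by (cases j) auto
    then have "?\<tau> (ins k i u v) = ins k i u (permute_components k (Transposition.transpose j' (Suc j')) v)" for u :: 'v and v
      using permute_adjacent_ins(3)[of i j' k u v] i j 3 by simp
    from same[OF _ _ this] show ?thesis using \<open>j = Suc j'\<close> \<open>1 \<le> j'\<close> j 3 by simp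
  next
    case 4
    have "?\<tau> (ins k i u v) = ins k i u (permute_components k (Transposition.transpose j (Suc j)) v)" for u :: 'v and v
      using permute_adjacent_ins(4)[of j i k u v] i j 4 by simp
    from same[OF _ _ this] show ?thesis using j i 4 by simp
  qed
qed

text \<open>The exterior product with the lifted simplex, so that alternating chains are mapped to alternating
  chains. Forgetting the last component recovers the chain from the summand \<open>i = k + 1\<close> and commutes with
  the insertion in the others.\<close>

definition alt_cone :: "nat \<Rightarrow> ((nat \<Rightarrow> 'v) list \<Rightarrow>\<^sub>0 int) \<Rightarrow> ((nat \<Rightarrow> 'v) list \<Rightarrow>\<^sub>0 int)" where
  "alt_cone k c = (\<Sum>i=1..Suc k. frag_cmul ((-1) ^ (Suc k - i)) (chain_cone k i c))"

lemma keys_alt_cone: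
  assumes "Poly_Mapping.keys c \<subseteq> FP n k" "1 \<le> k"
  shows "Poly_Mapping.keys (alt_cone k c) \<subseteq> FP n (Suc k)"
proof
  fix vs assume "vs \<in> Poly_Mapping.keys (alt_cone k c)"
  then obtain i where "i \<in> {1..Suc k}" "vs \<in> Poly_Mapping.keys (frag_cmul ((-1) ^ (Suc k - i)) (chain_cone k i c))"
    unfolding alt_cone_def using keys_sum[of "\<lambda>i. frag_cmul ((-1) ^ (Suc k - i)) (chain_cone k i c)" "{1..Suc k}"] by blast
  then show "vs \<in> FP n (Suc k)" using keys_chain_cone[OF assms, of i] by auto
qed

text \<open>An adjacent transposition exchanges the summands \<open>j\<close> and
  \<open>j + 1\<close>, which carry opposite signs, and negates every other summand. So each summand
  goes to minus the summand with transposed index.\<close>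

lemma alternating_alt_cone:
  assumes c: "Poly_Mapping.keys c \<subseteq> FP n k" "alternating k c" and k: "1 \<le> k"
  shows "alternating (Suc k) (alt_cone k c)"
proof (rule alternatingI_adjacent)
  show "set vs \<subseteq> extensional {1..Suc k}" if "vs \<in> Poly_Mapping.keys (alt_cone k c)" for vs
    using that keys_alt_cone[OF c(1) k] fibre_powerD(1) by blast
next
  fix j assume j: "1 \<le> j" "j < Suc k"
  let ?\<tau> = "Transposition.transpose j (Suc j)"
  let ?t = "\<lambda>i. frag_cmul ((-1) ^ (Suc k - i)) (chain_cone k i c)"
  have "simp_chain_map (permute_components (Suc k) ?\<tau>) (?t i) = - ?t (?\<tau> i)" if i: "i \<in> {1..Suc k}" for i
  proof -
    \<comment> \<open>The sign exponents of the summands \<open>j\<close> and \<open>j + 1\<close>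
      differ by exactly 1.\<close>
    have "Suc k - j = Suc (Suc k - Suc j)" using j by simp
    then show ?thesis
      using simp_chain_map_permute_cone[OF c k, of j i] i j
      by (auto simp: simp_chain_map_cmul Transposition.transpose_def frag_cmul_minus)
  qed
  then have "simp_chain_map (permute_components (Suc k) ?\<tau>) (alt_cone k c) = (\<Sum>i=1..Suc k. - ?t (?\<tau> i))"
    unfolding alt_cone_def simp_chain_map_sum by (intro sum.cong) auto
  also have "\<dots> = - (\<Sum>i=1..Suc k. (?t \<circ> ?\<tau>) i)" by (simp only: sum_negf o_def)
  also have "(\<Sum>i=1..Suc k. (?t \<circ> ?\<tau>) i) = alt_cone k c"
    unfolding alt_cone_def using j by (intro sum.permute[symmetric] permutes_swap_id) auto
  finally show "simp_chain_map (permute_components (Suc k) ?\<tau>) (alt_cone k c) = - alt_cone k c" .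
qed

text \<open>Only the summand \<open>i = k + 1\<close> survives, with sign +1. Vanishing of the
  others is left as a premise because it has two sources: \<open>eps c = 0\<close> inside a row and
  a vanishing augmentation at its end.\<close>

lemma forget_last_alt_cone:
  assumes "Poly_Mapping.keys c \<subseteq> FP n k" "1 \<le> k"
    and "\<And>i. 1 \<le> i \<Longrightarrow> i \<le> k \<Longrightarrow> simp_chain_map (forget (Suc k) (Suc k)) (chain_cone k i c) = 0"
  shows "simp_chain_map (forget (Suc k) (Suc k)) (alt_cone k c) = c"
proof -
  let ?t = "\<lambda>i. frag_cmul ((-1) ^ (Suc k - i)) (simp_chain_map (forget (Suc k) (Suc k)) (chain_cone k i c))"
  have "simp_chain_map (forget (Suc k) (Suc k)) (alt_cone k c) = (\<Sum>i=1..k. ?t i) + ?t (Suc k)"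
    unfolding alt_cone_def simp_chain_map_sum simp_chain_map_cmul by simp
  also have "(\<Sum>i=1..k. ?t i) = 0" using assms(3) by (intro sum.neutral) auto
  finally show ?thesis
    using simp_chain_map_forget_cone_same[OF assms(1,2), of "Suc k"] by simp
qed

section \<open>The augmentation\<close>

lemma augmentation_surj:
  assumes "Poly_Mapping.keys d \<subseteq> ordered_simplices U n"
  shows "\<exists>c. Poly_Mapping.keys c \<subseteq> FP n 1 \<and> simp_chain_map (\<lambda>v. f (v 1)) c = d"
proof -
  let ?h = "\<lambda>u. \<lambda>l\<in>{1..1::nat}. u"
  let ?c = "frag_extend (\<lambda>ws. frag_of (map ?h (lift ws))) d"
  have "map ?h (lift ws) \<in> FP n 1" if "ws \<in> ordered_simplices U n" for ws
    by (rule fibre_powerI) (use lift[OF that] in \<open>auto simp: o_def\<close>)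
  then have "Poly_Mapping.keys ?c \<subseteq> FP n 1"
    using assms keys_frag_extend_frag_of[of "\<lambda>ws. map ?h (lift ws)" d] by blast
  moreover have "simp_chain_map (\<lambda>v. f (v 1)) ?c = frag_extend frag_of d"
    unfolding simp_chain_map_frag_extend
  proof (rule frag_extend_eq)
    fix ws assume "ws \<in> Poly_Mapping.keys d"
    then have "map f (lift ws) = ws" using lift(2) assms by blast
    then show "frag_of (map (\<lambda>v. f (v 1)) (map ?h (lift ws))) = frag_of ws" by (simp add: o_def)
  qed
  ultimately show ?thesis by (metis frag_expansion)
qed

lemma augmentation_closed:
  assumes "Poly_Mapping.keys c \<subseteq> FP n 1"
  shows "Poly_Mapping.keys (simp_chain_map (\<lambda>v. f (v 1)) c) \<subseteq> ordered_simplices U n"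
  using keys_simp_chain_map[of "\<lambda>v. f (v 1)" c] base_mem assms by fastforce

lemma augmentation_image:
  "simp_chain_map (\<lambda>v. f (v 1)) ` {c. Poly_Mapping.keys c \<subseteq> FP n 1} = {c. Poly_Mapping.keys c \<subseteq> ordered_simplices U n}"
proof (intro equalityI subsetI)
  fix d :: "'w list \<Rightarrow>\<^sub>0 int" assume "d \<in> {c. Poly_Mapping.keys c \<subseteq> ordered_simplices U n}"
  then obtain c where "Poly_Mapping.keys c \<subseteq> FP n 1" "simp_chain_map (\<lambda>v. f (v 1)) c = d"
    using augmentation_surj[of d n] by auto
  then show "d \<in> simp_chain_map (\<lambda>v. f (v 1)) ` {c. Poly_Mapping.keys c \<subseteq> FP n 1}" by blast
qed (use augmentation_closed in blast)

lemma augmentation_forget: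
  assumes "Poly_Mapping.keys c \<subseteq> FP n (Suc k)" "1 \<le> k" "1 \<le> i" "i \<le> Suc k"
  shows "simp_chain_map (\<lambda>v. f (v 1)) (simp_chain_map (forget i (Suc k)) c) = simp_chain_map (\<lambda>v. f (v 1)) c"
  unfolding simp_chain_map_simp_chain_map
proof (rule simp_chain_map_cong)
  fix vs assume "vs \<in> Poly_Mapping.keys c"
  then have "vs \<in> FP n (Suc k)" using assms(1) by blast
  from map_forget_fibre_power(2)[OF this assms(3,4,2)]
  show "map (\<lambda>x. f (forget i (Suc k) x 1)) vs = map (\<lambda>v. f (v 1)) vs"
    by (simp add: o_def del: map_eq_conv)
qed

lemma augmentation_permute:
  assumes "Poly_Mapping.keys c \<subseteq> FP n k" "1 \<le> k" "\<sigma> permutes {1..k}"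
  shows "simp_chain_map (\<lambda>v. f (v 1)) (simp_chain_map (permute_components k \<sigma>) c) = simp_chain_map (\<lambda>v. f (v 1)) c"
  unfolding simp_chain_map_simp_chain_map
proof (rule simp_chain_map_cong)
  fix vs assume "vs \<in> Poly_Mapping.keys c"
  then have "vs \<in> FP n k" using assms(1) by blast
  from map_permute_fibre_power(2)[OF this assms(3,2)]
  show "map (\<lambda>x. f (permute_components k \<sigma> x 1)) vs = map (\<lambda>v. f (v 1)) vs"
    by (simp add: o_def del: map_eq_conv)
qed

lemma keys_simp_chain_map_forget:
  assumes "Poly_Mapping.keys c \<subseteq> FP n (Suc k)" "1 \<le> i" "i \<le> Suc k"
  shows "Poly_Mapping.keys (simp_chain_map (forget i (Suc k)) c) \<subseteq> FP n k"
  using keys_simp_chain_map[of "forget i (Suc k)" c] map_forget_fibre_power(1)[OF _ assms(2,3)] assms(1) by blast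

lemma keys_rho:
  assumes "Poly_Mapping.keys c \<subseteq> FP n (Suc k)"
  shows "Poly_Mapping.keys (rho (Suc k) 0 c) \<subseteq> FP n k"
proof
  fix vs assume "vs \<in> Poly_Mapping.keys (rho (Suc k) 0 c)"
  then obtain i where "i \<le> k" "vs \<in> Poly_Mapping.keys (frag_cmul ((-1) ^ i) (simp_chain_map (forget (Suc i) (Suc k)) c))"
    using keys_sum[of "\<lambda>i. frag_cmul ((-1) ^ i) (simp_chain_map (forget (Suc i) (Suc k)) c)" "{..k}"]
    unfolding rho_eq by auto
  then show "vs \<in> FP n k" using keys_simp_chain_map_forget[OF assms, of "Suc i"] by auto
qed

lemma rho_2: "rho (Suc 1) 0 c = simp_chain_map (forget 1 2) c - simp_chain_map (forget 2 2) c"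
  by (simp add: rho_eq One_nat_def numeral_2_eq_2)

text \<open>The homotopy formula for insertion in front: forgetting the new component returns
  \<open>c\<close>, and the other faces are the cones of the faces of \<open>c\<close>, with signs
  shifted by one.\<close>

lemma rho_cone:
  assumes c: "Poly_Mapping.keys c \<subseteq> FP n (Suc k)" and k: "1 \<le> k"
  shows "rho (Suc (Suc k)) 0 (chain_cone (Suc k) 1 c) = c - chain_cone k 1 (rho (Suc k) 0 c)"
proof -
  let ?t = "\<lambda>i. frag_cmul ((-1) ^ i) (simp_chain_map (forget (Suc i) (Suc (Suc k))) (chain_cone (Suc k) 1 c))"
  have "?t 0 = c" using simp_chain_map_forget_cone_same[OF c, of 1] by (simp add: One_nat_def)
  moreover have "?t (Suc i) = - frag_cmul ((-1) ^ i) (chain_cone k 1 (simp_chain_map (forget (Suc i) (Suc k)) c))"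
    if "i \<le> k" for i
    using simp_chain_map_forget_Suc_cone[OF c k, of 1 "Suc i"] that by simp
  then have "(\<Sum>i\<le>k. ?t (Suc i)) = - (\<Sum>i\<le>k. frag_cmul ((-1) ^ i) (chain_cone k 1 (simp_chain_map (forget (Suc i) (Suc k)) c)))"
    unfolding sum_negf[symmetric] by (intro sum.cong) auto
  ultimately show ?thesis
    unfolding rho_eq sum.atMost_Suc_shift by (simp add: chain_cone_sum chain_cone_cmul)
qed

text \<open>The contraction is \<open>chain_cone k 1\<close>, by \<open>rho_cone\<close> inside the
  row and by \<open>simp_chain_map_forget_2_cone\<close> at its end. The sign-free \<open>R\<close>
  is \<open>rho\<close> with degree argument 0.\<close>

theorem augmented_double_complex_W:
  "augmented_double_complex (\<lambda>p q. free_Abelian_group (FP p (q + 1))) (\<lambda>p q. simp_boundary p)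
    (\<lambda>p q. if q = 0 then (\<lambda>c. 0) else rho (q + 1) p) (simp_chain_group U) simp_boundary
    (\<lambda>p. simp_chain_map (\<lambda>v. f (v 1)))"
proof -
  let ?X = "\<lambda>p q. {c. Poly_Mapping.keys c \<subseteq> FP p (Suc q)}"
  have *: "augmented_double_complex (\<lambda>p q. \<lparr>carrier = ?X p q, monoid.mult = (+), one = 0\<rparr>)
    (\<lambda>p q. simp_boundary p) (\<lambda>p q. if q = 0 then (\<lambda>c. 0) else (\<lambda>c. frag_cmul ((-1) ^ p) (rho (Suc q) 0 c)))
    (simp_chain_group U) simp_boundary (\<lambda>p. simp_chain_map (\<lambda>v. f (v 1)))"
  proof (rule augmented_double_complexI)
    show "c - d \<in> ?X p q" if "c \<in> ?X p q" "d \<in> ?X p q" for p q c d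
      using that keys_diff[of c d] by blast
    show "length vs = Suc p" if "c \<in> ?X p q" "vs \<in> Poly_Mapping.keys c" for p q c vs
      using that FP_length[of vs p "Suc q"] by auto
    show "simp_boundary (Suc p) c \<in> ?X p q" if "c \<in> ?X (Suc p) q" for p q c
      using that keys_simp_boundary_FP by simp
    show "rho (Suc (Suc q)) 0 c \<in> ?X p q" if "c \<in> ?X p (Suc q)" for p q c
      using that keys_rho by simp
    show "rho (Suc q) 0 (c - d) = rho (Suc q) 0 c - rho (Suc q) 0 d" for q and c d :: "(nat \<Rightarrow> 'v) list \<Rightarrow>\<^sub>0 int"
      by (simp add: rho_eq simp_chain_map_diff frag_cmul_diff sum_subtractf del: sum.atMost_Suc)
    show "rho (Suc q) 0 (simp_boundary p c) = simp_boundary p (rho (Suc q) 0 c)" for p q and c :: "(nat \<Rightarrow> 'v) list \<Rightarrow>\<^sub>0 int"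
      by (simp add: rho_eq simp_boundary_sum simp_boundary_cmul simp_boundary_simp_chain_map del: sum.atMost_Suc)
    show "rho (Suc (Suc q)) 0 (rho (Suc (Suc (Suc q))) 0 c) = 0" for q and c :: "(nat \<Rightarrow> 'v) list \<Rightarrow>\<^sub>0 int"
      by (rule rho_rho)
    show "\<exists>b\<in>?X p (Suc (Suc q)). rho (Suc (Suc (Suc q))) 0 b = c"
      if "c \<in> ?X p (Suc q)" "rho (Suc (Suc q)) 0 c = 0" for p q c
    proof
      have c: "Poly_Mapping.keys c \<subseteq> FP p (Suc (Suc q))" using that by simp
      show "rho (Suc (Suc (Suc q))) 0 (chain_cone (Suc (Suc q)) 1 c) = c"
        using rho_cone[OF c] that by simp
      show "chain_cone (Suc (Suc q)) 1 c \<in> ?X p (Suc (Suc q))"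
        using keys_chain_cone[OF c, of 1] by simp
    qed
    show "simp_chain_map (\<lambda>v. f (v 1)) ` ?X p 0 = {c. Poly_Mapping.keys c \<subseteq> ordered_simplices U p}" for p
      unfolding One_nat_def[symmetric] by (rule augmentation_image)
    show "simp_chain_map (\<lambda>v. f (v 1)) (rho (Suc 1) 0 c) = 0" if "c \<in> ?X p 1" for p c
      using augmentation_forget[of c p 1 1] augmentation_forget[of c p 1 2] that
      by (simp add: rho_2 simp_chain_map_diff flip: Suc_1)
    show "\<exists>b\<in>?X p 1. rho (Suc 1) 0 b = c" if "c \<in> ?X p 0" "simp_chain_map (\<lambda>v. f (v 1)) c = 0" for p c
    proof
      have c: "Poly_Mapping.keys c \<subseteq> FP p 1" using that by (simp add: One_nat_def)
      show "rho (Suc 1) 0 (chain_cone 1 1 c) = c"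
        using simp_chain_map_forget_2_cone[OF c] simp_chain_map_forget_cone_same[OF c, of 1] that
        by (simp add: rho_2 flip: Suc_1)
      show "chain_cone 1 1 c \<in> ?X p 1" using keys_chain_cone[OF c, of 1] by simp
    qed
  qed simp
  have "(\<lambda>p q. if q = 0 then (\<lambda>c. 0) else (\<lambda>c :: (nat \<Rightarrow> 'v) list \<Rightarrow>\<^sub>0 int. frag_cmul ((-1) ^ p) (rho (Suc q) 0 c)))
    = (\<lambda>p q. if q = 0 then (\<lambda>c. 0) else rho (q + 1) p)"
    by (intro ext) (simp add: rho_eq One_nat_def del: sum.atMost_Suc)
  moreover have "(\<lambda>p q. \<lparr>carrier = ?X p q, monoid.mult = (+), one = 0\<rparr>) = (\<lambda>p q. free_Abelian_group (FP p (q + 1)))"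
    by (intro ext) (simp add: free_Abelian_group_def One_nat_def)
  ultimately show ?thesis using * by (simp only:)
qed

text \<open>The contraction is \<open>alt_cone\<close>: if forgetting the last component kills
  \<open>c\<close>, it kills every summand but the last one, so \<open>alt_cone\<close> gives a
  preimage of \<open>c\<close>. At tuple length 1 the vanishing of the augmentation takes over this
  role.\<close>

theorem augmented_double_complex_alternating:
  "augmented_double_complex
    (\<lambda>p q. \<lparr>carrier = {c. Poly_Mapping.keys c \<subseteq> FP p (q + 1) \<and> alternating (q + 1) c}, monoid.mult = (+), one = 0\<rparr>)
    (\<lambda>p q. simp_boundary p) (\<lambda>p q. if q = 0 then (\<lambda>c. 0) else eps (q + 1) p) (simp_chain_group U) simp_boundary
    (\<lambda>p. simp_chain_map (\<lambda>v. f (v 1)))"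
proof -
  let ?X = "\<lambda>p q. {c. Poly_Mapping.keys c \<subseteq> FP p (Suc q) \<and> alternating (Suc q) c}"
  have eps0: "eps k 0 c = simp_chain_map (forget k k) c" for k and c :: "(nat \<Rightarrow> 'v) list \<Rightarrow>\<^sub>0 int"
    by (simp add: eps_def)
  have *: "augmented_double_complex (\<lambda>p q. \<lparr>carrier = ?X p q, monoid.mult = (+), one = 0\<rparr>)
    (\<lambda>p q. simp_boundary p) (\<lambda>p q. if q = 0 then (\<lambda>c. 0) else (\<lambda>c. frag_cmul ((-1) ^ p) (eps (Suc q) 0 c)))
    (simp_chain_group U) simp_boundary (\<lambda>p. simp_chain_map (\<lambda>v. f (v 1)))"
  proof (rule augmented_double_complexI)
    show "c - d \<in> ?X p q" if "c \<in> ?X p q" "d \<in> ?X p q" for p q c d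
      using that keys_diff[of c d] alternating_add[of "Suc q" c "- d"] alternating_cmul[of "Suc q" d "-1"] by auto
    show "length vs = Suc p" if "c \<in> ?X p q" "vs \<in> Poly_Mapping.keys c" for p q c vs
      using that FP_length[of vs p "Suc q"] by auto
    show "simp_boundary (Suc p) c \<in> ?X p q" if "c \<in> ?X (Suc p) q" for p q c
      using that by (simp add: keys_simp_boundary_FP alternating_boundary)
    show "eps (Suc (Suc q)) 0 c \<in> ?X p q" if "c \<in> ?X p (Suc q)" for p q c
      using that keys_simp_chain_map_forget[of c p "Suc q" "Suc (Suc q)"] by (simp add: eps0 alternating_forget_last)
    show "eps (Suc q) 0 (c - d) = eps (Suc q) 0 c - eps (Suc q) 0 d" for q and c d :: "(nat \<Rightarrow> 'v) list \<Rightarrow>\<^sub>0 int"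
      by (simp add: eps0 simp_chain_map_diff)
    show "eps (Suc q) 0 (simp_boundary p c) = simp_boundary p (eps (Suc q) 0 c)" for p q and c :: "(nat \<Rightarrow> 'v) list \<Rightarrow>\<^sub>0 int"
      by (simp add: eps0 simp_boundary_simp_chain_map)
    show "eps (Suc (Suc q)) 0 (eps (Suc (Suc (Suc q))) 0 c) = 0" if "c \<in> ?X p (Suc (Suc q))" for p q c
      using that by (intro eps_eps) simp
    show "\<exists>b\<in>?X p (Suc (Suc q)). eps (Suc (Suc (Suc q))) 0 b = c"
      if "c \<in> ?X p (Suc q)" "eps (Suc (Suc q)) 0 c = 0" for p q c
    proof
      have c: "Poly_Mapping.keys c \<subseteq> FP p (Suc (Suc q))" "alternating (Suc (Suc q)) c" using that by auto
      have "simp_chain_map (forget (Suc (Suc (Suc q))) (Suc (Suc (Suc q)))) (chain_cone (Suc (Suc q)) i c) = 0"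
        if "1 \<le> i" "i \<le> Suc (Suc q)" for i
        using simp_chain_map_forget_Suc_cone[OF c(1), of i "Suc (Suc q)"] that \<open>eps _ _ c = 0\<close> by (simp add: eps0)
      then show "eps (Suc (Suc (Suc q))) 0 (alt_cone (Suc (Suc q)) c) = c"
        unfolding eps0 using forget_last_alt_cone[OF c(1)] by simp
      show "alt_cone (Suc (Suc q)) c \<in> ?X p (Suc (Suc q))"
        using keys_alt_cone[OF c(1)] alternating_alt_cone[OF c] by simp
    qed
    show "simp_chain_map (\<lambda>v. f (v 1)) ` ?X p 0 = {c. Poly_Mapping.keys c \<subseteq> ordered_simplices U p}" for p
    proof -
      \<comment> \<open>On 1-tuples alternation is no condition, so the augmentation is the same as
        for the first complex.\<close>
      have "alternating 1 c" if "Poly_Mapping.keys c \<subseteq> FP p 1" for c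
        by (rule alternating_1) (use that fibre_powerD(1) in blast)
      then have "?X p 0 = {c. Poly_Mapping.keys c \<subseteq> FP p 1}" unfolding One_nat_def[symmetric] by blast
      then show ?thesis by (simp only: augmentation_image)
    qed
    show "simp_chain_map (\<lambda>v. f (v 1)) (eps (Suc 1) 0 c) = 0" if "c \<in> ?X p 1" for p c
    proof -
      let ?a = "simp_chain_map (\<lambda>v. f (v 1))"
      have c: "Poly_Mapping.keys c \<subseteq> FP p (Suc 1)" "alternating (Suc 1) c" using that by auto
      have perm: "Transposition.transpose 1 (Suc 1) permutes {1..Suc 1}" by (rule permutes_swap_id) auto
      \<comment> \<open>Both columns of a pair have the same image, so the augmentation does not see
        the swap, while \<open>c\<close> changes its sign.\<close>
      have "?a c = ?a (- c)"
        using augmentation_permute[OF c(1) _ perm] alternating_transpose[OF c(2), of 1 "Suc 1"] by simp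
      then have "?a c = 0" by (intro frag_self_inverse_eq_0) (simp add: simp_chain_map_uminus)
      then show ?thesis using augmentation_forget[OF c(1), of "Suc 1"] by (simp add: eps0)
    qed
    show "\<exists>b\<in>?X p 1. eps (Suc 1) 0 b = c" if "c \<in> ?X p 0" "simp_chain_map (\<lambda>v. f (v 1)) c = 0" for p c
    proof
      have c: "Poly_Mapping.keys c \<subseteq> FP p 1" "alternating 1 c" using that by (simp_all add: One_nat_def)
      have "simp_chain_map (forget (Suc 1) (Suc 1)) (chain_cone 1 i c) = 0" if "1 \<le> i" "i \<le> 1" for i
        using simp_chain_map_forget_2_cone[OF c(1)] that \<open>simp_chain_map _ c = 0\<close> by (simp add: Suc_1)
      then show "eps (Suc 1) 0 (alt_cone 1 c) = c"
        unfolding eps0 using forget_last_alt_cone[OF c(1)] by simp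
      show "alt_cone 1 c \<in> ?X p 1" using keys_alt_cone[OF c(1)] alternating_alt_cone[OF c] by simp
    qed
  qed (simp add: alternating_zero)
  have "(\<lambda>p q. if q = 0 then (\<lambda>c. 0) else (\<lambda>c :: (nat \<Rightarrow> 'v) list \<Rightarrow>\<^sub>0 int. frag_cmul ((-1) ^ p) (eps (Suc q) 0 c)))
    = (\<lambda>p q. if q = 0 then (\<lambda>c. 0) else eps (q + 1) p)"
    by (intro ext) (simp add: eps_def One_nat_def)
  then show ?thesis using * by (simp only: Suc_eq_plus1)
qed

end

section \<open>Simplicial maps with finite fibres\<close>

lemma vertices_convex_hull: "\<not> affine_dependent C \<Longrightarrow> vertices (convex hull C) = C"
  by (simp add: vertices_def extreme_point_of_convex_hull_affine_independent)

lemma simplex_vertices: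
  assumes "n simplex S"
  shows "\<not> affine_dependent (vertices S)" "convex hull (vertices S) = S"
proof -
  obtain C where C: "\<not> affine_dependent C" "S = convex hull C" using assms unfolding simplex_def by blast
  then have "vertices S = C" using vertices_convex_hull by simp
  then show "\<not> affine_dependent (vertices S)" "convex hull (vertices S) = S" using C by simp_all
qed

lemma
  assumes "locally_finite_complex K" "S \<in> K"
  shows locally_finite_complex_simplex: "\<exists>n. n simplex S"
    and locally_finite_complex_face: "F face_of S \<Longrightarrow> F \<in> K"
    and locally_finite_complex_Int: "S' \<in> K \<Longrightarrow> (S \<inter> S') face_of S"
  using assms unfolding locally_finite_complex_def by blast+

text \<open>Affinity along segments is upgraded to the restriction of a global affine map, which
  gives access to images of hulls and relative interiors and to continuity. The linear part is
  prescribed on the edge vectors from one vertex \<open>a\<close>, which are independent.\<close>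

lemma affine_on_convex_hull:
  fixes f :: "'a::euclidean_space \<Rightarrow> 'b::euclidean_space"
  assumes C: "\<not> affine_dependent C"
    and f: "\<And>x y u. x \<in> convex hull C \<Longrightarrow> y \<in> convex hull C \<Longrightarrow> u \<in> {0..1} \<Longrightarrow>
      f ((1 - u) *\<^sub>R x + u *\<^sub>R y) = (1 - u) *\<^sub>R f x + u *\<^sub>R f y"
  obtains h c where "linear h" "\<And>x. x \<in> convex hull C \<Longrightarrow> f x = c + h x"
proof (cases "C = {}")
  case True
  then show thesis using that[of "\<lambda>_. 0" 0] by (simp add: linear_zero)
next
  case False
  then obtain a where a: "a \<in> C" by blast
  have "independent ((\<lambda>x. - a + x) ` (C - {a}))"
    using C affine_dependent_iff_dependent2[OF a] by simp
  then obtain h where h: "linear h" "\<forall>d\<in>(\<lambda>x. - a + x) ` (C - {a}). h d = f (a + d) - f a"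
    using linear_independent_extend[of _ "\<lambda>d. f (a + d) - f a"] by blast
  define c where "c = f a - h a"
  have onC: "f x = c + h x" if "x \<in> C" for x
  proof (cases "x = a")
    case False
    then have "f x - f a = h x - h a" using h(2) that linear_diff[OF h(1), of x a] by auto
    then have "f x = (h x - h a) + f a" by (simp only: diff_eq_eq)
    then show ?thesis by (simp add: c_def)
  qed (simp add: c_def)
  \<comment> \<open>The set of agreement is convex and contains the vertices, hence is the whole
    hull.\<close>
  let ?E = "{x \<in> convex hull C. f x = c + h x}"
  have "convex ?E"
  proof (rule convexI)
    fix x y and v u :: real assume x: "x \<in> ?E" and y: "y \<in> ?E" and uv: "0 \<le> v" "0 \<le> u" "v + u = 1"
    have v: "v = 1 - u" and u: "0 \<le> u" "u \<le> 1" using uv by auto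
    have "(1 - u) *\<^sub>R x + u *\<^sub>R y \<in> convex hull C"
      using x y u convex_convex_hull[of C] unfolding convex_alt by blast
    moreover have "f ((1 - u) *\<^sub>R x + u *\<^sub>R y) = (1 - u) *\<^sub>R (c + h x) + u *\<^sub>R (c + h y)"
      using f[of x y u] x y u by auto
    then have "f ((1 - u) *\<^sub>R x + u *\<^sub>R y) = c + ((1 - u) *\<^sub>R h x + u *\<^sub>R h y)"
      by (simp add: algebra_simps)
    then have "f ((1 - u) *\<^sub>R x + u *\<^sub>R y) = c + h ((1 - u) *\<^sub>R x + u *\<^sub>R y)"
      by (simp only: linear_add[OF h(1)] linear_scale[OF h(1)])
    ultimately show "v *\<^sub>R x + u *\<^sub>R y \<in> ?E" unfolding v by blast
  qed
  moreover have "C \<subseteq> ?E" using onC hull_subset[of C convex] by auto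
  ultimately have "convex hull C \<subseteq> ?E" by (intro hull_minimal)
  then show thesis using that[OF h(1), of c] by blast
qed

text \<open>If \<open>x\<close> is interior to two simplices, their intersection is a face of each
  that meets its relative interior, so it equals both.\<close>

lemma carrier_simplex_eq:
  assumes "locally_finite_complex K" "S \<in> K" "x \<in> rel_interior S"
  shows "carrier_simplex K x = S"
  unfolding carrier_simplex_def
proof (rule the_equality)
  fix S' assume S': "S' \<in> K \<and> x \<in> rel_interior S'"
  have sub: "A \<subseteq> B" if "A \<in> K" "B \<in> K" "x \<in> rel_interior A" "x \<in> rel_interior B" for A B
  proof -
    have "(A \<inter> B) face_of A" by (rule locally_finite_complex_Int[OF assms(1) that(1,2)])
    moreover have "x \<in> (A \<inter> B) \<inter> rel_interior A" using that rel_interior_subset by blast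
    ultimately have "A \<subseteq> A \<inter> B" using subset_of_face_of[of "A \<inter> B" A A] by blast
    then show ?thesis by blast
  qed
  show "S' = S" using sub[of S S'] sub[of S' S] assms(2,3) S' by auto
qed (use assms in blast)

lemma in_rel_interior_of_simplex:
  assumes K: "locally_finite_complex K" and "x \<in> \<Union>K"
  shows "\<exists>S\<in>K. x \<in> rel_interior S"
proof -
  have "\<exists>S'\<in>K. x \<in> rel_interior S'" if "S \<in> K" "x \<in> S" for S
    using that
  \<comment> \<open>A point of \<open>S\<close> outside its relative interior lies in a facet. The
    shift by 1 is there because dimensions start at -1.\<close>
  proof (induction "nat (aff_dim S + 1)" arbitrary: S rule: less_induct)
    case less
    show ?case
    proof (cases "x \<in> rel_interior S")
      case False
      have "polyhedron S" using locally_finite_complex_simplex[OF K less.prems(1)] simplex_imp_polyhedron by blast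
      moreover have "x \<in> S - rel_interior S" using False less.prems by blast
      ultimately have "x \<in> \<Union> {F. F facet_of S}" using rel_boundary_of_polyhedron by metis
      then obtain F where F: "F facet_of S" "x \<in> F" by blast
      have "F \<in> K" by (rule locally_finite_complex_face[OF K less.prems(1) facet_of_imp_face_of[OF F(1)]])
      moreover have "nat (aff_dim F + 1) < nat (aff_dim S + 1)"
        using F aff_dim_geq[of F] by (simp add: facet_of_def)
      ultimately show ?thesis using less.hyps[of F] F(2) by blast
    qed (use less.prems in blast)
  qed
  then show ?thesis using assms by blast
qed

lemma
  assumes "x \<in> W_space X f k"
  shows W_space_mem: "l \<in> {1..k} \<Longrightarrow> x l \<in> X"
    and W_space_eq: "i \<in> {1..k} \<Longrightarrow> j \<in> {1..k} \<Longrightarrow> f (x i) = f (x j)"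
  using assms unfolding W_space_def by blast+

lemma W_space_subset: "W_space X f k \<subseteq> {1..k} \<rightarrow>\<^sub>E X"
  unfolding W_space_def by blast

locale finite_simplicial_map =
  fixes K :: "'a::euclidean_space set set" and L :: "'b::euclidean_space set set" and f :: "'a \<Rightarrow> 'b"
  assumes K: "locally_finite_complex K" and L: "locally_finite_complex L"
    and simplicial: "simplicial_map K L f"
    and onto: "f ` (\<Union>K) = \<Union>L"
    and finite_fibres: "y \<in> \<Union>L \<Longrightarrow> finite {x \<in> \<Union>K. f x = y}"
begin

section \<open>The map on single simplices\<close>

lemma K_simplex: "S \<in> K \<Longrightarrow> \<not> affine_dependent (vertices S)" "S \<in> K \<Longrightarrow> convex hull (vertices S) = S"
  and L_simplex: "T \<in> L \<Longrightarrow> \<not> affine_dependent (vertices T)" "T \<in> L \<Longrightarrow> convex hull (vertices T) = T"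
  using locally_finite_complex_simplex[OF K] locally_finite_complex_simplex[OF L] simplex_vertices by metis+

lemma vertices_subset: "S \<in> K \<Longrightarrow> vertices S \<subseteq> S"
  unfolding vertices_def extreme_point_of_def by blast

lemma affine_on_simplex:
  assumes "S \<in> K" obtains h c where "linear h" "\<And>x. x \<in> S \<Longrightarrow> f x = c + h x"
proof -
  have "\<forall>x\<in>S. \<forall>y\<in>S. \<forall>u\<in>{0..1}. f ((1 - u) *\<^sub>R x + u *\<^sub>R y) = (1 - u) *\<^sub>R f x + u *\<^sub>R f y"
    using simplicial assms unfolding simplicial_map_def by blast
  then obtain h c where "linear h" "\<And>x. x \<in> convex hull (vertices S) \<Longrightarrow> f x = c + h x"
    using affine_on_convex_hull[OF K_simplex(1)[OF assms], of f] K_simplex(2)[OF assms] by metis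
  then show thesis using that K_simplex(2)[OF assms] by metis
qed

text \<open>This is where finiteness of the fibres enters: \<open>f\<close> is constant on the
  segment between two points of a simplex with equal image, and a nontrivial segment is
  infinite.\<close>

lemma inj_on_simplex:
  assumes "S \<in> K" shows "inj_on f S"
proof (rule inj_onI, rule ccontr)
  fix x y assume xy: "x \<in> S" "y \<in> S" "f x = f y" "x \<noteq> y"
  have "convex S" using K_simplex(2)[OF assms] convex_convex_hull by metis
  have "closed_segment x y \<subseteq> {z \<in> \<Union>K. f z = f x}"
  proof
    fix z assume "z \<in> closed_segment x y"
    then obtain u where u: "z = (1 - u) *\<^sub>R x + u *\<^sub>R y" "0 \<le> u" "u \<le> 1" by (auto simp: in_segment)
    then have "z \<in> S" using \<open>convex S\<close> xy unfolding convex_alt by blast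
    moreover have "f z = (1 - u) *\<^sub>R f x + u *\<^sub>R f y"
      using simplicial assms xy u unfolding simplicial_map_def by auto
    then have "f z = f x" using xy by (simp flip: scaleR_add_left)
    ultimately show "z \<in> {z \<in> \<Union>K. f z = f x}" using assms by blast
  qed
  moreover have "f x \<in> \<Union>L" using onto xy assms by blast
  ultimately have "finite (closed_segment x y)" using finite_fibres finite_subset by blast
  then show False using xy by simp
qed

text \<open>The images of the vertices lie among the vertices of a simplex \<open>T\<close>, hence
  are affinely independent and span a face of \<open>T\<close>. Relative interiors are preserved
  because \<open>f\<close> is affine on \<open>S\<close>.\<close>

lemma image_simplex:
  assumes S: "S \<in> K"
  shows "f ` S = convex hull (f ` vertices S)" "f ` S \<in> L" "vertices (f ` S) = f ` vertices S"
    and "f ` rel_interior S = rel_interior (f ` S)"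
proof -
  obtain h c where h: "linear h" and f: "\<And>x. x \<in> S \<Longrightarrow> f x = c + h x"
    using affine_on_simplex[OF S] by blast
  have im: "f ` A = (\<lambda>x. c + x) ` h ` A" if "A \<subseteq> S" for A
    using f that by (force simp: image_image)
  have vS: "vertices S \<subseteq> S" by (rule vertices_subset[OF S])
  have "f ` S = (\<lambda>x. c + x) ` h ` (convex hull (vertices S))"
    using im[of S] K_simplex(2)[OF S] by simp
  also have "\<dots> = convex hull (f ` vertices S)"
    unfolding im[OF vS] by (simp add: convex_hull_linear_image[OF h] convex_hull_translation)
  finally show hull: "f ` S = convex hull (f ` vertices S)" .
  obtain T where T: "T \<in> L" "f ` vertices S \<subseteq> vertices T"
    using simplicial S unfolding simplicial_map_def by blast
  have "convex hull (f ` vertices S) face_of convex hull (vertices T)"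
    using face_of_convex_hull_affine_independent[OF L_simplex(1)[OF T(1)]] T(2) by blast
  then have "f ` S face_of T" using L_simplex(2)[OF T(1)] hull by simp
  then show "f ` S \<in> L" by (rule locally_finite_complex_face[OF L T(1)])
  show "vertices (f ` S) = f ` vertices S"
    unfolding hull by (rule vertices_convex_hull[OF affine_independent_subset[OF L_simplex(1)[OF T(1)] T(2)]])
  have "convex S" using K_simplex(2)[OF S] convex_convex_hull by metis
  then show "f ` rel_interior S = rel_interior (f ` S)"
    using im[of S] im[OF rel_interior_subset] rel_interior_convex_linear_image[OF h]
    by (simp add: rel_interior_translation)
qed

text \<open>By local finiteness a neighbourhood of \<open>x\<close> meets finitely many simplices;
  these are closed, and \<open>f\<close> is continuous on each.\<close>

lemma continuous_on_f: "continuous_on (\<Union>K) f"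
  unfolding continuous_on_eq_continuous_within
proof
  fix x assume x: "x \<in> \<Union>K"
  obtain U where U: "open U" "x \<in> U" and fin: "finite {S \<in> K. S \<inter> U \<noteq> {}}"
    using K x unfolding locally_finite_complex_def by blast
  let ?F = "{S \<in> K. S \<inter> U \<noteq> {}}"
  have "continuous_on (\<Union>S\<in>?F. S) f"
  proof (rule continuous_on_closed_Union[OF fin])
    fix S assume S: "S \<in> ?F"
    then show "closed S" using locally_finite_complex_simplex[OF K] closed_simplex by blast
    obtain h c where h: "linear h" and f: "\<And>x. x \<in> S \<Longrightarrow> f x = c + h x" using affine_on_simplex[of S] S by blast
    have "continuous_on S (\<lambda>x. c + h x)" by (intro continuous_intros linear_continuous_on linear_linear[THEN iffD2] h)
    then show "continuous_on S f" using f by (simp cong: continuous_on_cong)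
  qed
  moreover have "x \<in> (\<Union>S\<in>?F. S)" using x U by blast
  ultimately have "continuous (at x within (\<Union>S\<in>?F. S)) f"
    unfolding continuous_on_eq_continuous_within by (rule bspec)
  moreover have "at x within (\<Union>S\<in>?F. S) = at x within (\<Union>K)"
    using U by (intro at_within_nhd[of x U]) auto
  ultimately show "continuous (at x within (\<Union>K)) f" by simp
qed

text \<open>By continuity of \<open>f\<close> the equations \<open>f (x i) = f (x j)\<close> define
  closed sets, so they persist in the closure.\<close>

lemma D_space_subset_W_space: "D_space (\<Union>K) f k \<subseteq> W_space (\<Union>K) f k"
proof
  let ?P = "product_topology (\<lambda>_. top_of_set (\<Union>K)) {1..k}"
  fix x assume x: "x \<in> D_space (\<Union>K) f k"
  then have "x \<in> topspace ?P" unfolding D_space_def by (rule subsetD[OF closure_of_subset_topspace])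
  moreover have "f (x i) = f (x j)" if "i \<in> {1..k}" "j \<in> {1..k}" for i j
  proof -
    have cont: "continuous_map ?P euclidean (\<lambda>x. f (x i))" if "i \<in> {1..k}" for i
      using continuous_map_compose[OF continuous_map_product_projection[OF that], of "\<lambda>_. top_of_set (\<Union>K)" euclidean f]
        continuous_on_f by (simp add: o_def)
    have "closedin ?P {x \<in> topspace ?P. f (x i) = f (x j)}"
      by (rule closedin_continuous_maps_eq[OF Hausdorff_space_euclidean cont[OF that(1)] cont[OF that(2)]])
    moreover have "{x \<in> W_space (\<Union>K) f k. inj_on x {1..k}} \<subseteq> {x \<in> topspace ?P. f (x i) = f (x j)}"
    proof
      fix z assume "z \<in> {x \<in> W_space (\<Union>K) f k. inj_on x {1..k}}"
      then have z: "z \<in> W_space (\<Union>K) f k" by blast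
      have "z \<in> topspace ?P" using subsetD[OF W_space_subset z] by simp
      then show "z \<in> {x \<in> topspace ?P. f (x i) = f (x j)}" using W_space_eq[OF z that] by blast
    qed
    ultimately have "D_space (\<Union>K) f k \<subseteq> {x \<in> topspace ?P. f (x i) = f (x j)}"
      unfolding D_space_def by (rule closure_of_minimal[rotated])
    then show ?thesis using x by blast
  qed
  moreover have "topspace ?P = {1..k} \<rightarrow>\<^sub>E \<Union>K" by simp
  ultimately show "x \<in> W_space (\<Union>K) f k" unfolding W_space_def by blast
qed

section \<open>From points to vertex sets\<close>

lemma carrier_simplex_image:
  assumes "x \<in> \<Union>K"
  shows "carrier_simplex K x \<in> K" "f ` carrier_simplex K x = carrier_simplex L (f x)"
    and "vertices (carrier_simplex L (f x)) = f ` vertices (carrier_simplex K x)"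
    and "inj_on f (vertices (carrier_simplex K x))"
proof -
  obtain S where S: "S \<in> K" "x \<in> rel_interior S" using in_rel_interior_of_simplex[OF K assms] by blast
  have eq: "carrier_simplex K x = S" by (rule carrier_simplex_eq[OF K S])
  have "f x \<in> rel_interior (f ` S)" using image_simplex(4)[OF S(1)] S(2) by blast
  then have eqL: "carrier_simplex L (f x) = f ` S" by (intro carrier_simplex_eq[OF L] image_simplex(2)[OF S(1)])
  show "carrier_simplex K x \<in> K" "f ` carrier_simplex K x = carrier_simplex L (f x)"
    "vertices (carrier_simplex L (f x)) = f ` vertices (carrier_simplex K x)"
    unfolding eq eqL using S(1) image_simplex(3)[OF S(1)] by simp_all
  show "inj_on f (vertices (carrier_simplex K x))"
    unfolding eq by (rule inj_on_subset[OF inj_on_simplex[OF S(1)] vertices_subset[OF S(1)]])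
qed

sublocale fibre_system "vertices ` K" "vertices ` L" f
proof
  fix s t assume "s \<in> vertices ` K" "t \<subseteq> s"
  then obtain S where S: "S \<in> K" "t \<subseteq> vertices S" by blast
  have "convex hull t face_of convex hull (vertices S)"
    using face_of_convex_hull_affine_independent[OF K_simplex(1)[OF S(1)]] S(2) by blast
  then have "convex hull t \<in> K"
    unfolding K_simplex(2)[OF S(1)] by (rule locally_finite_complex_face[OF K S(1)])
  moreover have "vertices (convex hull t) = t"
    by (rule vertices_convex_hull[OF affine_independent_subset[OF K_simplex(1)[OF S(1)] S(2)]])
  ultimately show "t \<in> vertices ` K" by (intro image_eqI[of _ _ "convex hull t"]) simp_all
next
  fix n
  show "map f ` ordered_simplices (vertices ` K) n = ordered_simplices (vertices ` L) n"
  proof (intro equalityI subsetI)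
    fix ws assume "ws \<in> map f ` ordered_simplices (vertices ` K) n"
    then obtain us S where us: "ws = map f us" "length us = Suc n" "distinct us" and S: "S \<in> K" "set us = vertices S"
      by (auto simp: ordered_simplices_def)
    have "inj_on f (set us)"
      using S inj_on_subset[OF inj_on_simplex[OF S(1)] vertices_subset[OF S(1)]] by simp
    moreover have "set ws = vertices (f ` S)" using image_simplex(3)[OF S(1)] S(2) us(1) by simp
    then have "set ws \<in> vertices ` L" using image_simplex(2)[OF S(1)] by simp
    ultimately show "ws \<in> ordered_simplices (vertices ` L) n"
      using us by (simp add: ordered_simplices_def distinct_map)
  next
    fix ws assume "ws \<in> ordered_simplices (vertices ` L) n"
    then obtain T where ws: "length ws = Suc n" "distinct ws" and T: "T \<in> L" "set ws = vertices T"
      by (auto simp: ordered_simplices_def)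
    \<comment> \<open>Having \<open>Suc n\<close> vertices rules out the empty simplex, which has no
      interior point.\<close>
    have "set ws \<noteq> {}" using ws(1) by auto
    then have "T \<noteq> {}" using T(2) by (auto simp: vertices_def extreme_point_of_def)
    moreover have "convex T" using L_simplex(2)[OF T(1)] convex_convex_hull by metis
    \<comment> \<open>Lifting one interior point of \<open>T\<close> lifts the simplex: the vertices
      of the carrier of a preimage map bijectively onto those of \<open>T\<close>.\<close>
    ultimately obtain y where y: "y \<in> rel_interior T" using rel_interior_eq_empty by blast
    then have "y \<in> \<Union>L" using T(1) rel_interior_subset by blast
    then have "y \<in> f ` (\<Union>K)" by (simp only: onto)
    then obtain x where x: "x \<in> \<Union>K" "f x = y" by blast
    let ?S = "carrier_simplex K x"
    have "carrier_simplex L y = T" by (rule carrier_simplex_eq[OF L T(1) y])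
    then have V: "set ws = f ` vertices ?S" using carrier_simplex_image(3)[OF x(1)] x(2) T(2) by simp
    let ?us = "map (inv_into (vertices ?S) f) ws"
    have "f (inv_into (vertices ?S) f w) = w" if "w \<in> set ws" for w
      using f_inv_into_f[of w f "vertices ?S"] that V by simp
    then have "map f ?us = ws" by (simp add: map_idI)
    moreover have "distinct ?us" using ws(2) V by (simp add: distinct_map inj_on_inv_into)
    moreover have "set ?us = vertices ?S"
      using carrier_simplex_image(4)[OF x(1)] by (simp add: V inv_into_image_cancel)
    ultimately show "ws \<in> map f ` ordered_simplices (vertices ` K) n"
      using ws(1) carrier_simplex_image(1)[OF x(1)] by (intro image_eqI[of _ _ ?us]) (auto simp: ordered_simplices_def)
  qed
qed

text \<open>The tuple over \<open>w\<close> picks, in the carrier of each \<open>x l\<close>, the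
  unique vertex above \<open>w\<close>. So column \<open>l\<close> lists the vertices of that
  carrier without repetition, and all columns have the same image.\<close>

lemma ordered_simplex_in_fibre_power:
  assumes x: "x \<in> W_space (\<Union>K) f k" and k: "1 \<le> k"
    and vs: "length vs = Suc n" "distinct vs" "set vs = multi_simplex_vertices K L f k x"
  shows "vs \<in> FP n k"
proof -
  define T where "T = carrier_simplex L (f (x 1))"
  define S where "S l = carrier_simplex K (x l)" for l
  define t where "t w = (\<lambda>l\<in>{1..k}. THE v. v \<in> vertices (S l) \<and> f v = w)" for w
  have set_vs: "set vs = t ` vertices T" using vs(3) by (simp add: multi_simplex_vertices_def t_def S_def T_def)
  have S: "S l \<in> K" "vertices T = f ` vertices (S l)" "inj_on f (vertices (S l))" if "l \<in> {1..k}" for l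
  proof -
    have xl: "x l \<in> \<Union>K" "f (x l) = f (x 1)" using W_space_mem[OF x that] W_space_eq[OF x that, of 1] k by simp_all
    then show "S l \<in> K" "vertices T = f ` vertices (S l)" "inj_on f (vertices (S l))"
      using carrier_simplex_image[OF xl(1)] by (simp_all add: S_def T_def)
  qed
  have t: "t (f v) l = v" if "l \<in> {1..k}" "v \<in> vertices (S l)" for v l
  proof -
    have "(THE u. u \<in> vertices (S l) \<and> f u = f v) = v"
      using that(2) inj_onD[OF S(3)[OF that(1)]] by (intro the_equality) blast+
    then show ?thesis using that(1) by (simp add: t_def)
  qed
  have t': "t w l \<in> vertices (S l)" "f (t w l) = w" if l: "l \<in> {1..k}" and w: "w \<in> vertices T" for w l
  proof -
    obtain v where "v \<in> vertices (S l)" "w = f v" using S(2)[OF l] w by blast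
    then show "t w l \<in> vertices (S l)" "f (t w l) = w" using t[OF l] by simp_all
  qed
  show ?thesis
  proof (rule fibre_powerI)
    show "set vs \<subseteq> extensional {1..k}" unfolding set_vs by (auto simp: t_def)
  next
    fix l assume l: "l \<in> {1..k}"
    have "inj_on (\<lambda>v. v l) (set vs)" unfolding set_vs
    proof (rule inj_onI)
      fix v v' assume v: "v \<in> t ` vertices T" "v' \<in> t ` vertices T" "v l = v' l"
      then obtain w w' where w: "v = t w" "w \<in> vertices T" "v' = t w'" "w' \<in> vertices T" by blast
      have "f (v l) = w" "f (v' l) = w'"
        unfolding w(1,3) by (rule t'(2)[OF l w(2)], rule t'(2)[OF l w(4)])
      then have "w = w'" using v(3) by metis
      then show "v = v'" using w(1,3) by metis
    qed
    moreover have "(\<lambda>v. v l) ` set vs = vertices (S l)"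
    proof (intro equalityI subsetI)
      fix u assume "u \<in> vertices (S l)"
      then have "u = t (f u) l" "t (f u) \<in> set vs" using t[OF l] S(2)[OF l] set_vs by auto
      then show "u \<in> (\<lambda>v. v l) ` set vs" by (rule image_eqI)
    qed (use t'(1)[OF l] set_vs in auto)
    ultimately show "map (\<lambda>v. v l) vs \<in> ordered_simplices (vertices ` K) n"
      using vs S(1)[OF l] by (simp add: ordered_simplices_def distinct_map)
    have "f (v l) = f (v 1)" if v: "v \<in> set vs" for v
    proof -
      obtain w where w: "v = t w" "w \<in> vertices T" using v set_vs by blast
      have "1 \<in> {1..k}" using k by simp
      from t'(2)[OF this w(2)] show ?thesis unfolding w(1) t'(2)[OF l w(2)] by (rule sym)
    qed
    then show "map f (map (\<lambda>v. v l) vs) = base vs" by simp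
  qed
qed

text \<open>All columns span simplices with the same image \<open>T\<close>; an interior point
  \<open>y\<close> of \<open>T\<close> has a preimage in the relative interior of each, and these
  preimages form \<open>x\<close>. The last clause, read in contrapositive, turns distinct columns
  into distinct coordinates.\<close>

lemma fibre_power_from_point:
  assumes vs: "vs \<in> FP n k" and k: "1 \<le> k"
  obtains x where "x \<in> W_space (\<Union>K) f k" "multi_simplex_vertices K L f k x = set vs"
    and "\<And>l m. l \<in> {1..k} \<Longrightarrow> m \<in> {1..k} \<Longrightarrow> x l = x m \<Longrightarrow> map (\<lambda>v. v l) vs = map (\<lambda>v. v m) vs"
proof -
  have base: "f (v l) = f (v 1)" if "v \<in> set vs" "l \<in> {1..k}" for v l
    using fibre_powerD(3)[OF vs that(2)] that(1) by (auto simp: map_eq_conv)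
  have "\<exists>S\<in>K. vertices S = (\<lambda>v. v l) ` set vs" if "l \<in> {1..k}" for l
    using fibre_powerD(2)[OF vs that] by (auto simp: ordered_simplices_def)
  then obtain S where S: "\<And>l. l \<in> {1..k} \<Longrightarrow> S l \<in> K" "\<And>l. l \<in> {1..k} \<Longrightarrow> vertices (S l) = (\<lambda>v. v l) ` set vs"
    by metis
  define T where "T = convex hull (set (base vs))"
  have fS: "f ` S l = T" if "l \<in> {1..k}" for l
  proof -
    have "f ` vertices (S l) = set (base vs)" using S(2)[OF that] base[OF _ that] by (auto simp: image_image)
    then show ?thesis using image_simplex(1)[OF S(1)[OF that]] by (simp add: T_def)
  qed
  have one: "1 \<in> {1..k}" using k by auto
  have T: "T \<in> L" using image_simplex(2)[OF S(1)[OF one]] fS[OF one] by simp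
  have vT: "vertices T = set (base vs)"
    using image_simplex(3)[OF S(1)[OF one]] fS[OF one] S(2)[OF one] by (simp add: image_image)
  have "T \<noteq> {}" using FP_length[OF vs k] by (auto simp: T_def)
  then obtain y where y: "y \<in> rel_interior T" using rel_interior_eq_empty[of T] by (auto simp: T_def)
  have "\<exists>z\<in>rel_interior (S l). f z = y" if "l \<in> {1..k}" for l
    using y image_simplex(4)[OF S(1)[OF that]] fS[OF that] by (metis imageE)
  then obtain z where z: "\<And>l. l \<in> {1..k} \<Longrightarrow> z l \<in> rel_interior (S l)" "\<And>l. l \<in> {1..k} \<Longrightarrow> f (z l) = y"
    by metis
  define x where "x = (\<lambda>l\<in>{1..k}. z l)"
  have cS: "carrier_simplex K (x l) = S l" if "l \<in> {1..k}" for l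
    using carrier_simplex_eq[OF K S(1)[OF that] z(1)[OF that]] that by (simp add: x_def)
  have cT: "carrier_simplex L (f (x 1)) = T"
    using carrier_simplex_eq[OF L T y] z(2)[OF one] one by (simp add: x_def)
  have inj: "u = u'" if "l \<in> {1..k}" "u \<in> vertices (S l)" "u' \<in> vertices (S l)" "f u = f u'" for l u u'
    using inj_on_simplex[OF S(1)[OF that(1)]] vertices_subset[OF S(1)[OF that(1)]] that by (auto dest: inj_onD)
  show thesis
  proof
    show "x \<in> W_space (\<Union>K) f k"
      using z S(1) rel_interior_subset by (fastforce simp: W_space_def x_def)
    have "(\<lambda>l\<in>{1..k}. THE u. u \<in> vertices (carrier_simplex K (x l)) \<and> f u = f (v 1)) = v" if v: "v \<in> set vs" for v
    proof
      fix l
      show "(\<lambda>l\<in>{1..k}. THE u. u \<in> vertices (carrier_simplex K (x l)) \<and> f u = f (v 1)) l = v l"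
      proof (cases "l \<in> {1..k}")
        case True
        then have "(THE u. u \<in> vertices (S l) \<and> f u = f (v 1)) = v l"
          using S(2)[OF True] base[OF v True] v inj[OF True] by (intro the_equality) auto
        then show ?thesis using True cS[OF True] by simp
      next
        case False
        have "v \<in> extensional {1..k}" using fibre_powerD(1)[OF vs] v by blast
        then show ?thesis using False extensional_arb[of v "{1..k}" l] by auto
      qed
    qed
    then show "multi_simplex_vertices K L f k x = set vs"
      unfolding multi_simplex_vertices_def cT vT by (simp add: image_image)
    fix l m assume lm: "l \<in> {1..k}" "m \<in> {1..k}" "x l = x m"
    \<comment> \<open>A point determines its carrier; injectivity of \<open>f\<close> there then
      determines the vertex over each vertex of \<open>T\<close>.\<close>
    then have "S l = S m" using cS by metis
    have "v l = v m" if "v \<in> set vs" for v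
    proof (rule inj[OF lm(1)])
      show "v l \<in> vertices (S l)" using S(2)[OF lm(1)] that by blast
      show "v m \<in> vertices (S l)" unfolding \<open>S l = S m\<close> S(2)[OF lm(2)] using that by blast
      show "f (v l) = f (v m)" by (rule trans[OF base[OF that lm(1)] base[OF that lm(2), symmetric]])
    qed
    then show "map (\<lambda>v. v l) vs = map (\<lambda>v. v m) vs" by simp
  qed
qed

lemma distinct_fibre_power:
  assumes "vs \<in> FP n k" "1 \<le> k" shows "distinct vs"
proof -
  have "distinct (map (\<lambda>v. v 1) vs)"
    using fibre_powerD(2)[OF assms(1), of 1] assms(2) by (simp add: ordered_simplices_def)
  then show ?thesis by (simp add: distinct_map)
qed

lemma ordered_W_simplices:
  assumes "1 \<le> k" shows "ordered_simplices (W_simplices K L f k) n = FP n k"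
proof (intro equalityI subsetI)
  fix vs assume "vs \<in> ordered_simplices (W_simplices K L f k) n"
  then show "vs \<in> FP n k"
    using ordered_simplex_in_fibre_power[OF _ assms] by (auto simp: ordered_simplices_def W_simplices_def)
next
  fix vs assume vs: "vs \<in> FP n k"
  obtain x where "x \<in> W_space (\<Union>K) f k" "multi_simplex_vertices K L f k x = set vs"
    using fibre_power_from_point[OF vs assms] by metis
  then have "set vs \<in> W_simplices K L f k" unfolding W_simplices_def by (metis imageI)
  then show "vs \<in> ordered_simplices (W_simplices K L f k) n"
    using FP_length[OF vs assms] distinct_fibre_power[OF vs assms] by (simp add: ordered_simplices_def)
qed

lemma ordered_D_simplices_subset:
  assumes "1 \<le> k" shows "ordered_simplices (D_simplices K L f k) n \<subseteq> FP n k"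
  unfolding ordered_W_simplices[OF assms, symmetric]
  using D_space_subset_W_space by (auto simp: ordered_simplices_def D_simplices_def W_simplices_def)

text \<open>With distinct columns the point from \<open>fibre_power_from_point\<close> has distinct
  coordinates, so it lies in the set whose closure is \<open>D_space\<close>.\<close>

lemma ordered_D_simplexI:
  assumes vs: "vs \<in> FP n k" "1 \<le> k"
    and cols: "\<And>l m. l \<in> {1..k} \<Longrightarrow> m \<in> {1..k} \<Longrightarrow> l \<noteq> m \<Longrightarrow> map (\<lambda>v. v l) vs \<noteq> map (\<lambda>v. v m) vs"
  shows "vs \<in> ordered_simplices (D_simplices K L f k) n"
proof -
  obtain x where x: "x \<in> W_space (\<Union>K) f k" "multi_simplex_vertices K L f k x = set vs"
    and inj: "\<And>l m. l \<in> {1..k} \<Longrightarrow> m \<in> {1..k} \<Longrightarrow> x l = x m \<Longrightarrow> map (\<lambda>v. v l) vs = map (\<lambda>v. v m) vs"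
    using fibre_power_from_point[OF vs] by metis
  let ?I = "{x \<in> W_space (\<Union>K) f k. inj_on x {1..k}}"
  have "x \<in> ?I" using x(1) inj cols by (blast intro: inj_onI)
  moreover have "?I \<subseteq> topspace (product_topology (\<lambda>_. top_of_set (\<Union>K)) {1..k})"
    by (auto simp: W_space_def)
  ultimately have "x \<in> D_space (\<Union>K) f k" unfolding D_space_def using closure_of_subset by blast
  then have "set vs \<in> D_simplices K L f k" unfolding D_simplices_def using x(2) by (metis imageI)
  then show ?thesis
    using FP_length[OF vs] distinct_fibre_power[OF vs] by (simp add: ordered_simplices_def)
qed

end

text \<open>Injectivity prevents other keys from contributing to the coefficient of
  \<open>map g vs\<close>.\<close>

lemma lookup_simp_chain_map:
  assumes "inj_on (map g) (insert vs (Poly_Mapping.keys c))"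
  shows "Poly_Mapping.lookup (simp_chain_map g c) (map g vs) = Poly_Mapping.lookup c vs"
proof -
  have "Poly_Mapping.lookup (simp_chain_map g c) (map g vs) =
    (\<Sum>us\<in>Poly_Mapping.keys c. Poly_Mapping.lookup c us * (if map g vs = map g us then 1 else 0))"
    by (simp add: simp_chain_map_def frag_extend_def lookup_sum del: map_eq_conv)
  also have "\<dots> = (\<Sum>us\<in>Poly_Mapping.keys c. if us = vs then Poly_Mapping.lookup c us else 0)"
    using assms by (intro sum.cong) (auto dest: inj_onD simp del: map_eq_conv)
  also have "\<dots> = Poly_Mapping.lookup c vs" by (simp add: sum.delta in_keys_iff)
  finally show ?thesis .
qed

text \<open>Exchanging two equal columns fixes \<open>vs\<close> but negates \<open>c\<close>, so
  the coefficient of \<open>vs\<close> is its own negative.\<close>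

lemma alternating_columns_distinct:
  assumes c: "alternating k c" "\<And>us. us \<in> Poly_Mapping.keys c \<Longrightarrow> set us \<subseteq> extensional {1..k}"
    and vs: "vs \<in> Poly_Mapping.keys c" and lm: "l \<in> {1..k}" "m \<in> {1..k}" "l \<noteq> m"
  shows "map (\<lambda>v. v l) vs \<noteq> map (\<lambda>v. v m) vs"
proof
  assume eq: "map (\<lambda>v. v l) vs = map (\<lambda>v. v m) vs"
  let ?\<tau> = "permute_components k (Transposition.transpose l m)"
  have perm: "Transposition.transpose l m permutes {1..k}" by (rule permutes_swap_id[OF lm(1,2)])
  have inv: "map ?\<tau> (map ?\<tau> us) = us" if "us \<in> Poly_Mapping.keys c" for us
  proof -
    have "?\<tau> (?\<tau> v) = v" if "v \<in> set us" for v
      using c(2)[OF \<open>us \<in> _\<close>] that permute_components_id[of v k]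
      by (auto simp: permute_components_permute_components[OF perm])
    then show ?thesis by (simp add: map_idI)
  qed
  have "?\<tau> v = v" if "v \<in> set vs" for v
  proof
    fix j
    have "v l = v m" "v \<in> extensional {1..k}" using eq that c(2)[OF vs] by auto
    then show "?\<tau> v j = v j"
      by (auto simp: permute_components_def Transposition.transpose_def extensional_def)
  qed
  then have fixed: "map ?\<tau> vs = vs" by (simp add: map_idI)
  \<comment> \<open>On extensional tuples \<open>?\<tau>\<close> is an involution.\<close>
  have "inj_on (map ?\<tau>) (insert vs (Poly_Mapping.keys c))"
    using inv vs by (metis inj_on_inverseI insert_absorb)
  then have "Poly_Mapping.lookup (simp_chain_map ?\<tau> c) vs = Poly_Mapping.lookup c vs"
    using lookup_simp_chain_map fixed by metis
  moreover have "simp_chain_map ?\<tau> c = - c" by (rule alternating_transpose[OF c(1) lm])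
  ultimately have "Poly_Mapping.lookup c vs = 0" by simp
  then show False using vs by (simp add: in_keys_iff)
qed

text \<open>The closure disappears from the description: keys of an alternating chain have distinct
  columns and so belong to \<open>D_simplices\<close>, while \<open>D_simplices\<close> never
  exceeds the fibre powers.\<close>

lemma (in finite_simplicial_map) D_alt_chains_eq:
  assumes k: "1 \<le> k"
  shows "D_alt_chains K L f k n =
    \<lparr>carrier = {c. Poly_Mapping.keys c \<subseteq> FP n k \<and> alternating k c}, monoid.mult = (+), one = 0\<rparr>"
proof -
  have "Poly_Mapping.keys c \<subseteq> ordered_simplices (D_simplices K L f k) n"
    if c: "Poly_Mapping.keys c \<subseteq> FP n k" "alternating k c" for c
  proof
    fix vs assume vs: "vs \<in> Poly_Mapping.keys c"
    show "vs \<in> ordered_simplices (D_simplices K L f k) n"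
    proof (rule ordered_D_simplexI[OF _ k])
      show "vs \<in> FP n k" using vs c by blast
      show "map (\<lambda>v. v l) vs \<noteq> map (\<lambda>v. v m) vs" if "l \<in> {1..k}" "m \<in> {1..k}" "l \<noteq> m" for l m
      proof (rule alternating_columns_distinct[OF c(2) _ vs that])
        show "set us \<subseteq> extensional {1..k}" if "us \<in> Poly_Mapping.keys c" for us
          using that c(1) fibre_powerD(1) by blast
      qed
    qed
  qed
  then have "{c. Poly_Mapping.keys c \<subseteq> ordered_simplices (D_simplices K L f k) n \<and> alternating k c} =
      {c. Poly_Mapping.keys c \<subseteq> FP n k \<and> alternating k c}"
    using order_trans[OF _ ordered_D_simplices_subset[OF k]] by (intro Collect_cong) metis
  then show ?thesis
    unfolding D_alt_chains_def simp_chain_group_def free_Abelian_group_def Let_def alternating_def[symmetric]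
    by simp
qed

theorem proposition3p1:
  fixes K :: "'a::euclidean_space set set"
    and L :: "'b::euclidean_space set set"
    and f :: "'a \<Rightarrow> 'b"
    and C :: "nat \<Rightarrow> nat \<Rightarrow> ((nat \<Rightarrow> 'a) list \<Rightarrow>\<^sub>0 int) monoid"
    and d' d'' :: "nat \<Rightarrow> nat \<Rightarrow> ((nat \<Rightarrow> 'a) list \<Rightarrow>\<^sub>0 int) \<Rightarrow> ((nat \<Rightarrow> 'a) list \<Rightarrow>\<^sub>0 int)"
  assumes "locally_finite_complex K" and "locally_finite_complex L"
    and "simplicial_map K L f"
    and "f ` (\<Union>K) = \<Union>L"
    and "\<And>y. y \<in> \<Union>L \<Longrightarrow> finite {x \<in> \<Union>K. f x = y}"
    and "(C = (\<lambda>p q. W_chains K L f (q + 1) p) \<and>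
          d' = (\<lambda>p q. simp_boundary p) \<and>
          d'' = (\<lambda>p q. if q = 0 then (\<lambda>c. 0) else rho (q + 1) p)) \<or>
         (C = (\<lambda>p q. D_alt_chains K L f (q + 1) p) \<and>
          d' = (\<lambda>p q. simp_boundary p) \<and>
          d'' = (\<lambda>p q. if q = 0 then (\<lambda>c. 0) else eps (q + 1) p))"
  shows "double_complex C d' d''
    \<and> (\<forall>p q. q \<noteq> 0 \<longrightarrow> trivial_group (first_E C d' d'' 2 p q))
    \<and> (\<forall>n. first_E C d' d'' 2 n 0 \<cong> homology_at (Tot C) (Tot_d C d' d'') n
         \<and> homology_at (Tot C) (Tot_d C d' d'') n
             \<cong> homology_at (simp_chain_group (vertices ` L)) simp_boundary n)"
proof -
  interpret F: finite_simplicial_map K L f by unfold_locales (use assms in auto)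
  have "(\<lambda>p q. W_chains K L f (q + 1) p) = (\<lambda>p q. free_Abelian_group (F.FP p (q + 1)))"
    by (intro ext) (simp add: W_chains_def simp_chain_group_def F.ordered_W_simplices)
  moreover have "(\<lambda>p q. D_alt_chains K L f (q + 1) p) = (\<lambda>p q.
    \<lparr>carrier = {c. Poly_Mapping.keys c \<subseteq> F.FP p (q + 1) \<and> alternating (q + 1) c}, monoid.mult = (+), one = 0\<rparr>)"
    by (intro ext) (simp add: F.D_alt_chains_eq)
  \<comment> \<open>Both complexes have the same augmentation onto the chains of \<open>L\<close>,
    through the first component, so one interpretation serves both.\<close>
  ultimately have "augmented_double_complex C d' d'' (simp_chain_group (vertices ` L)) simp_boundary
    (\<lambda>p. simp_chain_map (\<lambda>v. f (v 1)))"
    using assms(6) F.augmented_double_complex_W F.augmented_double_complex_alternating by auto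
  then interpret A: augmented_double_complex C d' d'' "simp_chain_group (vertices ` L)" simp_boundary
    "\<lambda>p. simp_chain_map (\<lambda>v. f (v 1))" .
  show ?thesis
    using A.double_complex A.trivial_first_E2 A.first_E2_iso_homology_Tot A.homology_Tot_iso by blast
qed

end
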